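(* \textsc{Bicriteria $s,t$-Path} on $n$-vertex graphs can be solved in time $O(n^{\min\{\lambda,\chi\}+2})$, where $\lambda$ is the number of distinct edge lengths and $\chi$ the number of distinct edge costs in the input graph. Moreover, assuming SETH, for any constants $\lambda,\chi\ge 2$ and any $\varepsilon>0$ there is no $O(n^{\min\{\lambda,\chi\}-1-\varepsilon})$-time algorithm for \textsc{Bicriteria $s,t$-Path} on instances with at most $\lambda$ distinct edge lengths and at most $\chi$ distinct edge costs.
   Context: \textsc{Bicriteria $s,t$-Path}: given a directed graph $G$ in which each edge $e$ has a non-negative integer length $\ell(e)$ and a non-negative integer cost $c(e)$, two vertices $s,t$, and non-negative integer budgets $L$ and $C$, decide whether there is an $s,t$-path $e_1,\dots,e_r$ with $\sum_i \ell(e_i)\le L$ and $\sum_i c(e_i)\le C$. SETH: for every $\varepsilon>0$ there exists $k\ge 3$ such that $k$-SAT on $n$ variables cannot be solved in time $O(2^{(1-\varepsilon)n})$. *)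

theory Defs
  imports Complex_Main "Graph_Theory.Pair_Digraph"
begin

section \<open>Word RAM\<close>

text \<open>
  A word RAM with finitely many registers per program, a random access memory with one word per
  cell, and unit-cost instructions. Programs are kept in structured form; a program with jumps can
  be put into this form (one loop that dispatches on the program counter) at the price of a
  constant factor that depends only on the program.
\<close>

datatype operand = Imm nat | Reg nat

datatype binop = Add | Sub | Mul | Div | Mod | And | Or | Xor | Shl | Shr

datatype test = Less operand operand | Equal operand operand

datatype com =
    Skip
  | Op nat binop operand operand
  | Load nat operand
  | Store operand operand
  | Seq com com
  | If test com com
  | While test com

record state =
  reg :: "nat \<Rightarrow> nat"
  mem :: "nat \<Rightarrow> nat"

primrec val :: "state \<Rightarrow> operand \<Rightarrow> nat" where
  "val \<sigma> (Imm k) = k"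
| "val \<sigma> (Reg r) = reg \<sigma> r"

context
  includes bit_operations_syntax
begin

text \<open>Subtraction is truncated at 0, and division by 0 yields 0.\<close>

primrec apply_op :: "binop \<Rightarrow> nat \<Rightarrow> nat \<Rightarrow> nat" where
  "apply_op Add x y = x + y"
| "apply_op Sub x y = x - y"
| "apply_op Mul x y = x * y"
| "apply_op Div x y = x div y"
| "apply_op Mod x y = x mod y"
| "apply_op And x y = x AND y"
| "apply_op Or x y = x OR y"
| "apply_op Xor x y = x XOR y"
| "apply_op Shl x y = push_bit y x"
| "apply_op Shr x y = drop_bit y x"

end

primrec holds :: "state \<Rightarrow> test \<Rightarrow> bool" where
  "holds \<sigma> (Less a b) \<longleftrightarrow> val \<sigma> a < val \<sigma> b"
| "holds \<sigma> (Equal a b) \<longleftrightarrow> val \<sigma> a = val \<sigma> b"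

text \<open>
  \<open>run w p \<sigma> t \<sigma>'\<close>: with words of \<open>w\<close> bits, \<open>p\<close> started in \<open>\<sigma>\<close> halts after exactly \<open>t\<close> steps in \<open>\<sigma>'\<close>.
  Overflow is not wrapped around: an instruction that would produce a value or use an address
  of more than \<open>w\<close> bits has no transition, so such a run does not count as halting.
\<close>

inductive run :: "nat \<Rightarrow> com \<Rightarrow> state \<Rightarrow> nat \<Rightarrow> state \<Rightarrow> bool" for w :: nat where
  Skip: "run w Skip \<sigma> 1 \<sigma>"
| Op: "x = apply_op f (val \<sigma> a) (val \<sigma> b) \<Longrightarrow> x < 2 ^ w \<Longrightarrow>
    run w (Op r f a b) \<sigma> 1 (\<sigma>\<lparr>reg := (reg \<sigma>)(r := x)\<rparr>)"
| Load: "val \<sigma> a < 2 ^ w \<Longrightarrow> mem \<sigma> (val \<sigma> a) < 2 ^ w \<Longrightarrow>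
    run w (Load r a) \<sigma> 1 (\<sigma>\<lparr>reg := (reg \<sigma>)(r := mem \<sigma> (val \<sigma> a))\<rparr>)"
| Store: "val \<sigma> a < 2 ^ w \<Longrightarrow> val \<sigma> b < 2 ^ w \<Longrightarrow>
    run w (Store a b) \<sigma> 1 (\<sigma>\<lparr>mem := (mem \<sigma>)(val \<sigma> a := val \<sigma> b)\<rparr>)"
| Seq: "run w p \<sigma> t \<sigma>' \<Longrightarrow> run w q \<sigma>' t' \<sigma>'' \<Longrightarrow> run w (Seq p q) \<sigma> (t + t') \<sigma>''"
| IfTrue: "holds \<sigma> b \<Longrightarrow> run w p \<sigma> t \<sigma>' \<Longrightarrow> run w (If b p q) \<sigma> (1 + t) \<sigma>'"
| IfFalse: "\<not> holds \<sigma> b \<Longrightarrow> run w q \<sigma> t \<sigma>' \<Longrightarrow> run w (If b p q) \<sigma> (1 + t) \<sigma>'"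
| WhileFalse: "\<not> holds \<sigma> b \<Longrightarrow> run w (While b p) \<sigma> 1 \<sigma>"
| WhileTrue: "holds \<sigma> b \<Longrightarrow> run w p \<sigma> t \<sigma>' \<Longrightarrow> run w (While b p) \<sigma>' t' \<sigma>'' \<Longrightarrow>
    run w (While b p) \<sigma> (1 + t + t') \<sigma>''"

lemma run_deterministic:
  assumes "run w p \<sigma> t \<sigma>'" "run v p \<sigma> u \<tau>"
  shows "t = u \<and> \<sigma>' = \<tau>"
  using assms
proof (induction arbitrary: u \<tau> rule: run.induct)
  case (Seq p \<sigma> t \<sigma>' q t' \<sigma>'')
  from Seq.prems show ?case by (cases rule: run.cases) (use Seq.IH in blast)+
next
  case (WhileTrue \<sigma> b p t \<sigma>' t' \<sigma>'')
  from WhileTrue.prems show ?case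
    by (cases rule: run.cases) (use WhileTrue in blast)+
qed (erule run.cases; auto)+

definition initial :: "nat list \<Rightarrow> state" where
  "initial xs = \<lparr>reg = (\<lambda>_. 0), mem = (\<lambda>a. if a < length xs then xs ! a else 0)\<rparr>"

text \<open>
  The decision problem with instance set \<open>X\<close> and set \<open>{x. yes x}\<close> of yes-instances can be solved in
  time \<open>O(T x)\<close>. One program and one constant serve all of \<open>X\<close>, on which its behaviour must be
  correct; \<open>enc x xs\<close> says that \<open>xs\<close> is an admissible way of writing \<open>x\<close> into memory. As usual for the
  word RAM, a word has \<open>O(log N)\<close> bits, where \<open>N\<close> is the largest among the input size, the
  numbers in the input and the running time. The answer is left in register 0.
\<close>

definition solvable_in_time ::
  "('i \<Rightarrow> nat list \<Rightarrow> bool) \<Rightarrow> 'i set \<Rightarrow> ('i \<Rightarrow> bool) \<Rightarrow> ('i \<Rightarrow> real) \<Rightarrow> bool" where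
  "solvable_in_time enc X yes T \<longleftrightarrow>
    (\<exists>(p :: com) (c :: real). \<forall>x\<in>X. \<forall>xs. enc x xs \<longrightarrow>
      (\<exists>w t \<sigma>. run w p (initial xs) t \<sigma> \<and>
        real t \<le> c * T x \<and>
        real w \<le> c * log 2 (2 + real (length xs) + real (Max (insert 0 (set xs))) + T x) \<and>
        reg \<sigma> 0 = (if yes x then 1 else 0)))"


section \<open>Satisfiability and SETH\<close>

text \<open>
  An instance is a pair \<open>(n, F)\<close> of a number of variables and a set of clauses; the literal \<open>(x, b)\<close>
  is true iff \<open>x\<close> has value \<open>b\<close>. As clauses are not repeated, the size of the input is polynomial
  in \<open>n\<close> for fixed \<open>k\<close>; otherwise a time bound in terms of \<open>n\<close> alone would make no sense.
\<close>

type_synonym literal = "nat \<times> bool"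
type_synonym cnf = "literal set set"

definition ksat_instances :: "nat \<Rightarrow> (nat \<times> cnf) set" where
  "ksat_instances k = {(n, F). \<forall>C\<in>F. C \<subseteq> {..<n} \<times> UNIV \<and> card C \<le> k}"

definition satisfiable :: "nat \<times> cnf \<Rightarrow> bool" where
  "satisfiable = (\<lambda>(n, F). \<exists>\<alpha> :: nat \<Rightarrow> bool. \<forall>C\<in>F. \<exists>(x, b)\<in>C. \<alpha> x = b)"

definition literal_code :: "literal \<Rightarrow> nat" where
  "literal_code = (\<lambda>(x, b). 2 * x + of_bool b)"

definition ksat_encoding :: "nat \<times> cnf \<Rightarrow> nat list \<Rightarrow> bool" where
  "ksat_encoding = (\<lambda>(n, F) xs. \<exists>Cs.
    distinct (map set Cs) \<and> (\<forall>C\<in>set Cs. distinct C) \<and> F = set (map set Cs) \<and>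
    xs = [n, length Cs] @ concat (map (\<lambda>C. length C # map literal_code C) Cs))"

definition SETH :: bool where
  "SETH \<longleftrightarrow> (\<forall>\<epsilon>::real. \<epsilon> > 0 \<longrightarrow> (\<exists>k\<ge>3. \<not> solvable_in_time ksat_encoding
    (ksat_instances k) satisfiable (\<lambda>(n, F). 2 powr ((1 - \<epsilon>) * real n))))"


section \<open>Bicriteria paths\<close>

record bicriteria =
  graph :: "nat pair_pre_digraph"
  edge_length :: "nat \<times> nat \<Rightarrow> nat"
  edge_cost :: "nat \<times> nat \<Rightarrow> nat"
  source :: nat
  target :: nat
  length_budget :: nat
  cost_budget :: nat

definition num_verts :: "bicriteria \<Rightarrow> nat" where
  "num_verts I = card (pverts (graph I))"

definition num_lengths :: "bicriteria \<Rightarrow> nat" where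
  "num_lengths I = card (edge_length I ` parcs (graph I))"

definition num_costs :: "bicriteria \<Rightarrow> nat" where
  "num_costs I = card (edge_cost I ` parcs (graph I))"

text \<open>For the sake of the input encoding, the vertices are numbered \<open>0, \<dots>, n - 1\<close>.\<close>

definition bicriteria_instances :: "bicriteria set" where
  "bicriteria_instances = {I. pair_fin_digraph (graph I) \<and> pverts (graph I) = {..<num_verts I} \<and>
    source I \<in> pverts (graph I) \<and> target I \<in> pverts (graph I)}"

definition has_bicriteria_path :: "bicriteria \<Rightarrow> bool" where
  "has_bicriteria_path I \<longleftrightarrow>
    (\<exists>p. pre_digraph.apath (with_proj (graph I)) (source I) p (target I) \<and>
      (\<Sum>e\<leftarrow>p. edge_length I e) \<le> length_budget I \<and> (\<Sum>e\<leftarrow>p. edge_cost I e) \<le> cost_budget I)"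

text \<open>The graph is given as a list of its edges, in any order.\<close>

definition bicriteria_encoding :: "bicriteria \<Rightarrow> nat list \<Rightarrow> bool" where
  "bicriteria_encoding I xs \<longleftrightarrow> (\<exists>es.
    distinct es \<and> set es = parcs (graph I) \<and>
    xs = [num_verts I, length es, source I, target I, length_budget I, cost_budget I] @
      concat (map (\<lambda>e. [fst e, snd e, edge_length I e, edge_cost I e]) es))"

end

theory Submission
  imports Defs "HOL-Real_Asymp.Real_Asymp"
begin

text \<open>
  Upper bound: let \<open>k\<close> be the smaller of the numbers of distinct lengths and distinct costs, say of the lengths.
  The length of a path is determined by how often each of the \<open>k\<close> lengths occurs, so it suffices to know, for
  every vector of multiplicities and every vertex, the cheapest way to arrive there: a table with \<open>n ^ (k + 1)\<close>
  entries. The distinct weights are discovered alternately for lengths and costs, one pass per weight, so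
  that this phase also stops after \<open>k + 1\<close> passes.

  Lower bound for two weights: on a path with budgets 0 every edge length matters, but a sublinear
  algorithm cannot read all of them.

  Lower bound for \<open>d \<ge> 3\<close> weights: the variables of a CNF formula with \<open>M\<close> clauses are split into \<open>P = (d - 1) D\<close>
  blocks with at most \<open>q = 2 ^ (n / P + 1)\<close> assignments each. A ladder has an upper pair of rails of a certain length
  and a lower pair of rails of the same cost, and the place where a path drops down encodes an assignment
  of a block. There is one round of ladders for each clause, in which a path can only pass if some block
  satisfies the clause, and one extra round as a reference. The two budgets together fix the sum of all
  positions. The weights of the ladders are powers \<open>B ^ g\<close> for \<open>g < d - 1\<close>, so the sum splits into \<open>d - 1\<close> sums over \<open>D\<close>
  blocks each, and these split further since the codes of the blocks are written to separate digits
  in base \<open>Q\<close>. By strict convexity of the codes, the clause rounds must use the assignment of the reference round.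
  There are about \<open>q ^ (D + 2)\<close> vertices, that is \<open>2 ^ (n (1 + 2 / D) / (d - 1))\<close>, up to polynomial factors.
\<close>

section \<open>Weakest preconditions for the word RAM\<close>

text \<open>The budgets are mere upper bounds, yet the reduction needs an equation. It gets one
  because each of the \<open>H\<close> positions of a ladder is paid exactly once, as length before
  the drop or as cost after it: length plus cost is the same for all paths through all ladders, and
  the two budgets add up to exactly this total. The reference round drops at
  \<open>H - M * code\<close>, so a path that repeats one assignment in all rounds meets the budgets
  whatever the assignment is. Conversely, the digits of the codes reveal only the sum over the
  rounds for each block; the squares, collected in one common leading digit, turn this into a
  vanishing variance. That digit ranges up to about \<open>q ^ 2\<close> and is the price: the
  exponent is \<open>(D + 2) / P\<close> instead of \<open>D / P\<close>, which a large
  \<open>D\<close> compensates. One of the \<open>d\<close> weights is 0, for edges that must be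
  free, so \<open>d - 1\<close> powers of \<open>B\<close> remain. For \<open>d = 2\<close> the
  exponent to be excluded is below 1, where a reduction is useless because writing the instance
  already takes linear time; hence the separate, unconditional argument.\<close>

definition wp :: "nat \<Rightarrow> com \<Rightarrow> (nat \<Rightarrow> state \<Rightarrow> bool) \<Rightarrow> state \<Rightarrow> bool" where
  "wp w c Q \<sigma> \<longleftrightarrow> (\<exists>t \<sigma>'. run w c \<sigma> t \<sigma>' \<and> Q t \<sigma>')"

text \<open>The second copy has the step counts in the \<open>Suc\<close> form into which the
  simplifier turns \<open>1\<close> and \<open>1 + t\<close>, so that the rules still match after
  simplification.\<close>

lemmas run_intros = run.intros run.intros[unfolded plus_1_eq_Suc add_Suc, unfolded One_nat_def]

lemma wp_mono:
  assumes "wp w c Q \<sigma>" "\<And>t \<sigma>'. Q t \<sigma>' \<Longrightarrow> Q' t \<sigma>'"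
  shows "wp w c Q' \<sigma>"
  using assms by (auto simp: wp_def)

text \<open>Keeps the simplifier out of the postcondition, which it would otherwise rewrite before the state is known.\<close>

lemma wp_weak_cong [cong]: "c = c' \<Longrightarrow> \<sigma> = \<sigma>' \<Longrightarrow> wp w c Q \<sigma> = wp w c' Q \<sigma>'"
  by simp

text \<open>\<open>wp_Seq\<close> makes the simplifier execute a program symbolically. This rule
  cuts the execution at a chosen assertion, as is useful around loops and subprograms whose
  specification is already known.\<close>

lemma wp_SeqI:
  assumes "wp w p R \<sigma>" "\<And>t \<sigma>'. R t \<sigma>' \<Longrightarrow> wp w q (\<lambda>t'. Q (t + t')) \<sigma>'"
  shows "wp w (Seq p q) Q \<sigma>"
  using assms by (fastforce simp: wp_def intro: run.Seq)

lemma wp_Skip [simp]: "wp w Skip Q \<sigma> \<longleftrightarrow> Q 1 \<sigma>"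
  by (auto simp: wp_def elim: run.cases intro: run_intros)

lemma wp_Op [simp]: "wp w (Op r f a b) Q \<sigma> \<longleftrightarrow>
    apply_op f (val \<sigma> a) (val \<sigma> b) < 2 ^ w \<and>
    Q 1 (\<sigma>\<lparr>reg := (reg \<sigma>)(r := apply_op f (val \<sigma> a) (val \<sigma> b))\<rparr>)"
  by (auto simp: wp_def elim!: run.cases[of w "Op r f a b"] intro: run_intros)

lemma wp_Load [simp]: "wp w (Load r a) Q \<sigma> \<longleftrightarrow>
    val \<sigma> a < 2 ^ w \<and> mem \<sigma> (val \<sigma> a) < 2 ^ w \<and>
    Q 1 (\<sigma>\<lparr>reg := (reg \<sigma>)(r := mem \<sigma> (val \<sigma> a))\<rparr>)"
  by (auto simp: wp_def elim!: run.cases[of w "Load r a"] intro: run_intros)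

lemma wp_Store [simp]: "wp w (Store a b) Q \<sigma> \<longleftrightarrow>
    val \<sigma> a < 2 ^ w \<and> val \<sigma> b < 2 ^ w \<and>
    Q 1 (\<sigma>\<lparr>mem := (mem \<sigma>)(val \<sigma> a := val \<sigma> b)\<rparr>)"
  by (auto simp: wp_def elim!: run.cases[of w "Store a b"] intro: run_intros)

lemma wp_Seq [simp]: "wp w (Seq p q) Q \<sigma> \<longleftrightarrow> wp w p (\<lambda>t. wp w q (\<lambda>t'. Q (t + t'))) \<sigma>"
proof
  assume "wp w (Seq p q) Q \<sigma>"
  then obtain t \<sigma>' where "run w (Seq p q) \<sigma> t \<sigma>'" "Q t \<sigma>'" by (auto simp: wp_def)
  then show "wp w p (\<lambda>t. wp w q (\<lambda>t'. Q (t + t'))) \<sigma>"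
    by (cases rule: run.cases) (auto simp: wp_def)
qed (auto simp: wp_def intro: run_intros)

lemma wp_If [simp]: "wp w (If b p q) Q \<sigma> \<longleftrightarrow>
    (if holds \<sigma> b then wp w p (\<lambda>t. Q (1 + t)) \<sigma> else wp w q (\<lambda>t. Q (1 + t)) \<sigma>)"
proof
  assume "wp w (If b p q) Q \<sigma>"
  then obtain t \<sigma>' where "run w (If b p q) \<sigma> t \<sigma>'" "Q t \<sigma>'" by (auto simp: wp_def)
  then show "if holds \<sigma> b then wp w p (\<lambda>t. Q (1 + t)) \<sigma> else wp w q (\<lambda>t. Q (1 + t)) \<sigma>"
    by (cases rule: run.cases) (auto simp: wp_def)
qed (auto simp: wp_def split: if_splits intro: run_intros)

text \<open>Every loop below has a number of iterations that is determined on entry, so the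
  invariant is indexed by the iteration and takes over the role of a variant. Each iteration pays
  one step for the test on top of \<open>T\<close>; the last \<open>+ 1\<close> is the failing
  test.\<close>

lemma wp_While:
  assumes "I 0 \<sigma>"
    and "\<And>i \<tau>. i < n \<Longrightarrow> I i \<tau> \<Longrightarrow>
      holds \<tau> b \<and> wp w c (\<lambda>t \<tau>'. t \<le> T \<and> I (Suc i) \<tau>') \<tau>"
    and "\<And>\<tau>. I n \<tau> \<Longrightarrow> \<not> holds \<tau> b"
    and "\<And>t \<tau>. I n \<tau> \<Longrightarrow> t \<le> n * (T + 1) + 1 \<Longrightarrow> Q t \<tau>"
  shows "wp w (While b c) Q \<sigma>"
proof -
  have "\<exists>t \<tau>'. run w (While b c) \<tau> t \<tau>' \<and> I n \<tau>' \<and> t \<le> k * (T + 1) + 1"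
    if "k \<le> n" "I (n - k) \<tau>" for k \<tau>
    using that
  proof (induction k arbitrary: \<tau>)
    case 0
    then show ?case using assms(3)[of \<tau>] by (auto intro: run_intros)
  next
    case (Suc k)
    have "n - Suc k < n" using Suc.prems by simp
    from assms(2)[OF this Suc.prems(2)] obtain t \<tau>' where b: "holds \<tau> b" and
      r: "run w c \<tau> t \<tau>'" "t \<le> T" "I (Suc (n - Suc k)) \<tau>'"
      by (auto simp: wp_def)
    have "Suc (n - Suc k) = n - k" using Suc.prems by simp
    then obtain t' \<tau>'' where "run w (While b c) \<tau>' t' \<tau>''" "I n \<tau>''" "t' \<le> k * (T + 1) + 1"
      using Suc.IH[of \<tau>'] r(3) Suc.prems by auto
    moreover from this(1) have "run w (While b c) \<tau> (1 + t + t') \<tau>''"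
      by (rule run.WhileTrue[OF b r(1)])
    ultimately show ?case using r(2) by (intro exI[of _ "1 + t + t'"] exI[of _ \<tau>'']) auto
  qed
  from this[of n \<sigma>] assms(1) obtain t \<tau>' where
    "run w (While b c) \<sigma> t \<tau>'" "I n \<tau>'" "t \<le> n * (T + 1) + 1" by auto
  then show ?thesis using assms(4) by (auto simp: wp_def)
qed

text \<open>Overflow only blocks a transition and never alters a value, so a wider word preserves
  the run and its step count. This allows programs with different word sizes to be composed.\<close>

lemma run_mono:
  assumes "run w c \<sigma> t \<sigma>'" "w \<le> v"
  shows "run v c \<sigma> t \<sigma>'"
proof -
  have *: "x < 2 ^ v" if "x < 2 ^ w" for x :: nat
    using that assms(2) power_increasing[of w v "2::nat"] by linarith
  from assms(1) show ?thesis
  proof (induction rule: run.induct)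
    case WhileFalse
    then show ?case by (rule run.WhileFalse)
  next
    case WhileTrue
    then show ?case by (intro run.WhileTrue)
  qed (auto intro!: run_intros(1-7) intro: run_intros(10-16) *)
qed

section \<open>Registers left alone by a program, and cells read by a run\<close>

primrec written :: "com \<Rightarrow> nat set" where
  "written Skip = {}"
| "written (Op r f a b) = {r}"
| "written (Load r a) = {r}"
| "written (Store a b) = {}"
| "written (Seq p q) = written p \<union> written q"
| "written (If b p q) = written p \<union> written q"
| "written (While b p) = written p"

text \<open>The reduction has to hand over an all-zero register file, but a program can clear only
  finitely many registers; the others are zero because nothing writes to them.\<close>

lemma run_written: "run w c \<sigma> t \<sigma>' \<Longrightarrow> r \<notin> written c \<Longrightarrow> reg \<sigma>' r = reg \<sigma> r"
  by (induction rule: run.induct) auto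

text \<open>The simulation relation of the adversary argument: cells on which the two runs start out
  different may stay different, but no disagreement may spread to other cells or to the
  registers.\<close>

definition in_step :: "state \<Rightarrow> state \<Rightarrow> state \<Rightarrow> state \<Rightarrow> bool" where
  "in_step \<sigma> \<tau> \<sigma>' \<tau>' \<longleftrightarrow> reg \<tau>' = reg \<sigma>' \<and> (\<forall>a. mem \<tau> a = mem \<sigma> a \<longrightarrow> mem \<tau>' a = mem \<sigma>' a)"

text \<open>\<open>A\<close> contains the cells on whose initial contents the run depends. This is
  expressed through other runs of the same length, so the semantics need not record its
  accesses.\<close>

definition reads_only :: "nat \<Rightarrow> com \<Rightarrow> state \<Rightarrow> nat \<Rightarrow> state \<Rightarrow> nat set \<Rightarrow> bool" where
  "reads_only w c \<sigma> t \<sigma>' A \<longleftrightarrow> (\<forall>\<tau>. reg \<tau> = reg \<sigma> \<longrightarrow> (\<forall>a\<in>A. mem \<tau> a = mem \<sigma> a) \<longrightarrow>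
    (\<exists>\<tau>'. run w c \<tau> t \<tau>' \<and> in_step \<sigma> \<tau> \<sigma>' \<tau>'))"

lemma reads_onlyI:
  assumes "\<And>\<tau>. reg \<tau> = reg \<sigma> \<Longrightarrow> \<forall>a\<in>A. mem \<tau> a = mem \<sigma> a \<Longrightarrow> run w c \<tau> t (f \<tau>) \<and> in_step \<sigma> \<tau> \<sigma>' (f \<tau>)"
  shows "reads_only w c \<sigma> t \<sigma>' A"
  using assms unfolding reads_only_def by blast

lemma reads_onlyE:
  assumes "reads_only w c \<sigma> t \<sigma>' A" "reg \<tau> = reg \<sigma>" "\<forall>a\<in>A. mem \<tau> a = mem \<sigma> a"
  obtains \<tau>' where "run w c \<tau> t \<tau>'" "in_step \<sigma> \<tau> \<sigma>' \<tau>'"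
  using assms unfolding reads_only_def by auto

text \<open>The program \<open>c\<close> is arbitrary, so that the lemma serves sequences, loop
  iterations and, with a \<open>Skip\<close> that stands for the test, conditionals.\<close>

lemma reads_only_trans:
  assumes "reads_only w p \<sigma> t \<sigma>' A" "reads_only w q \<sigma>' t' \<sigma>'' B"
    and "\<And>\<tau> \<tau>' \<tau>''. reg \<tau> = reg \<sigma> \<Longrightarrow> run w p \<tau> t \<tau>' \<Longrightarrow> run w q \<tau>' t' \<tau>'' \<Longrightarrow> run w c \<tau> u \<tau>''"
  shows "reads_only w c \<sigma> u \<sigma>'' (A \<union> B)"
  unfolding reads_only_def
proof (intro allI impI)
  fix \<tau> :: state assume \<tau>: "reg \<tau> = reg \<sigma>" "\<forall>a\<in>A \<union> B. mem \<tau> a = mem \<sigma> a"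
  obtain \<tau>' where 1: "run w p \<tau> t \<tau>'" "in_step \<sigma> \<tau> \<sigma>' \<tau>'"
    using assms(1) \<tau> by (elim reads_onlyE[where \<tau> = \<tau>]) auto
  obtain \<tau>'' where 2: "run w q \<tau>' t' \<tau>''" "in_step \<sigma>' \<tau>' \<sigma>'' \<tau>''"
    using assms(2) 1(2) \<tau>(2) by (elim reads_onlyE[where \<tau> = \<tau>']) (auto simp: in_step_def)
  have "in_step \<sigma> \<tau> \<sigma>'' \<tau>''" using 1(2) 2(2) by (simp add: in_step_def)
  with assms(3)[OF \<tau>(1) 1(1) 2(1)] show "\<exists>\<tau>''. run w c \<tau> u \<tau>'' \<and> in_step \<sigma> \<tau> \<sigma>'' \<tau>''" by auto
qed

text \<open>A step loads at most one cell, and its address is computed from registers, on which the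
  two runs agree as long as the loaded cells agree.\<close>

lemma run_reads_only:
  assumes "run w c \<sigma> t \<sigma>'"
  shows "\<exists>A. finite A \<and> card A \<le> t \<and> reads_only w c \<sigma> t \<sigma>' A"
  using assms
proof (induction rule: run.induct)
  have val_eq: "val \<tau> a = val \<sigma> a" if "reg \<tau> = reg \<sigma>" for \<tau> \<sigma> :: state and a
    using that by (cases a) auto
  have holds_eq: "holds \<tau> b = holds \<sigma> b" if "reg \<tau> = reg \<sigma>" for \<tau> \<sigma> :: state and b
    using that by (cases b) (auto simp: val_eq[OF that])
  have join: "finite (A \<union> B) \<and> card (A \<union> B) \<le> t + t'"
    if "finite A" "card A \<le> t" "finite B" "card B \<le> t'" for A B :: "nat set" and t t'
    using that card_Un_le[of A B] by auto
  {
    case (Skip \<sigma>)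
    show ?case
      by (intro exI[of _ "{}"] conjI reads_onlyI[where f = "\<lambda>\<tau>. \<tau>"])
        (auto simp: in_step_def intro: run_intros(1,10))
  next
    case (Op x f \<sigma> a b r)
    have "run w (Op r f a b) \<tau> 1 (\<tau>\<lparr>reg := (reg \<tau>)(r := x)\<rparr>)" if "reg \<tau> = reg \<sigma>" for \<tau>
      using Op that by (intro run.Op) (simp_all add: val_eq[OF that])
    then show ?case
      by (intro exI[of _ "{}"] conjI reads_onlyI[where f = "\<lambda>\<tau>. \<tau>\<lparr>reg := (reg \<tau>)(r := x)\<rparr>"])
        (auto simp: in_step_def)
  next
    case (Load \<sigma> a r)
    have "run w (Load r a) \<tau> 1 (\<tau>\<lparr>reg := (reg \<tau>)(r := mem \<sigma> (val \<sigma> a))\<rparr>)"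
      if "reg \<tau> = reg \<sigma>" "mem \<tau> (val \<sigma> a) = mem \<sigma> (val \<sigma> a)" for \<tau>
      using Load that run.Load[of \<tau> a w r] by (simp add: val_eq[OF that(1)])
    then show ?case
      by (intro exI[of _ "{val \<sigma> a}"] conjI
          reads_onlyI[where f = "\<lambda>\<tau>. \<tau>\<lparr>reg := (reg \<tau>)(r := mem \<sigma> (val \<sigma> a))\<rparr>"])
        (auto simp: in_step_def)
  next
    case (Store \<sigma> a b)
    have "run w (Store a b) \<tau> 1 (\<tau>\<lparr>mem := (mem \<tau>)(val \<sigma> a := val \<sigma> b)\<rparr>)"
      if "reg \<tau> = reg \<sigma>" for \<tau>
      using Store that run.Store[of \<tau> a w b] by (simp add: val_eq[OF that])
    then show ?case
      by (intro exI[of _ "{}"] conjI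
          reads_onlyI[where f = "\<lambda>\<tau>. \<tau>\<lparr>mem := (mem \<tau>)(val \<sigma> a := val \<sigma> b)\<rparr>"])
        (auto simp: in_step_def)
  next
    case (Seq p \<sigma> t \<sigma>' q t' \<sigma>'')
    from Seq.IH obtain A B where A: "finite A" "card A \<le> t" "reads_only w p \<sigma> t \<sigma>' A"
      and B: "finite B" "card B \<le> t'" "reads_only w q \<sigma>' t' \<sigma>'' B" by auto
    have "reads_only w (Seq p q) \<sigma> (t + t') \<sigma>'' (A \<union> B)"
      using A(3) B(3) by (rule reads_only_trans) (rule run.Seq)
    with join[OF A(1,2) B(1,2)] show ?case by (intro exI[of _ "A \<union> B"]) simp
  next
    case (IfTrue \<sigma> b p t \<sigma>' q)
    then obtain A where A: "finite A" "card A \<le> t" "reads_only w p \<sigma> t \<sigma>' A" by auto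
    have "reads_only w Skip \<sigma> 1 \<sigma> {}"
      by (intro reads_onlyI[where f = "\<lambda>\<tau>. \<tau>"]) (auto simp: in_step_def intro: run_intros(1,10))
    then have "reads_only w (If b p q) \<sigma> (1 + t) \<sigma>' ({} \<union> A)"
    proof (rule reads_only_trans[OF _ A(3)])
      fix \<tau> \<tau>' \<tau>'' assume "reg \<tau> = reg \<sigma>" "run w Skip \<tau> 1 \<tau>'" "run w p \<tau>' t \<tau>''"
      moreover from this(2) have "\<tau>' = \<tau>" by (cases rule: run.cases) auto
      ultimately show "run w (If b p q) \<tau> (1 + t) \<tau>''"
        using IfTrue.hyps(1) holds_eq[of \<tau> \<sigma> b] by (intro run.IfTrue) auto
    qed
    with A(1,2) show ?case by (intro exI[of _ A]) simp
  next
    case (IfFalse \<sigma> b q t \<sigma>' p)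
    then obtain A where A: "finite A" "card A \<le> t" "reads_only w q \<sigma> t \<sigma>' A" by auto
    have "reads_only w Skip \<sigma> 1 \<sigma> {}"
      by (intro reads_onlyI[where f = "\<lambda>\<tau>. \<tau>"]) (auto simp: in_step_def intro: run_intros(1,10))
    then have "reads_only w (If b p q) \<sigma> (1 + t) \<sigma>' ({} \<union> A)"
    proof (rule reads_only_trans[OF _ A(3)])
      fix \<tau> \<tau>' \<tau>'' assume "reg \<tau> = reg \<sigma>" "run w Skip \<tau> 1 \<tau>'" "run w q \<tau>' t \<tau>''"
      moreover from this(2) have "\<tau>' = \<tau>" by (cases rule: run.cases) auto
      ultimately show "run w (If b p q) \<tau> (1 + t) \<tau>''"
        using IfFalse.hyps(1) holds_eq[of \<tau> \<sigma> b] by (intro run.IfFalse) auto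
    qed
    with A(1,2) show ?case by (intro exI[of _ A]) simp
  next
    case (WhileFalse \<sigma> b p)
    have "run w (While b p) \<tau> 1 \<tau>" if "reg \<tau> = reg \<sigma>" for \<tau>
      using WhileFalse holds_eq[OF that] by (intro run.WhileFalse) simp
    then show ?case
      by (intro exI[of _ "{}"] conjI reads_onlyI[where f = "\<lambda>\<tau>. \<tau>"]) (auto simp: in_step_def)
  next
    case (WhileTrue \<sigma> b p t \<sigma>' t' \<sigma>'')
    from WhileTrue.IH obtain A B where A: "finite A" "card A \<le> t" "reads_only w p \<sigma> t \<sigma>' A"
      and B: "finite B" "card B \<le> t'" "reads_only w (While b p) \<sigma>' t' \<sigma>'' B" by auto
    have "reads_only w (While b p) \<sigma> (1 + t + t') \<sigma>'' (A \<union> B)"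
      using A(3) B(3)
    proof (rule reads_only_trans)
      fix \<tau> \<tau>' \<tau>'' assume "reg \<tau> = reg \<sigma>" "run w p \<tau> t \<tau>'" "run w (While b p) \<tau>' t' \<tau>''"
      then show "run w (While b p) \<tau> (1 + t + t') \<tau>''"
        using WhileTrue.hyps(1) holds_eq[of \<tau> \<sigma> b] by (intro run.WhileTrue) auto
    qed
    with join[OF A(1,2) B(1,2)] show ?case by (intro exI[of _ "A \<union> B"]) simp
  }
qed

section \<open>Walks over lists of weighted edges\<close>

text \<open>Source, target, length and cost, in the order in which the input encoding lists
  them.\<close>

type_synonym wedge = "nat \<times> nat \<times> nat \<times> nat"

fun esrc :: "wedge \<Rightarrow> nat" where "esrc (u, v, l, c) = u"
fun edst :: "wedge \<Rightarrow> nat" where "edst (u, v, l, c) = v"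
fun elen :: "wedge \<Rightarrow> nat" where "elen (u, v, l, c) = l"
fun ecost :: "wedge \<Rightarrow> nat" where "ecost (u, v, l, c) = c"

text \<open>Walks grow at their end, just as the dynamic program and the paths through the ladders
  extend them.\<close>

inductive walk :: "wedge set \<Rightarrow> nat \<Rightarrow> wedge list \<Rightarrow> nat \<Rightarrow> bool" for E s where
  Nil: "walk E s [] s"
| snoc: "walk E s p u \<Longrightarrow> e \<in> E \<Longrightarrow> esrc e = u \<Longrightarrow> walk E s (p @ [e]) (edst e)"

lemma walk_Nil_iff [simp]: "walk E s [] v \<longleftrightarrow> v = s"
  by (auto elim: walk.cases intro: walk.Nil)

lemma walk_snoc_iff [simp]: "walk E s (p @ [e]) v \<longleftrightarrow> walk E s p (esrc e) \<and> e \<in> E \<and> v = edst e"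
  by (auto elim: walk.cases intro: walk.snoc)

definition wedges :: "bicriteria \<Rightarrow> wedge set" where
  "wedges I = (\<lambda>e. (fst e, snd e, edge_length I e, edge_cost I e)) ` parcs (graph I)"

definition within_budgets :: "bicriteria \<Rightarrow> wedge list \<Rightarrow> bool" where
  "within_budgets I p \<longleftrightarrow> sum_list (map elen p) \<le> length_budget I \<and> sum_list (map ecost p) \<le> cost_budget I"

lemma sum_list_mono_subset:
  fixes f :: "'a \<Rightarrow> nat"
  assumes "distinct xs" "set xs \<subseteq> set ys"
  shows "sum_list (map f xs) \<le> sum_list (map f ys)"
proof -
  have "sum f (set ys) \<le> sum_list (map f ys)"
  proof (induction ys)
    case (Cons y ys)
    then show ?case by (cases "y \<in> set ys") (auto simp: insert_absorb)
  qed simp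
  moreover have "sum f (set xs) \<le> sum f (set ys)" using assms(2) by (intro sum_mono2) auto
  ultimately show ?thesis using assms(1) by (simp add: sum_list_distinct_conv_sum_set)
qed

lemma walk_append:
  "walk E s p u \<Longrightarrow> walk E u q v \<Longrightarrow> walk E s (p @ q) v"
  by (induction q arbitrary: v rule: rev_induct)
    (auto simp: append_assoc[symmetric] simp del: append_assoc)

text \<open>Cutting the cycles out of a walk only drops non-negative weights, so paths may be
  replaced by walks. The lower bounds use the first equivalence; the dynamic program needs the bound
  on the number of edges in the second.\<close>

lemma has_path_iff_walk:
  assumes I: "I \<in> bicriteria_instances"
  shows "has_bicriteria_path I \<longleftrightarrow>
      (\<exists>p. walk (wedges I) (source I) p (target I) \<and> within_budgets I p)" (is "?P \<longleftrightarrow> ?W")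
    and "has_bicriteria_path I \<longleftrightarrow>
      (\<exists>p. walk (wedges I) (source I) p (target I) \<and> length p < num_verts I \<and> within_budgets I p)"
      (is "_ \<longleftrightarrow> ?S")
proof -
  from I interpret pair_fin_digraph "graph I" by (simp add: bicriteria_instances_def)
  define q where "q e = (fst e, snd e, edge_length I e, edge_cost I e)" for e
  have q_simps [simp]: "esrc (q e) = fst e" "edst (q e) = snd e" "elen (q e) = edge_length I e"
    "ecost (q e) = edge_cost I e" for e
    by (simp_all add: q_def)
  have q_comp: "elen \<circ> q = edge_length I" "ecost \<circ> q = edge_cost I" by auto
  have wedges: "wedges I = q ` parcs (graph I)" by (simp add: wedges_def q_def)
  have "inj q" by (auto simp: inj_def q_def)
  have to_walk: "walk (wedges I) u (map q p) v" if "awalk u p v" for u p v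
    using that
  proof (induction p arbitrary: u)
    case (Cons e p)
    then have "e \<in> parcs (graph I)" "u = fst e" "awalk (snd e) p v" by (auto simp: awalk_Cons_iff)
    then have "walk (wedges I) u ([] @ [q e]) (snd e)" by (simp only: walk_snoc_iff) (auto simp: wedges)
    from walk_append[OF this Cons.IH[OF \<open>awalk (snd e) p v\<close>]] show ?case by simp
  qed (auto simp: awalk_def)
  have of_walk: "\<exists>p'. p = map q p' \<and> awalk u p' v" if "walk (wedges I) u p v" "u \<in> pverts (graph I)" for u p v
    using that
  proof (induction rule: walk.induct)
    case Nil
    then show ?case by (auto simp: awalk_def)
  next
    case (snoc p w e)
    then obtain p' where p': "p = map q p'" "awalk u p' w" by auto
    from snoc obtain a where a: "a \<in> parcs (graph I)" "e = q a" by (auto simp: wedges)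
    with snoc have "awalk w [a] (snd a)" by (auto simp: awalk_Cons_iff awalk_def arc_snd_in_verts arc_fst_in_verts)
    with p' a show ?case by (intro exI[of _ "p' @ [a]"]) (auto intro: awalk_appendI)
  qed
  have 1: "?S" if "?P"
  proof -
    from that obtain p where p: "apath (source I) p (target I)"
      "(\<Sum>e\<leftarrow>p. edge_length I e) \<le> length_budget I" "(\<Sum>e\<leftarrow>p. edge_cost I e) \<le> cost_budget I"
      by (auto simp: has_bicriteria_path_def)
    from p have "walk (wedges I) (source I) (map q p) (target I)" by (auto simp: apath_def to_walk)
    moreover have "length p < num_verts I" using length_apath_less[OF p(1)] by (simp add: num_verts_def)
    ultimately show ?thesis using p by (intro exI[of _ "map q p"]) (simp add: within_budgets_def q_comp)
  qed
  moreover have 2: "?W" if ?S using that by auto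
  moreover have 3: "?P" if ?W
  proof -
    from that obtain p where p: "walk (wedges I) (source I) p (target I)" "within_budgets I p" by auto
    then obtain p' where p': "p = map q p'" "awalk (source I) p' (target I)"
      using of_walk[OF p(1)] I unfolding bicriteria_instances_def by blast
    define r where "r = awalk_to_apath p'"
    have r: "apath (source I) r (target I)" "set r \<subseteq> set p'"
      unfolding r_def using p'(2) by (auto dest: apath_awalk_to_apath awalk_to_apath_subset)
    \<comment> \<open>The vertices of a path are distinct, hence so are the sources of its edges.
      Each edge is counted once, and the sum over \<open>r\<close> is at most that over
      \<open>p'\<close>.\<close>
    have "distinct r"
    proof -
      have "distinct (pawalk_verts u r) \<Longrightarrow> distinct r" for u
      proof (induction r arbitrary: u)
        case (Cons e r)
        have "fst ` set r \<subseteq> set (pawalk_verts x r)" for x by (induction r arbitrary: x) auto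
        with Cons show ?case by fastforce
      qed simp
      then show ?thesis using r(1) by (auto simp: apath_def)
    qed
    with sum_list_mono_subset[OF this r(2)] p(2) have
      "(\<Sum>e\<leftarrow>r. edge_length I e) \<le> length_budget I" "(\<Sum>e\<leftarrow>r. edge_cost I e) \<le> cost_budget I"
      unfolding within_budgets_def p'(1) by (simp_all add: q_comp) (meson order_trans)+
    with r(1) show ?thesis by (auto simp: has_bicriteria_path_def)
  qed
  ultimately show "?P \<longleftrightarrow> ?W" "?P \<longleftrightarrow> ?S" by blast+
qed

text \<open>Only the lower digits are bounded. The free leading coefficients \<open>X\<close> and
  \<open>Y\<close> will hold the sums of squares of the codes, which may exceed the base.\<close>

lemma digits_eq:
  fixes x y :: "nat \<Rightarrow> nat"
  assumes "\<And>i. i < k \<Longrightarrow> x i < b" "\<And>i. i < k \<Longrightarrow> y i < b"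
    and "(\<Sum>i<k. x i * b ^ i) + X * b ^ k = (\<Sum>i<k. y i * b ^ i) + Y * b ^ k"
  shows "(\<forall>i<k. x i = y i) \<and> X = Y"
  using assms
proof (induction k arbitrary: x y X Y)
  case (Suc k)
  have eq: "(\<Sum>i<k. x (Suc i) * b ^ i) + X * b ^ k = (\<Sum>i<k. y (Suc i) * b ^ i) + Y * b ^ k \<and> x 0 = y 0"
  proof -
    have *: "(\<Sum>i<Suc k. z i * b ^ i) + Z * b ^ Suc k = z 0 + b * ((\<Sum>i<k. z (Suc i) * b ^ i) + Z * b ^ k)"
      for z :: "nat \<Rightarrow> nat" and Z
      by (subst sum.lessThan_Suc_shift) (simp add: sum_distrib_left algebra_simps)
    from Suc.prems(3) have "x 0 + b * ((\<Sum>i<k. x (Suc i) * b ^ i) + X * b ^ k) =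
        y 0 + b * ((\<Sum>i<k. y (Suc i) * b ^ i) + Y * b ^ k)" (is "_ + b * ?u = _ + b * ?v") by (simp only: *)
    moreover have "x 0 < b" "y 0 < b" using Suc.prems by auto
    moreover from calculation have "(x 0 + b * ?u) mod b = (y 0 + b * ?v) mod b" by simp
    then have "x 0 = y 0" using \<open>x 0 < b\<close> \<open>y 0 < b\<close> by simp
    ultimately show ?thesis by simp
  qed
  then have "(\<forall>i<k. x (Suc i) = y (Suc i)) \<and> X = Y"
    using Suc.prems(1,2) by (intro Suc.IH) auto
  with eq show ?case by (auto simp: less_Suc_eq_0_disj)
qed simp

section \<open>The dynamic program\<close>

notation Seq (infixr ";;" 60)

section \<open>Ranking the distinct weights\<close>

abbreviation mov :: "nat \<Rightarrow> operand \<Rightarrow> com" where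
  "mov r a \<equiv> Op r Add a (Imm 0)"

abbreviation incr :: "nat \<Rightarrow> operand \<Rightarrow> com" where
  "incr r a \<equiv> Op r Add (Reg r) a"

text \<open>An entry 0 in the array at \<open>ibr\<close> marks an edge whose weight is not ranked
  yet. The first such edge fixes the weight of the pass (flag in register 12, weight in 13), and all
  edges of this weight receive the power in register 10. Register 14 counts the edges, 15 walks down
  the weight column, 16 addresses the array entry.\<close>

definition pass_body :: "nat \<Rightarrow> com" where
  "pass_body ibr =
      Op 16 Add (Reg ibr) (Reg 14) ;; Load 17 (Reg 16) ;;
      If (Equal (Reg 17) (Imm 0)) (
        Load 18 (Reg 15) ;;
        If (Equal (Reg 12) (Imm 0)) (mov 12 (Imm 1) ;; mov 13 (Reg 18)) Skip ;;
        If (Equal (Reg 18) (Reg 13)) (Store (Reg 16) (Reg 10)) Skip) Skip ;;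
      incr 15 (Imm 4) ;; incr 14 (Imm 1)"

definition pass :: "nat \<Rightarrow> nat \<Rightarrow> com" where
  "pass col ibr =
    mov 12 (Imm 0) ;; mov 14 (Imm 0) ;; mov 15 (Imm (6 + col)) ;;
    While (Less (Reg 14) (Reg 2)) (pass_body ibr)"

definition mark :: "nat \<Rightarrow> nat \<Rightarrow> nat \<Rightarrow> (nat \<Rightarrow> nat) \<Rightarrow> nat \<Rightarrow> (nat \<Rightarrow> nat) \<Rightarrow> nat \<Rightarrow> nat" where
  "mark ib i pw wt v M = (\<lambda>a. if ib \<le> a \<and> a < ib + i \<and> M a = 0 \<and> wt (a - ib) = v then pw else M a)"

definition pass_inv :: "nat \<Rightarrow> nat \<Rightarrow> (nat \<Rightarrow> nat) \<Rightarrow> (nat \<Rightarrow> nat) \<Rightarrow>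
    nat \<Rightarrow> nat \<Rightarrow> nat \<Rightarrow> (nat \<Rightarrow> nat) \<Rightarrow> bool" where
  "pass_inv ib pw wt M i found v M' \<longleftrightarrow>
    (\<forall>i'<i. M (ib + i') \<noteq> 0) \<and> found = 0 \<and> M' = M \<or>
    (\<exists>i0<i. M (ib + i0) = 0 \<and> found = 1 \<and> v = wt i0 \<and> M' = mark ib i pw wt (wt i0) M)"

lemma mark_Suc: "mark ib (Suc i) pw wt v M =
    (if M (ib + i) = 0 \<and> wt i = v then (mark ib i pw wt v M)(ib + i := pw) else mark ib i pw wt v M)"
  by (rule ext) (auto simp: mark_def less_Suc_eq)

lemma mark_fresh: "mark ib i pw wt v M (ib + i) = M (ib + i)"
  by (simp add: mark_def)

lemma mark_none: "\<forall>i'<i. M (ib + i') \<noteq> 0 \<Longrightarrow> mark ib i pw wt v M = M"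
  by (rule ext) (auto simp: mark_def dest!: le_Suc_ex)

lemma pass_inv_fresh: "pass_inv ib pw wt M i found v M' \<Longrightarrow> M' (ib + i) = M (ib + i)"
  by (auto simp: pass_inv_def mark_fresh)

lemma pass_inv_below: "pass_inv ib pw wt M i found v M' \<Longrightarrow> a < ib \<Longrightarrow> M' a = M a"
  by (auto simp: pass_inv_def mark_def)

lemma pass_inv_skip:
  assumes "pass_inv ib pw wt M i found v M'" "M (ib + i) \<noteq> 0"
  shows "pass_inv ib pw wt M (Suc i) found v M'"
  using assms by (auto simp: pass_inv_def mark_Suc less_Suc_eq)

lemma pass_inv_first:
  assumes "pass_inv ib pw wt M i 0 v M'" "M (ib + i) = 0"
  shows "pass_inv ib pw wt M (Suc i) (Suc 0) (wt i) (M'(ib + i := pw))"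
  using assms by (auto simp: pass_inv_def mark_Suc mark_none intro!: exI[of _ i])

lemma pass_inv_same:
  assumes "pass_inv ib pw wt M i found v M'" "M (ib + i) = 0" "found \<noteq> 0" "wt i = v"
  shows "pass_inv ib pw wt M (Suc i) found v (M'(ib + i := pw))"
proof -
  from assms obtain i0 where "i0 < i" "M (ib + i0) = 0" "found = 1" "v = wt i0"
    "M' = mark ib i pw wt (wt i0) M" by (auto simp: pass_inv_def)
  then show ?thesis using assms unfolding pass_inv_def
    by (intro disjI2 exI[of _ i0]) (auto simp: mark_Suc)
qed

lemma pass_inv_other:
  assumes "pass_inv ib pw wt M i found v M'" "found \<noteq> 0" "wt i \<noteq> v"
  shows "pass_inv ib pw wt M (Suc i) found v M'"
proof -
  from assms obtain i0 where "i0 < i" "M (ib + i0) = 0" "found = 1" "v = wt i0"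
    "M' = mark ib i pw wt (wt i0) M" by (auto simp: pass_inv_def)
  then show ?thesis using assms unfolding pass_inv_def
    by (intro disjI2 exI[of _ i0]) (auto simp: mark_Suc)
qed

lemma wp_pass:
  fixes \<sigma> :: state
  assumes regs: "reg \<sigma> 2 = m" "reg \<sigma> ibr = ib" "reg \<sigma> 10 = pw" "ibr \<notin> {12..18}"
    and wt: "\<And>i. i < m \<Longrightarrow> mem \<sigma> (6 + (col + 4 * i)) = wt i \<and> wt i < 2 ^ w \<and> mem \<sigma> (ib + i) < 2 ^ w"
    and bnd: "ib + m + 4 < 2 ^ w" "pw < 2 ^ w" "6 + 4 * m \<le> ib" "col < 4"
    and Q: "\<And>t \<sigma>' v. t \<le> 12 * m + 5 \<Longrightarrow> (\<And>r. r \<notin> {12..18} \<Longrightarrow> reg \<sigma>' r = reg \<sigma> r) \<Longrightarrow>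
      pass_inv ib pw wt (mem \<sigma>) m (reg \<sigma>' 12) v (mem \<sigma>') \<Longrightarrow> Q t \<sigma>'"
  shows "wp w (pass col ibr) Q \<sigma>"
proof -
  define M where "M = mem \<sigma>"
  define R where "R = reg \<sigma>"
  define inv where "inv i \<tau> \<longleftrightarrow> reg \<tau> 14 = i \<and> reg \<tau> 15 = 6 + (col + 4 * i) \<and>
      (\<forall>r. r \<notin> {12..18} \<longrightarrow> reg \<tau> r = R r) \<and> pass_inv ib pw wt M i (reg \<tau> 12) (reg \<tau> 13) (mem \<tau>)"
    for i and \<tau> :: state
  have R: "R 2 = m" "R ibr = ib" "R 10 = pw" using regs by (auto simp: R_def)
  have ibr: "ibr \<noteq> 12" "ibr \<noteq> 13" "ibr \<noteq> 14" "ibr \<noteq> 15" "ibr \<noteq> 16" "ibr \<noteq> 17" "ibr \<noteq> 18"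
    using regs(4) by auto
  have body: "holds \<tau> (Less (Reg 14) (Reg 2)) \<and> wp w (pass_body ibr) (\<lambda>t \<tau>'. t \<le> 11 \<and> inv (Suc i) \<tau>') \<tau>"
    if i: "i < m" and inv: "inv i \<tau>" for i \<tau>
  proof -
    have rg: "reg \<tau> 14 = i" "reg \<tau> 15 = 6 + (col + 4 * i)" "reg \<tau> 2 = m" "reg \<tau> ibr = ib" "reg \<tau> 10 = pw"
      "\<forall>r. r \<notin> {12..18} \<longrightarrow> reg \<tau> r = R r"
      and pinv: "pass_inv ib pw wt M i (reg \<tau> 12) (reg \<tau> 13) (mem \<tau>)"
      using inv regs R unfolding inv_def by auto
    have wi: "mem \<tau> (6 + (col + 4 * i)) = wt i" "wt i < 2 ^ w" "M (ib + i) < 2 ^ w"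
      using wt[OF i] pass_inv_below[OF pinv, of "6 + (col + 4 * i)"] i bnd by (simp_all add: M_def)
    have b: "ib + i < 2 ^ w" "6 + (col + 4 * i) < 2 ^ w" "10 + (col + 4 * i) < 2 ^ w" "Suc i < 2 ^ w" "Suc 0 < 2 ^ w"
      using i bnd by linarith+
    show ?thesis
      using i rg wi b bnd(2) pass_inv_fresh[OF pinv] pass_inv_skip[OF pinv]
        pass_inv_first[of ib pw wt M i "reg \<tau> 13" "mem \<tau>"]
        pass_inv_same[OF pinv] pass_inv_other[OF pinv] pinv
      by (auto simp: pass_body_def inv_def ibr)
  qed
  have loop: "wp w (While (Less (Reg 14) (Reg 2)) (pass_body ibr)) Q' \<tau>0"
    if init: "inv 0 \<tau>0" and post: "\<And>t \<tau>. t \<le> m * 12 + 1 \<Longrightarrow> inv m \<tau> \<Longrightarrow> Q' t \<tau>" for \<tau>0 Q'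
    by (rule wp_While[where I = inv and n = m and T = 11])
      (use body init post R in \<open>auto simp: inv_def\<close>)
  show ?thesis
    unfolding pass_def using bnd
    by (auto intro!: loop Q[where v = "reg _ 13"] simp: inv_def R_def M_def) (auto simp: pass_inv_def)
qed

text \<open>The \<open>i\<close>-th distinct weight that is found is represented by the power \<open>n ^ i\<close>, so that the sum of
  the entries over the edges of a path with fewer than \<open>n\<close> edges lists, in base \<open>n\<close>, how often each weight
  occurs.\<close>

definition ranked :: "nat \<Rightarrow> nat \<Rightarrow> nat \<Rightarrow> (nat \<Rightarrow> nat) \<Rightarrow> nat \<Rightarrow> (nat \<Rightarrow> nat) \<Rightarrow> bool" where
  "ranked n m ib wt j M \<longleftrightarrow> (\<exists>f V. V \<subseteq> wt ` {..<m} \<and> bij_betw f V {..<j} \<and>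
    (\<forall>i<m. M (ib + i) = (if wt i \<in> V then n ^ f (wt i) else 0)))"

definition fully_ranked :: "nat \<Rightarrow> nat \<Rightarrow> nat \<Rightarrow> (nat \<Rightarrow> nat) \<Rightarrow> nat \<Rightarrow> (nat \<Rightarrow> nat) \<Rightarrow> bool" where
  "fully_ranked n m ib wt j M \<longleftrightarrow> (\<exists>f. bij_betw f (wt ` {..<m}) {..<j} \<and> (\<forall>i<m. M (ib + i) = n ^ f (wt i)))"

lemma ranked_le: "ranked n m ib wt j M \<Longrightarrow> j \<le> card (wt ` {..<m})"
  unfolding ranked_def by (metis bij_betw_same_card card_lessThan card_mono finite_imageI finite_lessThan)

lemma fully_ranked_card: "fully_ranked n m ib wt j M \<Longrightarrow> card (wt ` {..<m}) = j"
  unfolding fully_ranked_def by (metis bij_betw_same_card card_lessThan)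

lemma ranked_full:
  assumes "ranked n m ib wt j M" "\<forall>i<m. M (ib + i) \<noteq> 0"
  shows "fully_ranked n m ib wt j M"
proof -
  from assms(1) obtain f V where V: "V \<subseteq> wt ` {..<m}" "bij_betw f V {..<j}"
    and M: "\<forall>i<m. M (ib + i) = (if wt i \<in> V then n ^ f (wt i) else 0)"
    unfolding ranked_def by auto
  from M assms(2) have "\<forall>i<m. wt i \<in> V" by (metis (full_types))
  with V(1) have "V = wt ` {..<m}" by auto
  with V M show ?thesis unfolding fully_ranked_def by (intro exI[of _ f]) auto
qed

lemma ranked_cong:
  "ranked n m ib wt j M \<Longrightarrow> (\<And>i. i < m \<Longrightarrow> M' (ib + i) = M (ib + i)) \<Longrightarrow> ranked n m ib wt j M'"
  unfolding ranked_def by simp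

lemma ranked_step:
  assumes "ranked n m ib wt j M" "i0 < m" "M (ib + i0) = 0" "0 < n"
  shows "ranked n m ib wt (Suc j) (mark ib m (n ^ j) wt (wt i0) M)"
proof -
  from assms(1) obtain f V where V: "V \<subseteq> wt ` {..<m}" "bij_betw f V {..<j}"
    and M: "\<forall>i<m. M (ib + i) = (if wt i \<in> V then n ^ f (wt i) else 0)"
    unfolding ranked_def by auto
  have new: "wt i0 \<notin> V" using M assms by (auto split: if_splits)
  have "bij_betw (f(wt i0 := j)) V {..<j}"
    using V(2) new by (subst bij_betw_cong[where g = f]) auto
  then have "bij_betw (f(wt i0 := j)) (V \<union> {wt i0}) ({..<j} \<union> {j})"
    by (rule bij_betw_combine) auto
  then have "bij_betw (f(wt i0 := j)) (insert (wt i0) V) {..<Suc j}"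
    by (simp add: lessThan_Suc)
  then show ?thesis unfolding ranked_def
    using V(1) M new assms(2,4) by (intro exI[of _ "f(wt i0 := j)"] exI[of _ "insert (wt i0) V"])
      (auto simp: mark_def)
qed

lemma pass_inv_cases:
  assumes "pass_inv ib (n ^ j) wt M m found v M'" "ranked n m ib wt j M" "0 < n"
  obtains "found = 0" "M' = M" "fully_ranked n m ib wt j M" "card (wt ` {..<m}) = j"
  | "found = 1" "ranked n m ib wt (Suc j) M'" "Suc j \<le> card (wt ` {..<m})"
proof -
  from assms(1) consider "\<forall>i'<m. M (ib + i') \<noteq> 0" "found = 0" "M' = M"
    | i0 where "i0 < m" "M (ib + i0) = 0" "found = 1" "M' = mark ib m (n ^ j) wt (wt i0) M"
    unfolding pass_inv_def by auto
  then show ?thesis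
  proof cases
    case 1
    then show ?thesis using that(1) ranked_full[OF assms(2)] fully_ranked_card by blast
  next
    case 2
    have "ranked n m ib wt (Suc j) M'"
      unfolding 2(4) by (rule ranked_step[OF assms(2) 2(1,2) assms(3)])
    then show ?thesis using that(2) 2(3) ranked_le by blast
  qed
qed

lemma pass_inv_outside: "pass_inv ib pw wt M m found v M' \<Longrightarrow> a < ib \<or> ib + m \<le> a \<Longrightarrow> M' a = M a"
  by (auto simp: pass_inv_def mark_def)

text \<open>Register 11 ends the loop and 19 records which kind was exhausted, 0 for the lengths.
  The power in register 10 is multiplied by \<open>n\<close> only after both kinds have yielded a
  new weight, so it ends as \<open>n ^ k\<close>.\<close>

definition discover_body :: com where
  "discover_body = pass 2 20 ;;
    If (Equal (Reg 12) (Imm 0)) (mov 11 (Imm 1))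
      (pass 3 21 ;;
       If (Equal (Reg 12) (Imm 0)) (mov 11 (Imm 1) ;; mov 19 (Imm 1)) (Op 10 Mul (Reg 10) (Reg 1)))"

definition discover :: com where
  "discover = mov 10 (Imm 1) ;; mov 11 (Imm 0) ;; mov 19 (Imm 0) ;; While (Equal (Reg 11) (Imm 0)) discover_body"

lemma wp_discover:
  fixes \<sigma> :: state and wl wc :: "nat \<Rightarrow> nat"
  defines "k \<equiv> \<lambda>m. min (card (wl ` {..<m})) (card (wc ` {..<m}))"
  assumes regs: "reg \<sigma> 1 = n" "reg \<sigma> 2 = m" "reg \<sigma> 20 = 6 + 4 * m" "reg \<sigma> 21 = 6 + 5 * m"
    and mem: "\<And>i. i < m \<Longrightarrow> mem \<sigma> (8 + 4 * i) = wl i \<and> wl i < 2 ^ w"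
      "\<And>i. i < m \<Longrightarrow> mem \<sigma> (9 + 4 * i) = wc i \<and> wc i < 2 ^ w"
      "\<And>a. 6 + 4 * m \<le> a \<Longrightarrow> mem \<sigma> a = 0"
    and n: "0 < n" and bnd: "10 + 6 * m < 2 ^ w" "n ^ k m < 2 ^ w"
    and Q: "\<And>t \<sigma>'. t \<le> (k m + 1) * (24 * m + 17) + 4 \<Longrightarrow> (\<And>r. r \<notin> {10..19} \<Longrightarrow> reg \<sigma>' r = reg \<sigma> r) \<Longrightarrow>
      (\<And>a. a < 6 + 4 * m \<or> 6 + 6 * m \<le> a \<Longrightarrow> mem \<sigma>' a = mem \<sigma> a) \<Longrightarrow> reg \<sigma>' 10 = n ^ k m \<Longrightarrow>
      reg \<sigma>' 19 = 0 \<and> fully_ranked n m (6 + 4 * m) wl (k m) (mem \<sigma>') \<or>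
      reg \<sigma>' 19 = 1 \<and> fully_ranked n m (6 + 5 * m) wc (k m) (mem \<sigma>') \<Longrightarrow> Q t \<sigma>'"
  shows "wp w discover Q \<sigma>"
proof -
  define M where "M = mem \<sigma>"
  define R where "R = reg \<sigma>"
  define fr where "fr \<tau> \<longleftrightarrow> (\<forall>r. r \<notin> {10..19} \<longrightarrow> reg \<tau> r = R r) \<and>
      (\<forall>a. a < 6 + 4 * m \<or> 6 + 6 * m \<le> a \<longrightarrow> mem \<tau> a = M a)" for \<tau> :: state
  define going where "going i \<tau> \<longleftrightarrow> fr \<tau> \<and> reg \<tau> 11 = 0 \<and> reg \<tau> 10 = n ^ i \<and> reg \<tau> 19 = 0 \<and>
      ranked n m (6 + 4 * m) wl i (mem \<tau>) \<and> ranked n m (6 + 5 * m) wc i (mem \<tau>)" for i and \<tau> :: state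
  define stopped where "stopped \<tau> \<longleftrightarrow> fr \<tau> \<and> reg \<tau> 11 = 1 \<and> reg \<tau> 10 = n ^ k m \<and>
      (reg \<tau> 19 = 0 \<and> fully_ranked n m (6 + 4 * m) wl (k m) (mem \<tau>) \<or>
       reg \<tau> 19 = 1 \<and> fully_ranked n m (6 + 5 * m) wc (k m) (mem \<tau>))" for \<tau> :: state
  \<comment> \<open>After \<open>k m\<close> rounds each kind has \<open>k m\<close> ranked weights.
    One further round finds a kind exhausted, so the invariant changes its form after
    \<open>k m + 1\<close> rounds.\<close>
  define inv where "inv i \<tau> \<longleftrightarrow> (if i \<le> k m then going i \<tau> else stopped \<tau>)" for i \<tau>
  have pow_le: "n ^ i < 2 ^ w" if "i \<le> k m" for i
    using power_increasing[OF that, of n] n bnd(2) by linarith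
  have rank_bnd: "M' (ib + i) < 2 ^ w" if "ranked n m ib wt j M'" "i < m" "j \<le> k m" for M' ib wt j i
  proof -
    from that(1) obtain f V where V: "bij_betw f V {..<j}"
      and "\<forall>i<m. M' (ib + i) = (if wt i \<in> V then n ^ f (wt i) else 0)"
      unfolding ranked_def by auto
    moreover have "f v \<le> k m" if "v \<in> V" for v
      using bij_betw_apply[OF V that] \<open>j \<le> k m\<close> by simp
    ultimately show ?thesis using that(2) pow_le[of "f (wt i)"] by auto
  qed
  have body: "wp w discover_body (\<lambda>t \<tau>'. t \<le> 24 * m + 16 \<and> inv (Suc i) \<tau>') \<tau>"
    if i: "i \<le> k m" and inv: "going i \<tau>" for i \<tau>
    unfolding discover_body_def wp_Seq
  proof (rule wp_pass[where m = m and ib = "6 + 4 * m" and pw = "n ^ i" and wt = wl])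
    have \<tau>: "fr \<tau>" "reg \<tau> 11 = 0" "reg \<tau> 10 = n ^ i" "reg \<tau> 19 = 0"
      "ranked n m (6 + 4 * m) wl i (mem \<tau>)" "ranked n m (6 + 5 * m) wc i (mem \<tau>)"
      using inv by (auto simp: going_def)
    then show "reg \<tau> 2 = m" "reg \<tau> 20 = 6 + 4 * m" "reg \<tau> 10 = n ^ i"
      using regs by (auto simp: fr_def R_def)
    show "mem \<tau> (6 + (2 + 4 * j)) = wl j \<and> wl j < 2 ^ w \<and> mem \<tau> (6 + 4 * m + j) < 2 ^ w" if "j < m" for j
      using mem(1)[OF that] rank_bnd[OF \<tau>(5) that i] \<tau>(1) that by (auto simp: fr_def M_def)
    fix t v and \<tau>1 :: state assume t1: "t \<le> 12 * m + 5" and reg1: "\<And>r. r \<notin> {12..18} \<Longrightarrow> reg \<tau>1 r = reg \<tau> r"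
      and p1: "pass_inv (6 + 4 * m) (n ^ i) wl (mem \<tau>) m (reg \<tau>1 12) v (mem \<tau>1)"
    have \<tau>1: "fr \<tau>1" "reg \<tau>1 11 = 0" "reg \<tau>1 10 = n ^ i" "reg \<tau>1 19 = 0"
      "ranked n m (6 + 5 * m) wc i (mem \<tau>1)"
      using \<tau> reg1 pass_inv_outside[OF p1] by (auto simp: fr_def intro: ranked_cong)
    from p1 \<tau>(5) n show "wp w (com.If (Equal (Reg 12) (Imm 0)) (mov 11 (Imm 1))
        (pass 3 21 ;; com.If (Equal (Reg 12) (Imm 0)) (mov 11 (Imm 1) ;; mov 19 (Imm 1)) (Op 10 Mul (Reg 10) (Reg 1))))
        (\<lambda>t'. (\<lambda>t \<tau>'. t \<le> 24 * m + 16 \<and> inv (Suc i) \<tau>') (t + t')) \<tau>1"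
    proof (cases rule: pass_inv_cases)
      case 1
      then have "i = k m" using i by (simp add: k_def)
      then show ?thesis using 1 \<tau>1 t1 bnd by (auto simp: inv_def stopped_def fr_def)
    next
      case 2
      have "wp w (pass 3 21) (\<lambda>u. wp w (com.If (Equal (Reg 12) (Imm 0)) (mov 11 (Imm 1) ;; mov 19 (Imm 1)) (Op 10 Mul (Reg 10) (Reg 1)))
        (\<lambda>u'. (\<lambda>t' \<tau>'. t + Suc t' \<le> 24 * m + 16 \<and> inv (Suc i) \<tau>') (u + u'))) \<tau>1"
      proof (rule wp_pass[where m = m and ib = "6 + 5 * m" and pw = "n ^ i" and wt = wc])
        show "reg \<tau>1 2 = m" "reg \<tau>1 21 = 6 + 5 * m" "reg \<tau>1 10 = n ^ i"
          using regs \<tau>1 by (auto simp: fr_def R_def)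
        show "mem \<tau>1 (6 + (3 + 4 * j)) = wc j \<and> wc j < 2 ^ w \<and> mem \<tau>1 (6 + 5 * m + j) < 2 ^ w" if "j < m" for j
          using mem(2)[OF that] rank_bnd[OF \<tau>1(5) that i] \<tau>1(1) that by (auto simp: fr_def M_def)
        fix u v and \<tau>2 :: state assume t2: "u \<le> 12 * m + 5" and reg2: "\<And>r. r \<notin> {12..18} \<Longrightarrow> reg \<tau>2 r = reg \<tau>1 r"
          and p2: "pass_inv (6 + 5 * m) (n ^ i) wc (mem \<tau>1) m (reg \<tau>2 12) v (mem \<tau>2)"
        have \<tau>2: "fr \<tau>2" "reg \<tau>2 11 = 0" "reg \<tau>2 10 = n ^ i" "reg \<tau>2 19 = 0" "reg \<tau>2 1 = n"
          "ranked n m (6 + 4 * m) wl (Suc i) (mem \<tau>2)"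
          using \<tau>1 2 reg2 pass_inv_outside[OF p2] regs by (auto simp: fr_def R_def intro: ranked_cong)
        from p2 \<tau>1(5) n show "wp w (com.If (Equal (Reg 12) (Imm 0)) (mov 11 (Imm 1) ;; mov 19 (Imm 1)) (Op 10 Mul (Reg 10) (Reg 1)))
          (\<lambda>u'. (\<lambda>t' \<tau>'. t + Suc t' \<le> 24 * m + 16 \<and> inv (Suc i) \<tau>') (u + u')) \<tau>2"
        proof (cases rule: pass_inv_cases)
          case a: 1
          then have "i = k m" using i 2 by (simp add: k_def)
          then show ?thesis using a 2 \<tau>2 t1 t2 bnd by (auto simp: inv_def stopped_def fr_def)
        next
          case b: 2
          then have "Suc i \<le> k m" using 2 by (simp add: k_def)
          then show ?thesis using b 2 \<tau>2 t1 t2 bnd pow_le[of "Suc i"]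
            by (auto simp: inv_def going_def fr_def mult.commute)
        qed
      qed (use bnd i pow_le in auto)
      then show ?thesis using 2 by (simp cong del: wp_weak_cong)
    qed
  qed (use bnd i pow_le in auto)
  have loop: "wp w (While (Equal (Reg 11) (Imm 0)) discover_body) Q' \<tau>0"
    if init: "going 0 \<tau>0" and post: "\<And>t \<tau>. t \<le> (k m + 1) * (24 * m + 17) + 1 \<Longrightarrow> stopped \<tau> \<Longrightarrow> Q' t \<tau>"
    for \<tau>0 Q'
  proof (rule wp_While[where I = inv and n = "k m + 1" and T = "24 * m + 16"])
    show "inv 0 \<tau>0" using init by (simp add: inv_def)
    show "holds \<tau> (Equal (Reg 11) (Imm 0)) \<and>
         wp w discover_body (\<lambda>t \<tau>'. t \<le> 24 * m + 16 \<and> inv (Suc i) \<tau>') \<tau>" if "i < k m + 1" "inv i \<tau>" for i \<tau>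
      using that body by (auto simp: inv_def going_def)
    show "\<not> holds \<tau> (Equal (Reg 11) (Imm 0))" if "inv (k m + 1) \<tau>" for \<tau>
      using that by (simp add: inv_def stopped_def)
    show "Q' t \<tau>" if "inv (k m + 1) \<tau>" "t \<le> (k m + 1) * (24 * m + 16 + 1) + 1" for t \<tau>
      using that by (intro post) (simp_all add: inv_def algebra_simps)
  qed
  have zero: "ranked n m ib wt 0 M'" if "\<And>a. ib \<le> a \<Longrightarrow> M' a = 0" for ib wt M'
    unfolding ranked_def using that by (intro exI[of _ "\<lambda>_. 0"] exI[of _ "{}"]) (auto simp: bij_betw_def)
  show ?thesis
    unfolding discover_def using bnd
    by (auto intro!: loop Q zero mem(3) simp: going_def stopped_def fr_def R_def M_def)
qed

section \<open>The table indexed by multiplicities of weights\<close>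

lemma walk_set: "walk E s p v \<Longrightarrow> set p \<subseteq> E"
  by (induction rule: walk.induct) auto

lemma digits_less:
  fixes x :: "nat \<Rightarrow> nat"
  assumes "\<And>i. i < k \<Longrightarrow> x i < b"
  shows "(\<Sum>i<k. x i * b ^ i) < b ^ k"
  using assms
proof (induction k)
  case (Suc k)
  then have "(\<Sum>i<k. x i * b ^ i) < b ^ k" "x k + 1 \<le> b" by (simp_all add: Suc_leI)
  then have "(\<Sum>i<k. x i * b ^ i) + x k * b ^ k < (x k + 1) * b ^ k" by simp
  also have "\<dots> \<le> b * b ^ k" using \<open>x k + 1 \<le> b\<close> by (rule mult_le_mono1)
  finally show ?case by simp
qed simp

text \<open>\<open>wA\<close> is the kind of weight that has been ranked, by \<open>f\<close>, and
  \<open>wB\<close> the other kind, so lengths and costs may appear in either role.\<close>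

locale dp =
  fixes n k Z s :: nat and qs :: "wedge list" and wA wB :: "wedge \<Rightarrow> nat" and f :: "nat \<Rightarrow> nat"
  assumes n_pos: "0 < n"
    and ends: "\<And>e. e \<in> set qs \<Longrightarrow> esrc e < n \<and> edst e < n"
    and f: "bij_betw f (wA ` set qs) {..<k}"
begin

definition pe :: "wedge \<Rightarrow> nat" where "pe e = n ^ f (wA e)"
definition key :: "wedge list \<Rightarrow> nat" where "key p = sum_list (map pe p)"
definition sumA :: "wedge list \<Rightarrow> nat" where "sumA p = sum_list (map wA p)"
definition sumB :: "wedge list \<Rightarrow> nat" where "sumB p = sum_list (map wB p)"
text \<open>The table starts at \<open>Z\<close>. A cell takes three words: one more than the number
  of edges of the stored walk (0 if there is none), its \<open>wA\<close>-sum and its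
  \<open>wB\<close>-sum. The \<open>n\<close> cells of one key form a contiguous row.\<close>

definition cell :: "nat \<Rightarrow> nat \<Rightarrow> nat" where "cell K v = Z + 3 * (K * n + v)"

lemmas defs = key_def sumA_def sumB_def

lemma pe_pos: "0 < pe e"
  using n_pos by (simp add: pe_def)

definition occ :: "wedge list \<Rightarrow> nat \<Rightarrow> nat" where "occ p i = length (filter (\<lambda>e. f (wA e) = i) p)"

text \<open>With powers of \<open>n\<close>, with the inverse of the ranking and with 1 for
  \<open>h\<close>, the multiplicities yield the key, the \<open>wA\<close>-sum and the number of
  edges.\<close>

lemma sum_occ:
  assumes "set p \<subseteq> set qs"
  shows "(\<Sum>i<k. occ p i * h i) = sum_list (map (\<lambda>e. h (f (wA e))) p)"
  using assms
proof (induction p)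
  case (Cons e p)
  then have "f (wA e) < k" using f by (auto simp: bij_betw_def)
  have "(\<Sum>i<k. occ (e # p) i * h i) = (\<Sum>i<k. (if i = f (wA e) then h i else 0) + occ p i * h i)"
    by (rule sum.cong) (auto simp: occ_def)
  also have "\<dots> = h (f (wA e)) + (\<Sum>i<k. occ p i * h i)"
    using \<open>f (wA e) < k\<close> by (simp add: sum.distrib)
  finally show ?case using Cons by simp
qed (simp add: occ_def)

lemma occ_le: "occ p i \<le> length p"
  by (simp add: occ_def)

lemma key_occ: "set p \<subseteq> set qs \<Longrightarrow> key p = (\<Sum>i<k. occ p i * n ^ i)"
  by (simp add: sum_occ key_def pe_def[abs_def])

lemma key_less: "set p \<subseteq> set qs \<Longrightarrow> length p < n \<Longrightarrow> key p < n ^ k"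
  unfolding key_occ by (rule digits_less) (meson occ_le le_less_trans)

text \<open>A walk with fewer than \<open>n\<close> edges causes no carry in base \<open>n\<close>,
  so its key determines the multiplicities, and these determine both quantities.\<close>

lemma same_key:
  assumes p: "set p \<subseteq> set qs" "length p < n" and q: "set q \<subseteq> set qs" "length q < n"
    and key: "key p = key q"
  shows "sumA p = sumA q" "length p = length q"
proof -
  have "(\<Sum>i<k. occ p i * n ^ i) + 0 * n ^ k = (\<Sum>i<k. occ q i * n ^ i) + 0 * n ^ k"
    using key by (simp add: key_occ p q)
  then have eq: "occ p i = occ q i" if "i < k" for i
    using digits_eq[of k "occ p" n "occ q"] p q occ_le le_less_trans that by blast
  let ?g = "the_inv_into (wA ` set qs) f"
  have g: "?g (f (wA e)) = wA e" if "e \<in> set qs" for e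
    using f that by (intro the_inv_into_f_f) (auto simp: bij_betw_def)
  have "sumA r = (\<Sum>i<k. occ r i * ?g i)" "length r = (\<Sum>i<k. occ r i * 1)" if "set r \<subseteq> set qs" for r
  proof -
    have "map wA r = map (\<lambda>e. ?g (f (wA e))) r"
      by (intro map_cong refl) (metis g subsetD that)
    then show "sumA r = (\<Sum>i<k. occ r i * ?g i)" unfolding sum_occ[OF that] sumA_def by (rule arg_cong)
    show "length r = (\<Sum>i<k. occ r i * 1)" unfolding sum_occ[OF that] by (simp add: sum_list_triv)
  qed
  with p q eq show "sumA p = sumA q" "length p = length q" by simp_all
qed

lemma cell_inj: "v < n \<Longrightarrow> v' < n \<Longrightarrow> cell K v = cell K' v' \<Longrightarrow> K = K' \<and> v = v'"
proof -
  assume "v < n" "v' < n" "cell K v = cell K' v'"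
  then have "K * n + v = K' * n + v'" by (simp add: cell_def)
  then have "(K * n + v) div n = (K' * n + v') div n" "(K * n + v) mod n = (K' * n + v') mod n" by simp_all
  then show ?thesis using \<open>v < n\<close> \<open>v' < n\<close> by simp
qed

lemma cell_ne:
  "cell K v \<noteq> cell K' v' + 1" "cell K v \<noteq> cell K' v' + 2" "cell K v + 1 \<noteq> cell K' v' + 2"
  by (auto simp: cell_def; presburger)+

definition stored :: "(nat \<Rightarrow> nat) \<Rightarrow> nat \<Rightarrow> nat \<Rightarrow> wedge list \<Rightarrow> bool" where
  "stored M K v p \<longleftrightarrow> walk (set qs) s p v \<and> length p < n \<and> key p = K \<and> M (cell K v) = Suc (length p) \<and>
    M (cell K v + 1) = sumA p \<and> M (cell K v + 2) = sumB p"

lemma stored_set: "stored M K v p \<Longrightarrow> set p \<subseteq> set qs"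
  unfolding stored_def by (blast dest: walk_set)

text \<open>Empty cells must be zero in all their words, since the program loads the third word of a
  cell before it tests whether the cell is empty, and the load has to stay within the word
  size.\<close>

definition sound :: "(nat \<Rightarrow> nat) \<Rightarrow> bool" where
  "sound M \<longleftrightarrow> (\<forall>K v. v < n \<longrightarrow> (if M (cell K v) = 0 then M (cell K v + 1) = 0 \<and> M (cell K v + 2) = 0
    else \<exists>p. stored M K v p))"

text \<open>The condition says that the last extension of \<open>p\<close> has already been tried:
  keys are processed in increasing order, and at key \<open>K\<close> the edges of \<open>X\<close>
  are done.\<close>

definition complete :: "nat \<Rightarrow> wedge set \<Rightarrow> (nat \<Rightarrow> nat) \<Rightarrow> bool" where
  "complete K X M \<longleftrightarrow> (\<forall>p v. walk (set qs) s p v \<longrightarrow> length p < n \<longrightarrow>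
    p = [] \<or> key (butlast p) < K \<or> key (butlast p) = K \<and> last p \<in> X \<longrightarrow>
    M (cell (key p) v) \<noteq> 0 \<and> M (cell (key p) v + 2) \<le> sumB p)"

text \<open>The first word is one more than the number of edges, so \<open>M a < n\<close> says that
  the extended walk still has fewer than \<open>n\<close> edges.\<close>

definition relax :: "nat \<Rightarrow> wedge \<Rightarrow> (nat \<Rightarrow> nat) \<Rightarrow> nat \<Rightarrow> nat" where
  "relax K e M = (let a = cell K (esrc e); b = cell (K + pe e) (edst e) in
    if 0 < M a \<and> M a < n \<and> (M b = 0 \<or> M (a + 2) + wB e < M (b + 2))
    then M(b := Suc (M a), b + 2 := M (a + 2) + wB e, b + 1 := M (a + 1) + wA e) else M)"

lemma sound_relax:
  assumes M: "sound M" and e: "e \<in> set qs"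
  shows "sound (relax K e M)"
proof -
  define a where "a = cell K (esrc e)"
  define b where "b = cell (K + pe e) (edst e)"
  have relax: "relax K e M = (if 0 < M a \<and> M a < n \<and> (M b = 0 \<or> M (a + 2) + wB e < M (b + 2))
    then M(b := Suc (M a), b + 2 := M (a + 2) + wB e, b + 1 := M (a + 1) + wA e) else M)" (is "_ = (if ?c then _ else _)")
    unfolding relax_def Let_def a_def b_def by (rule refl)
  show ?thesis
  proof (cases ?c)
    case True
    then have 2: "0 < M a" "M a < n"
      "relax K e M = M(b := Suc (M a), b + 2 := M (a + 2) + wB e, b + 1 := M (a + 1) + wA e)"
      using relax by simp_all
    have en: "esrc e < n" "edst e < n" using ends e by auto
    from M 2(1) en obtain q where q: "stored M K (esrc e) q" unfolding sound_def a_def by force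
    have new: "stored (relax K e M) (K + pe e) (edst e) (q @ [e])"
      using q e 2(1,2) unfolding stored_def 2(3) by (auto simp: a_def b_def defs cell_ne)
    have same: "relax K e M (cell K' v) = M (cell K' v)" "relax K e M (cell K' v + 1) = M (cell K' v + 1)"
      "relax K e M (cell K' v + 2) = M (cell K' v + 2)" if "cell K' v \<noteq> b" for K' v
    proof -
      have "cell K' v \<noteq> b + 1" "cell K' v \<noteq> b + 2" "cell K' v + 1 \<noteq> b" "cell K' v + 1 \<noteq> b + 2"
        "cell K' v + 2 \<noteq> b" "cell K' v + 2 \<noteq> b + 1"
        using cell_ne[of K' v "K + pe e" "edst e"] cell_ne[of "K + pe e" "edst e" K' v]
        unfolding b_def by simp_all
      with that show "relax K e M (cell K' v) = M (cell K' v)" "relax K e M (cell K' v + 1) = M (cell K' v + 1)"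
        "relax K e M (cell K' v + 2) = M (cell K' v + 2)"
        unfolding 2(3) by simp_all
    qed
    show ?thesis
      unfolding sound_def
    proof (intro allI impI)
      fix K' v assume v: "v < n"
      show "if relax K e M (cell K' v) = 0 then relax K e M (cell K' v + 1) = 0 \<and> relax K e M (cell K' v + 2) = 0
        else \<exists>p. stored (relax K e M) K' v p"
      proof (cases "cell K' v = b")
        case True
        then have "K' = K + pe e" "v = edst e" using cell_inj v en(2) unfolding b_def by blast+
        with new have "stored (relax K e M) K' v (q @ [e])" by simp
        moreover from this have "relax K e M (cell K' v) \<noteq> 0"
          unfolding stored_def by (elim conjE) linarith
        ultimately show ?thesis by (simp only: if_False) blast
      next
        case False
        then show ?thesis
          using M[unfolded sound_def, rule_format, OF v, of K'] unfolding stored_def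
          by (simp only: same[OF False])
      qed
    qed
  next
    case False
    then have "relax K e M = M" unfolding relax by (rule if_not_P)
    with M show ?thesis by simp
  qed
qed

lemma relax_le:
  assumes "M (cell K' v) \<noteq> 0"
  shows "relax K e M (cell K' v) \<noteq> 0 \<and> relax K e M (cell K' v + 2) \<le> M (cell K' v + 2)"
proof -
  define a where "a = cell K (esrc e)"
  define b where "b = cell (K + pe e) (edst e)"
  define c where "c = cell K' v"
  have ne: "c \<noteq> b + 1" "c \<noteq> b + 2" "c + 2 \<noteq> b" "c + 2 \<noteq> b + 1"
    using cell_ne[of K' v "K + pe e" "edst e"] cell_ne[of "K + pe e" "edst e" K' v]
    unfolding b_def c_def by simp_all
  have "relax K e M = (if 0 < M a \<and> M a < n \<and> (M b = 0 \<or> M (a + 2) + wB e < M (b + 2))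
    then M(b := Suc (M a), b + 2 := M (a + 2) + wB e, b + 1 := M (a + 1) + wA e) else M)"
    unfolding relax_def Let_def a_def b_def by (rule refl)
  then show ?thesis
    using assms ne unfolding c_def[symmetric] by (cases "c = b") simp_all
qed

text \<open>The entry at the source of \<open>e\<close> may stem from another walk than
  \<open>butlast p\<close>. Both have the same key and hence equally many edges, so the guard on the
  number of edges lets the extension through.\<close>

lemma complete_relax:
  assumes M: "sound M" "complete K X M" and e: "e \<in> set qs"
  shows "complete K (insert e X) (relax K e M)"
  unfolding complete_def
proof (intro allI impI)
  fix p v assume p: "walk (set qs) s p v" "length p < n"
    and c: "p = [] \<or> key (butlast p) < K \<or> key (butlast p) = K \<and> last p \<in> insert e X"
  define a where "a = cell K (esrc e)"
  define b where "b = cell (K + pe e) (edst e)"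
  let ?M = "relax K e M"
  let ?c = "cell (key p) v"
  have en: "esrc e < n" "edst e < n" using ends e by auto
  have relax: "?M = (if 0 < M a \<and> M a < n \<and> (M b = 0 \<or> M (a + 2) + wB e < M (b + 2))
    then M(b := Suc (M a), b + 2 := M (a + 2) + wB e, b + 1 := M (a + 1) + wA e) else M)"
    unfolding relax_def Let_def a_def b_def by (rule refl)
  show "?M ?c \<noteq> 0 \<and> ?M (?c + 2) \<le> sumB p"
  proof (cases "p = [] \<or> key (butlast p) < K \<or> key (butlast p) = K \<and> last p \<in> X")
    case True
    then have "M ?c \<noteq> 0 \<and> M (?c + 2) \<le> sumB p"
      using M(2)[unfolded complete_def, rule_format, OF p(1,2)] by simp
    then show ?thesis using relax_le[of M "key p" v K e] by linarith
  next
    case False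
    with c have "p \<noteq> []" "last p = e" and kq: "key (butlast p) = K" by auto
    define q where "q = butlast p"
    have pq: "p = q @ [e]"
      using append_butlast_last_id[OF \<open>p \<noteq> []\<close>] \<open>last p = e\<close> by (simp add: q_def)
    have q: "walk (set qs) s q (esrc e)" "length q < n" "v = edst e" using p unfolding pq by auto
    have keyq: "key q = K" using kq by (simp add: q_def)
    \<comment> \<open>Every edge adds a positive power to the key, so \<open>q\<close> itself was
      completed when an earlier key was processed.\<close>
    have "q = [] \<or> key (butlast q) < K"
    proof (cases q rule: rev_cases)
      case (snoc r d)
      then show ?thesis using keyq pe_pos[of d] by (simp add: key_def)
    qed simp
    then have Ma: "M a \<noteq> 0" "M (a + 2) \<le> sumB q"
      using M(2) q keyq unfolding complete_def a_def by auto
    then obtain q' where q': "stored M K (esrc e) q'" using M(1) en unfolding sound_def a_def by (metis)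
    have "length q' = length q"
      using q' stored_set[OF q'] walk_set[OF q(1)] q(2) keyq
      by (intro same_key(2)) (simp_all add: stored_def)
    then have "M a < n" using q' p(2) unfolding stored_def a_def pq by simp
    moreover have "?c = b" using q(3) keyq by (simp add: b_def pq key_def)
    moreover have "sumB p = sumB q + wB e" by (simp add: pq sumB_def)
    ultimately show ?thesis using Ma unfolding relax by (simp add: not_less)
  qed
qed

lemma complete_next:
  assumes "complete K (set qs) M"
  shows "complete (Suc K) {} M"
  unfolding complete_def
proof (intro allI impI)
  fix p v assume p: "walk (set qs) s p v" "length p < n"
    and c: "p = [] \<or> key (butlast p) < Suc K \<or> key (butlast p) = Suc K \<and> last p \<in> {}"
  have "p = [] \<or> last p \<in> set qs" using walk_set[OF p(1)] last_in_set[of p] by blast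
  with c have "p = [] \<or> key (butlast p) < K \<or> key (butlast p) = K \<and> last p \<in> set qs" by auto
  then show "M (cell (key p) v) \<noteq> 0 \<and> M (cell (key p) v + 2) \<le> sumB p"
    using assms[unfolded complete_def, rule_format, OF p] by simp
qed

lemma sound_init:
  assumes "\<And>a. Z \<le> a \<Longrightarrow> M a = 0" "s < n"
  shows "sound (M(cell 0 s := 1))"
  unfolding sound_def
proof (intro allI impI)
  fix K v assume v: "v < n"
  let ?M = "M(cell 0 s := 1)"
  show "if ?M (cell K v) = 0 then ?M (cell K v + 1) = 0 \<and> ?M (cell K v + 2) = 0 else \<exists>p. stored ?M K v p"
  proof (cases "cell K v = cell 0 s")
    case True
    then have "K = 0 \<and> v = s" by (rule cell_inj[OF v assms(2)])
    moreover have "stored ?M 0 s []"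
      using assms n_pos cell_ne[of 0 s 0 s] unfolding stored_def by (auto simp: defs cell_def)
    ultimately show ?thesis by auto
  next
    case False
    then show ?thesis using assms(1) cell_ne[of 0 s K v] by (auto simp: cell_def)
  qed
qed

lemma complete_init: "complete 0 {} (M(cell 0 s := 1))" if "\<And>a. Z \<le> a \<Longrightarrow> M a = 0"
  using that cell_ne[of 0 s 0 s] unfolding complete_def by (auto simp: defs cell_def)

text \<open>All walks with key \<open>K\<close> have the same \<open>wA\<close>-sum, so keeping only
  the least \<open>wB\<close>-sum loses nothing.\<close>

lemma check_cell:
  assumes "sound M" "complete K {} M" "t < n"
  shows "M (cell K t) \<noteq> 0 \<and> M (cell K t + 1) \<le> bA \<and> M (cell K t + 2) \<le> bB \<longleftrightarrow>
    (\<exists>p. walk (set qs) s p t \<and> length p < n \<and> key p = K \<and> sumA p \<le> bA \<and> sumB p \<le> bB)" (is "?L \<longleftrightarrow> ?R")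
proof
  assume ?L
  then obtain p where "stored M K t p" using assms unfolding sound_def by metis
  with \<open>?L\<close> show ?R by (auto simp: stored_def)
next
  assume ?R
  then obtain p where p: "walk (set qs) s p t" "length p < n" "key p = K" "sumA p \<le> bA" "sumB p \<le> bB" by auto
  have "p = [] \<or> key (butlast p) < K"
  proof (cases p rule: rev_cases)
    case (snoc r d)
    then show ?thesis using p(3) pe_pos[of d] by (simp add: key_def)
  qed simp
  then have c: "M (cell K t) \<noteq> 0" "M (cell K t + 2) \<le> sumB p"
    using assms(2) p unfolding complete_def by auto
  then obtain p' where p': "stored M K t p'" using assms unfolding sound_def by metis
  then have "sumA p' = sumA p" using p stored_set[OF p'] walk_set[OF p(1)]
    by (intro same_key(1)) (simp_all add: stored_def)
  then show ?L using c p p' by (auto simp: stored_def)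
qed

text \<open>The slack \<open>X\<close> leaves room for the weight of one more edge, which the
  program adds before it compares.\<close>

lemma sound_bounds:
  assumes "sound M" "v < n" "\<And>e. e \<in> set qs \<Longrightarrow> wA e \<le> X \<and> wB e \<le> X"
  shows "M (cell K v) \<le> n" "M (cell K v + 1) + X \<le> n * X" "M (cell K v + 2) + X \<le> n * X"
proof -
  have bnd: "sum_list (map h p) + X \<le> n * X"
    if "set p \<subseteq> set qs" "length p < n" "\<And>e. e \<in> set qs \<Longrightarrow> h e \<le> X" for p and h :: "wedge \<Rightarrow> nat"
  proof -
    have "sum_list (map h p) \<le> length p * X" using that(1,3) by (induction p) (auto simp: add_mono)
    moreover have "(length p + 1) * X \<le> n * X" using that(2) by (intro mult_le_mono1) simp
    ultimately show ?thesis by simp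
  qed
  have "M (cell K v) \<le> n \<and> M (cell K v + 1) + X \<le> n * X \<and> M (cell K v + 2) + X \<le> n * X"
  proof (cases "M (cell K v) = 0")
    case True
    have "X \<le> n * X" using n_pos by simp
    with True show ?thesis using assms(1)[unfolded sound_def, rule_format, OF assms(2), of K] by simp
  next
    case False
    then obtain p where "stored M K v p" using assms unfolding sound_def by metis
    with stored_set[OF this] show ?thesis using bnd[of p wA] bnd[of p wB] assms(3)
      by (simp add: stored_def defs)
  qed
  then show "M (cell K v) \<le> n" "M (cell K v + 1) + X \<le> n * X" "M (cell K v + 2) + X \<le> n * X" by auto
qed

end

section \<open>The program for the table\<close>

definition relax_prog :: com where
  "relax_prog =
    Load 16 (Reg 31) ;; Op 16 Mul (Reg 16) (Imm 3) ;; incr 16 (Reg 28) ;; Load 17 (Reg 16) ;;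
    If (Less (Imm 0) (Reg 17)) (If (Less (Reg 17) (Reg 1)) (
      Op 18 Add (Reg 31) (Reg 7) ;; Load 18 (Reg 18) ;; incr 16 (Imm 1) ;; Load 32 (Reg 16) ;; incr 18 (Reg 32) ;;
      Op 33 Add (Reg 31) (Reg 8) ;; Load 33 (Reg 33) ;; incr 16 (Imm 1) ;; Load 32 (Reg 16) ;; incr 33 (Reg 32) ;;
      Op 34 Add (Reg 9) (Reg 14) ;; Load 34 (Reg 34) ;; Op 34 Mul (Reg 34) (Reg 29) ;; incr 34 (Reg 28) ;;
      Op 35 Add (Reg 31) (Imm 1) ;; Load 35 (Reg 35) ;; Op 35 Mul (Reg 35) (Imm 3) ;; incr 34 (Reg 35) ;;
      Load 35 (Reg 34) ;; Op 36 Add (Reg 34) (Imm 2) ;; Load 37 (Reg 36) ;;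
      mov 38 (Imm 0) ;;
      If (Equal (Reg 35) (Imm 0)) (mov 38 (Imm 1)) (If (Less (Reg 33) (Reg 37)) (mov 38 (Imm 1)) Skip) ;;
      If (Equal (Reg 38) (Imm 1))
        (incr 17 (Imm 1) ;; Store (Reg 34) (Reg 17) ;; Store (Reg 36) (Reg 33) ;;
         incr 34 (Imm 1) ;; Store (Reg 34) (Reg 18)) Skip) Skip) Skip"

definition edge_body :: com where
  "edge_body = relax_prog ;; incr 14 (Imm 1) ;; incr 31 (Imm 4)"

definition check_prog :: com where
  "check_prog = Op 15 Add (Reg 28) (Reg 30) ;; Load 16 (Reg 15) ;;
    If (Less (Imm 0) (Reg 16)) (
      incr 15 (Imm 1) ;; Load 16 (Reg 15) ;;
      If (Less (Reg 5) (Reg 16)) Skip (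
        incr 15 (Imm 1) ;; Load 16 (Reg 15) ;;
        If (Less (Reg 6) (Reg 16)) Skip (mov 0 (Imm 1)))) Skip"

text \<open>Extensions go to larger keys only, so the row of a key is final when its turn comes, and
  the target can be tested before the row is used for relaxations.\<close>

definition key_body :: com where
  "key_body = check_prog ;; mov 14 (Imm 0) ;; mov 31 (Imm 6) ;;
    While (Less (Reg 14) (Reg 2)) edge_body ;; incr 25 (Imm 1) ;; incr 28 (Reg 29)"

text \<open>Registers 1 to 6 hold the header, with the \<open>wA\<close>-budget in 5; 7 and 8 are
  the offsets of \<open>wA\<close> and \<open>wB\<close> within an edge record; 9 is the array of
  powers and 10 the number of keys; 25 is the current key, 28 the address of its row, 29 the row
  size \<open>3 * n\<close>, 30 the offset of the target in a row, 31 the address of the current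
  edge record.\<close>

definition dp_prog :: com where
  "dp_prog =
    Op 30 Mul (Reg 4) (Imm 3) ;; Op 29 Mul (Reg 1) (Imm 3) ;; mov 28 (Reg 26) ;; mov 25 (Imm 0) ;;
    Op 15 Mul (Reg 3) (Imm 3) ;; incr 15 (Reg 28) ;; Store (Reg 15) (Imm 1) ;;
    While (Less (Reg 25) (Reg 10)) key_body"

context dp
begin

definition relax_regs :: "nat set" where
  "relax_regs = {16, 17, 18, 32, 33, 34, 35, 36, 37, 38}"

lemma wp_relax:
  fixes \<sigma> :: state
  assumes regs: "reg \<sigma> 1 = n" "reg \<sigma> 7 = cA" "reg \<sigma> 8 = cB" "reg \<sigma> 9 = ib" "reg \<sigma> 14 = i"
      "reg \<sigma> 28 = Z + 3 * (K * n)" "reg \<sigma> 29 = 3 * n" "reg \<sigma> 31 = ad"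
    and e: "e \<in> set qs" "mem \<sigma> ad = esrc e" "mem \<sigma> (Suc ad) = edst e" "mem \<sigma> (ad + cA) = wA e"
      "mem \<sigma> (ad + cB) = wB e" "mem \<sigma> (ib + i) = pe e"
    and M: "sound (mem \<sigma>)"
    and X: "\<And>e. e \<in> set qs \<Longrightarrow> wA e \<le> X \<and> wB e \<le> X"
    and bnd: "ad + 3 < 2 ^ w" "cA \<le> 3" "cB \<le> 3" "ib + i < 2 ^ w" "n * X < 2 ^ w" "n < 2 ^ w"
      "cell (K + pe e) n < 2 ^ w"
    and Q: "\<And>t \<sigma>'. t \<le> 37 \<Longrightarrow> (\<And>r. r \<notin> relax_regs \<Longrightarrow> reg \<sigma>' r = reg \<sigma> r) \<Longrightarrow>
      mem \<sigma>' = relax K e (mem \<sigma>) \<Longrightarrow> Q t \<sigma>'"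
  shows "wp w relax_prog Q \<sigma>"
proof -
  define a where "a = cell K (esrc e)"
  define b where "b = cell (K + pe e) (edst e)"
  define M where "M = mem \<sigma>"
  have en: "esrc e < n" "edst e < n" using ends e(1) by auto
  have pe: "1 \<le> pe e" using pe_pos by (simp add: Suc_leI)
  have addr: "esrc e * 3 + (Z + 3 * (K * n)) = a"
    "pe e * (3 * n) + (Z + 3 * (K * n)) + edst e * 3 = b"
    by (simp_all add: a_def b_def cell_def algebra_simps)
  have ab: "a + 2 < 2 ^ w" "b + 2 < 2 ^ w" "esrc e * 3 < 2 ^ w" "edst e * 3 < 2 ^ w"
    "pe e * (3 * n) < 2 ^ w" "pe e * (3 * n) + (Z + 3 * (K * n)) < 2 ^ w" "pe e < 2 ^ w"
  proof -
    have c: "cell (K + pe e) n = Z + 3 * (K * n) + 3 * (pe e * n) + 3 * n" by (simp add: cell_def algebra_simps)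
    have "n \<le> pe e * n" "pe e \<le> pe e * n" using pe n_pos by simp_all
    then show "a + 2 < 2 ^ w" "b + 2 < 2 ^ w" "esrc e * 3 < 2 ^ w" "edst e * 3 < 2 ^ w"
      "pe e * (3 * n) < 2 ^ w" "pe e * (3 * n) + (Z + 3 * (K * n)) < 2 ^ w" "pe e < 2 ^ w"
      using bnd(7) en unfolding c addr[symmetric] by (linarith | simp add: algebra_simps)+
  qed
  note sb = sound_bounds[OF M _ X]
  have Ma: "M a \<le> n" "M (a + 1) + X \<le> n * X" "M (a + 2) + X \<le> n * X"
    using sb[OF en(1), of K] unfolding M_def a_def by simp_all
  have Mb: "M b \<le> n" "M (b + 1) + X \<le> n * X" "M (b + 2) + X \<le> n * X"
    using sb[OF en(2), of "K + pe e"] unfolding M_def b_def by simp_all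
  have Xe: "wA e \<le> X" "wB e \<le> X" using X e(1) by auto
  have val: "M a < 2 ^ w" "M (Suc a) < 2 ^ w" "M (Suc (Suc a)) < 2 ^ w" "wA e < 2 ^ w" "wB e < 2 ^ w"
    "wA e + M (Suc a) < 2 ^ w" "wB e + M (Suc (Suc a)) < 2 ^ w"
    "M b < 2 ^ w" "M (Suc (Suc b)) < 2 ^ w" "Suc 0 < 2 ^ w" "M a < n \<Longrightarrow> Suc (M a) < 2 ^ w"
    using Ma Mb Xe bnd by simp_all
  have adr: "ad < 2 ^ w" "Suc ad < 2 ^ w" "ad + cA < 2 ^ w" "ad + cB < 2 ^ w" "a < 2 ^ w" "Suc a < 2 ^ w"
    "Suc (Suc a) < 2 ^ w" "b < 2 ^ w" "Suc b < 2 ^ w" "Suc (Suc b) < 2 ^ w" "esrc e < 2 ^ w" "edst e < 2 ^ w"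
    using bnd ab en by simp_all
  have relax: "relax K e M = (if 0 < M a \<and> M a < n \<and> (M b = 0 \<or> wB e + M (Suc (Suc a)) < M (Suc (Suc b)))
    then M(b := Suc (M a), Suc (Suc b) := wB e + M (Suc (Suc a)), Suc b := wA e + M (Suc a)) else M)"
    unfolding relax_def Let_def a_def b_def
      numeral_2_eq_2 One_nat_def add_Suc_right add_0_right by (simp only: add.commute)
  note rd = bnd(4) regs[unfolded One_nat_def] e(2-6)[folded M_def] M_def[symmetric] addr val ab adr
  consider (skip) "M a = 0 \<or> n \<le> M a" | (better) "0 < M a" "M a < n" "M b = 0 \<or> wB e + M (Suc (Suc a)) < M (Suc (Suc b))"
    | (worse) "0 < M a" "M a < n" "M b \<noteq> 0" "\<not> wB e + M (Suc (Suc a)) < M (Suc (Suc b))"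
    by linarith
  then show ?thesis
  proof cases
    case skip
    then have 1: "relax K e M = M" using relax by auto
    show ?thesis
    proof (cases "M a = 0")
      case True
      show ?thesis unfolding relax_prog_def
        by (simp add: rd True, intro Q) (simp_all add: relax_regs_def M_def[symmetric] 1)
    next
      case False
      with skip have "\<not> M a < n" "0 < M a" by auto
      then show ?thesis unfolding relax_prog_def
        by (simp add: rd, intro Q) (simp_all add: relax_regs_def M_def[symmetric] 1)
    qed
  next
    case better
    then have 1: "relax K e M = M(b := Suc (M a), Suc (Suc b) := wB e + M (Suc (Suc a)), Suc b := wA e + M (Suc a))"
      using relax by auto
    show ?thesis
    proof (cases "M b = 0")
      case True
      show ?thesis unfolding relax_prog_def
        by (simp add: rd better(1,2) True, intro Q) (simp_all add: relax_regs_def M_def[symmetric] 1)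
    next
      case False
      with better(3) have "wB e + M (Suc (Suc a)) < M (Suc (Suc b))" "0 < M b" by auto
      then show ?thesis unfolding relax_prog_def
        by (simp add: rd better(1,2), intro Q) (simp_all add: relax_regs_def M_def[symmetric] 1)
    qed
  next
    case worse
    then have 1: "relax K e M = M" using relax by auto
    show ?thesis unfolding relax_prog_def
      by (simp add: rd worse, intro Q) (simp_all add: relax_regs_def M_def[symmetric] 1)
  qed
qed

lemma relax_below: "a < Z \<Longrightarrow> relax K e M a = M a"
  by (auto simp: relax_def Let_def cell_def)

definition hit :: "nat \<Rightarrow> nat \<Rightarrow> nat \<Rightarrow> wedge list \<Rightarrow> bool" where
  "hit t bA bB p \<longleftrightarrow> walk (set qs) s p t \<and> length p < n \<and> sumA p \<le> bA \<and> sumB p \<le> bB"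

lemma wp_dp_prog:
  fixes \<sigma> :: state
  defines "m \<equiv> length qs"
  assumes regs: "reg \<sigma> 0 = 0" "reg \<sigma> 1 = n" "reg \<sigma> 2 = m" "reg \<sigma> 3 = s" "reg \<sigma> 4 = t"
      "reg \<sigma> 5 = bA" "reg \<sigma> 6 = bB" "reg \<sigma> 7 = cA" "reg \<sigma> 8 = cB" "reg \<sigma> 9 = ib"
      "reg \<sigma> 10 = n ^ k" "reg \<sigma> 26 = Z"
    and mem: "\<And>i. i < m \<Longrightarrow> mem \<sigma> (6 + 4 * i) = esrc (qs ! i) \<and> mem \<sigma> (7 + 4 * i) = edst (qs ! i) \<and>
        mem \<sigma> (6 + 4 * i + cA) = wA (qs ! i) \<and> mem \<sigma> (6 + 4 * i + cB) = wB (qs ! i) \<and>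
        mem \<sigma> (ib + i) = pe (qs ! i)"
      "\<And>a. Z \<le> a \<Longrightarrow> mem \<sigma> a = 0"
    and X: "\<And>e. e \<in> set qs \<Longrightarrow> wA e \<le> X \<and> wB e \<le> X"
    and bnd: "s < n" "t < n" "cA \<le> 3" "cB \<le> 3" "6 + 4 * m \<le> Z" "ib + m \<le> Z" "n * X < 2 ^ w"
      "Z + 9 * (n ^ k * n) + 10 < 2 ^ w"
    and Q: "\<And>u \<sigma>'. u \<le> n ^ k * (40 * m + 20) + 9 \<Longrightarrow>
      reg \<sigma>' 0 = of_bool (\<exists>p. hit t bA bB p) \<Longrightarrow> Q u \<sigma>'"
  shows "wp w dp_prog Q \<sigma>"
proof -
  define M0 where "M0 = mem \<sigma>"
  define R where "R = reg \<sigma>"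
  define ctx where "ctx \<tau> \<longleftrightarrow> (\<forall>r\<in>{1,2,3,4,5,6,7,8,9,10,26}. reg \<tau> r = R r) \<and> reg \<tau> 29 = 3 * n \<and>
      reg \<tau> 30 = 3 * t \<and> (\<forall>a<Z. mem \<tau> a = M0 a)" for \<tau> :: state
  define found where "found K \<longleftrightarrow> (\<exists>p. hit t bA bB p \<and> key p < K)" for K
  have np: "1 \<le> n ^ k" using n_pos by (simp add: Suc_leI)
  have nk: "n \<le> n ^ k * n" "n ^ k \<le> n ^ k * n" using np n_pos by simp_all
  have small: "3 * n + 10 < 2 ^ w" "Z + 3 * (n ^ k * n) + 10 < 2 ^ w" "n ^ k + 10 < 2 ^ w" "Suc m < 2 ^ w"
    "10 + 4 * m < 2 ^ w"
    using bnd nk np by linarith+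
  define inv1 where "inv1 K i \<tau> \<longleftrightarrow> ctx \<tau> \<and> reg \<tau> 25 = K \<and> reg \<tau> 28 = Z + 3 * (K * n) \<and> reg \<tau> 14 = i \<and>
      reg \<tau> 31 = 6 + 4 * i \<and> reg \<tau> 0 = of_bool (found (Suc K)) \<and> sound (mem \<tau>) \<and>
      complete K (set (take i qs)) (mem \<tau>)" for K i and \<tau> :: state
  define inv2 where "inv2 K \<tau> \<longleftrightarrow> ctx \<tau> \<and> reg \<tau> 25 = K \<and> reg \<tau> 28 = Z + 3 * (K * n) \<and>
      reg \<tau> 0 = of_bool (found K) \<and> sound (mem \<tau>) \<and> complete K {} (mem \<tau>)" for K and \<tau> :: state
  have Kn: "Z + 3 * (K * n) + 3 * n + 10 < 2 ^ w" "Suc K < 2 ^ w" "K * n + n \<le> n ^ k * n" if "K < n ^ k" for K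
  proof -
    have "(K + 1) * n \<le> n ^ k * n" using that by (intro mult_le_mono1) simp
    then show "K * n + n \<le> n ^ k * n" by simp
    with small that show "Z + 3 * (K * n) + 3 * n + 10 < 2 ^ w" "Suc K < 2 ^ w" by linarith+
  qed
  have edge: "wp w edge_body (\<lambda>u \<tau>'. u \<le> (39::nat) \<and> inv1 K (Suc i) \<tau>') \<tau>"
    if i: "i < m" and K: "K < n ^ k" and inv: "inv1 K i \<tau>" for i K and \<tau> :: state
    unfolding edge_body_def wp_Seq
  proof (rule wp_relax[where K = K and e = "qs ! i" and X = X and i = i and ib = ib and cA = cA and cB = cB and ad = "6 + 4 * i"])
    have \<tau>: "reg \<tau> 1 = n" "reg \<tau> 7 = cA" "reg \<tau> 8 = cB" "reg \<tau> 9 = ib" "reg \<tau> 14 = i"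
      "reg \<tau> 28 = Z + 3 * (K * n)" "reg \<tau> 29 = 3 * n" "reg \<tau> 31 = 6 + 4 * i"
      using inv regs by (auto simp: inv1_def ctx_def R_def)
    then show "reg \<tau> 1 = n" "reg \<tau> 7 = cA" "reg \<tau> 8 = cB" "reg \<tau> 9 = ib" "reg \<tau> 14 = i"
      "reg \<tau> 28 = Z + 3 * (K * n)" "reg \<tau> 29 = 3 * n" "reg \<tau> 31 = 6 + 4 * i" by blast+
    show ei: "qs ! i \<in> set qs" using i by (simp add: m_def)
    have below: "mem \<tau> a = M0 a" if "a < Z" for a using inv that by (auto simp: inv1_def ctx_def)
    show "mem \<tau> (6 + 4 * i) = esrc (qs ! i)" "mem \<tau> (Suc (6 + 4 * i)) = edst (qs ! i)"
      "mem \<tau> (6 + 4 * i + cA) = wA (qs ! i)" "mem \<tau> (6 + 4 * i + cB) = wB (qs ! i)"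
      "mem \<tau> (ib + i) = pe (qs ! i)"
      using mem(1)[OF i] i bnd by (simp_all add: below M0_def)
    show M: "sound (mem \<tau>)" using inv by (simp add: inv1_def)
    \<comment> \<open>This bounds the new key by \<open>2 * n ^ k\<close>, and every address of its
      row by what the reserved room \<open>9 * (n ^ k * n)\<close> admits.\<close>
    have "pe (qs ! i) \<le> n ^ k"
      using bij_betw_apply[OF f, of "wA (qs ! i)"] ei n_pos by (auto simp: pe_def intro!: power_increasing)
    then have "(K + pe (qs ! i)) * n \<le> (K + n ^ k) * n" by (intro mult_le_mono1) simp
    then have "(K + pe (qs ! i)) * n \<le> K * n + n ^ k * n" by (simp add: algebra_simps)
    then show "cell (K + pe (qs ! i)) n < 2 ^ w"
      using Kn(1,3)[OF K] bnd(8) unfolding cell_def distrib_right distrib_left by linarith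
    show "6 + 4 * i + 3 < 2 ^ w" "ib + i < 2 ^ w" "n < 2 ^ w" using i bnd small by linarith+
    fix u :: nat and \<tau>1 :: state assume u: "u \<le> 37" and r: "\<And>r. r \<notin> relax_regs \<Longrightarrow> reg \<tau>1 r = reg \<tau> r"
      and m1: "mem \<tau>1 = relax K (qs ! i) (mem \<tau>)"
    have "complete K (set (take (Suc i) qs)) (mem \<tau>1)"
      using complete_relax[OF M _ ei, of K "set (take i qs)"] inv i m1
      by (simp add: inv1_def take_Suc_conv_app_nth m_def)
    then have "inv1 K (Suc i) (\<tau>1\<lparr>reg := (reg \<tau>1)(14 := Suc i, 31 := 10 + 4 * i)\<rparr>)"
      using inv sound_relax[OF M ei, of K] m1 r relax_below
      by (auto simp: inv1_def ctx_def relax_regs_def)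
    moreover have "reg \<tau>1 14 = i" "reg \<tau>1 31 = 6 + 4 * i" using r \<tau> by (auto simp: relax_regs_def)
    ultimately show "wp w (incr 14 (Imm 1)) (\<lambda>t :: nat. wp w (incr 31 (Imm 4))
        (\<lambda>t'. (\<lambda>t'. (\<lambda>u \<tau>'. u \<le> (39::nat) \<and> inv1 K (Suc i) \<tau>') (u + t')) (t + t'))) \<tau>1"
      using u small i by simp
  qed (use bnd X in auto)
  have check: "wp w check_prog (\<lambda>u \<tau>'. u \<le> 12 \<and> (\<forall>r. r \<notin> {0, 15, 16} \<longrightarrow> reg \<tau>' r = reg \<tau> r) \<and> mem \<tau>' = mem \<tau> \<and>
      reg \<tau>' 0 = of_bool (found (Suc K))) \<tau>"
    if K: "K < n ^ k" and inv: "inv2 K \<tau>" for K and \<tau> :: state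
  proof -
    have \<tau>: "reg \<tau> 28 + reg \<tau> 30 = cell K t" "reg \<tau> 5 = bA" "reg \<tau> 6 = bB" "reg \<tau> 0 = of_bool (found K)"
      using inv regs by (auto simp: inv2_def ctx_def R_def cell_def)
    have M: "sound (mem \<tau>)" "complete K {} (mem \<tau>)" using inv by (auto simp: inv2_def)
    have chk: "found (Suc K) \<longleftrightarrow> found K \<or> (mem \<tau> (cell K t) \<noteq> 0 \<and> mem \<tau> (cell K t + 1) \<le> bA \<and> mem \<tau> (cell K t + 2) \<le> bB)"
      unfolding check_cell[OF M bnd(2)] found_def hit_def less_Suc_eq by blast
    have "cell K t + 2 < 2 ^ w" using Kn[OF K] bnd(2) by (simp add: cell_def)
    moreover have "mem \<tau> (cell K t) \<le> n" "mem \<tau> (cell K t + 1) + X \<le> n * X" "mem \<tau> (cell K t + 2) + X \<le> n * X"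
      using sound_bounds[OF M(1) bnd(2) X] by auto
    ultimately have "cell K t < 2 ^ w" "Suc (cell K t) < 2 ^ w" "Suc (Suc (cell K t)) < 2 ^ w" "mem \<tau> (cell K t) < 2 ^ w"
       "mem \<tau> (Suc (cell K t)) < 2 ^ w" "mem \<tau> (Suc (Suc (cell K t))) < 2 ^ w" "Suc 0 < 2 ^ w"
      using bnd small by simp_all
    then show ?thesis using \<tau> chk by (auto simp: check_prog_def not_less)
  qed
  have loop1: "wp w (While (Less (Reg 14) (Reg 2)) edge_body) Q' \<tau>"
    if K: "K < n ^ k" and init: "inv1 K 0 \<tau>" and post: "\<And>u \<tau>. u \<le> m * 40 + 1 \<Longrightarrow> inv1 K m \<tau> \<Longrightarrow> Q' u \<tau>" for K \<tau> Q'
  proof (rule wp_While[where I = "inv1 K" and n = m and T = 39])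
    have "reg \<tau> 2 = m" if "inv1 K i \<tau>" for i \<tau> using that regs by (auto simp: inv1_def ctx_def R_def)
    then show "holds \<tau> (Less (Reg 14) (Reg 2)) \<and> wp w edge_body (\<lambda>t \<tau>'. t \<le> 39 \<and> inv1 K (Suc i) \<tau>') \<tau>"
      if "i < m" "inv1 K i \<tau>" for i \<tau>
      using that edge[OF _ K] by (auto simp: inv1_def)
    show "\<not> holds \<tau> (Less (Reg 14) (Reg 2))" if "inv1 K m \<tau>" for \<tau>
      using that regs by (auto simp: inv1_def ctx_def R_def)
  qed (use init post in auto)
  have step: "wp w key_body (\<lambda>u \<tau>'. u \<le> 40 * m + 19 \<and> inv2 (Suc K) \<tau>') \<tau>"
    if K: "K < n ^ k" and inv: "inv2 K \<tau>" for K and \<tau> :: state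
    unfolding key_body_def
  proof (rule wp_SeqI[OF check[OF that]], elim conjE)
    fix u :: nat and \<tau>1 :: state assume u: "u \<le> 12" and r: "\<forall>r. r \<notin> {0, 15, 16} \<longrightarrow> reg \<tau>1 r = reg \<tau> r"
      and m1: "mem \<tau>1 = mem \<tau>" and f1: "reg \<tau>1 0 = of_bool (found (Suc K))"
    have 1: "inv1 K 0 (\<tau>1\<lparr>reg := (reg \<tau>1)(14 := 0, 31 := 6)\<rparr>)"
      using inv r m1 f1 by (auto simp: inv1_def inv2_def ctx_def)
    have 2: "inv2 (Suc K) (\<tau>2\<lparr>reg := (reg \<tau>2)(25 := Suc K, 28 := Z + 3 * (K * n) + 3 * n)\<rparr>) \<and> reg \<tau>2 25 = K \<and>
        reg \<tau>2 28 = Z + 3 * (K * n) \<and> reg \<tau>2 29 = 3 * n" if "inv1 K m \<tau>2" for \<tau>2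
      using that by (auto simp: inv1_def inv2_def ctx_def m_def intro: complete_next)
    show "wp w (mov 14 (Imm 0) ;; mov 31 (Imm 6) ;; While (Less (Reg 14) (Reg 2)) edge_body ;;
        incr 25 (Imm 1) ;; incr 28 (Reg 29)) (\<lambda>v \<tau>'. u + v \<le> 40 * m + 19 \<and> inv2 (Suc K) \<tau>') \<tau>1"
      using small Kn[OF K] u 1 by (auto intro!: loop1[OF K] dest!: 2)
  qed
  have loop2: "wp w (While (Less (Reg 25) (Reg 10)) key_body) Q' \<tau>"
    if init: "inv2 0 \<tau>" and post: "\<And>u \<tau>. u \<le> n ^ k * (40 * m + 20) + 1 \<Longrightarrow> inv2 (n ^ k) \<tau> \<Longrightarrow> Q' u \<tau>" for \<tau> Q'
  proof (rule wp_While[where I = inv2 and n = "n ^ k" and T = "40 * m + 19"])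
    show "holds \<tau> (Less (Reg 25) (Reg 10)) \<and> wp w key_body (\<lambda>t \<tau>'. t \<le> 40 * m + 19 \<and> inv2 (Suc i) \<tau>') \<tau>"
      if "i < n ^ k" "inv2 i \<tau>" for i \<tau>
      using that step regs by (auto simp: inv2_def ctx_def R_def)
    show "\<not> holds \<tau> (Less (Reg 25) (Reg 10))" if "inv2 (n ^ k) \<tau>" for \<tau>
      using that regs by (auto simp: inv2_def ctx_def R_def)
    show "Q' u \<tau>" if "inv2 (n ^ k) \<tau>" "u \<le> n ^ k * (40 * m + 19 + 1) + 1" for u \<tau>
      using that by (intro post) (simp_all add: algebra_simps)
  qed (use init in auto)
  \<comment> \<open>Walks with fewer than \<open>n\<close> edges have keys below
    \<open>n ^ k\<close>, so the loop over the keys misses none of them.\<close>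
  have found_all: "found (n ^ k) \<longleftrightarrow> (\<exists>p. hit t bA bB p)"
    unfolding found_def hit_def using key_less walk_set by blast
  have init: "inv2 0 (\<tau>\<lparr>mem := M0(Z + 3 * s := Suc 0)\<rparr>)"
    if "ctx (\<tau>\<lparr>mem := M0\<rparr>)" "reg \<tau> 25 = 0" "reg \<tau> 28 = Z" "reg \<tau> 0 = 0" for \<tau> :: state
    using that mem(2) bnd(1) sound_init[of M0] complete_init[of M0]
    by (auto simp: inv2_def ctx_def found_def M0_def cell_def)
  have addr: "s * 3 + Z = Z + 3 * s" by simp
  let ?\<tau> = "\<sigma>\<lparr>reg := (reg \<sigma>)(30 := t * 3, 29 := n * 3, 28 := Z, 25 := 0, 15 := Z + 3 * s)\<rparr>"
  have "inv2 0 (?\<tau>\<lparr>mem := M0(Z + 3 * s := Suc 0)\<rparr>)"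
    using regs by (intro init) (auto simp: ctx_def R_def M0_def)
  then have start: "inv2 0 (\<sigma>\<lparr>reg := (reg \<sigma>)(30 := t * 3, 29 := n * 3, 28 := Z, 25 := 0, 15 := Z + 3 * s),
      mem := (mem \<sigma>)(Z + 3 * s := Suc 0)\<rparr>)"
    by (simp add: M0_def)
  have b: "Z + 3 * s < 2 ^ w" "s * 3 < 2 ^ w" "t * 3 < 2 ^ w" "n * 3 < 2 ^ w" "Z < 2 ^ w" "Suc 0 < 2 ^ w"
    using small(1,2) bnd(1,2) nk(1) by linarith+
  show ?thesis
    unfolding dp_prog_def
    by (simp add: regs[unfolded One_nat_def] addr b, rule loop2[OF start])
      (rule Q, simp_all add: inv2_def found_all)
qed

end

section \<open>The upper bound\<close>

definition quad_list :: "wedge \<Rightarrow> nat list" where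
  "quad_list e = [esrc e, edst e, elen e, ecost e]"

definition flat :: "wedge list \<Rightarrow> nat list" where
  "flat qs = concat (map quad_list qs)"

lemma flat_simps [simp]: "flat [] = []" "flat (e # qs) = quad_list e @ flat qs" "flat (ps @ qs) = flat ps @ flat qs"
  by (simp_all add: flat_def)

lemma length_flat [simp]: "length (flat qs) = 4 * length qs"
  by (induction qs) (simp_all add: quad_list_def)

lemma nth_flat: "i < length qs \<Longrightarrow> j < 4 \<Longrightarrow> flat qs ! (4 * i + j) = quad_list (qs ! i) ! j"
proof (induction qs arbitrary: i)
  case (Cons e qs)
  show ?case
  proof (cases i)
    case 0
    have "length (quad_list e) = 4" by (simp add: quad_list_def)
    with 0 show ?thesis using Cons.prems by (simp add: nth_append)
  next
    case (Suc i')
    have "length (quad_list e) = 4" by (simp add: quad_list_def)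
    then have "flat (e # qs) ! (4 * i + j) = flat qs ! (4 * i' + j)"
      using Suc by (simp add: nth_append)
    with Cons Suc show ?thesis by simp
  qed
qed simp

definition header :: "bicriteria \<Rightarrow> nat \<Rightarrow> nat list" where
  "header I m = [num_verts I, m, source I, target I, length_budget I, cost_budget I]"

lemma bicriteria_encodingE:
  assumes "bicriteria_encoding I xs"
  obtains qs where "xs = header I (length qs) @ flat qs" "set qs = wedges I" "distinct qs"
    "length qs = card (parcs (graph I))"
proof -
  from assms obtain es where es: "distinct es" "set es = parcs (graph I)"
    "xs = [num_verts I, length es, source I, target I, length_budget I, cost_budget I] @
      concat (map (\<lambda>e. [fst e, snd e, edge_length I e, edge_cost I e]) es)"
    by (auto simp: bicriteria_encoding_def)
  let ?q = "\<lambda>e. (fst e, snd e, edge_length I e, edge_cost I e)"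
  show ?thesis
  proof (rule that[of "map ?q es"])
    show "xs = header I (length (map ?q es)) @ flat (map ?q es)"
      by (simp add: es(3) header_def flat_def quad_list_def o_def)
    show "set (map ?q es) = wedges I" by (simp add: es(2) wedges_def)
    show "distinct (map ?q es)" using es(1) by (auto simp: distinct_map inj_on_def)
    show "length (map ?q es) = card (parcs (graph I))" using distinct_card[OF es(1)] es(2) by simp
  qed
qed

text \<open>Rounding the logarithm up costs less than one bit, which \<open>B >= 2\<close> pays for
  with one more factor \<open>log 2 B\<close>.\<close>

lemma word_exists:
  assumes "2 \<le> (B :: real)"
  obtains w where "B ^ d \<le> 2 ^ w" "real w \<le> real (d + 1) * log 2 B"
proof
  let ?w = "nat \<lceil>real d * log 2 B\<rceil>"
  have log: "1 \<le> log 2 B" using assms by simp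
  then have ge: "0 \<le> real d * log 2 B" by simp
  have "real ?w \<le> real d * log 2 B + 1" using ge by linarith
  also have "\<dots> \<le> real (d + 1) * log 2 B" using log by (simp add: algebra_simps)
  finally show "real ?w \<le> real (d + 1) * log 2 B" .
  have "B ^ d = 2 powr (real d * log 2 B)"
    using assms by (simp add: powr_powr[symmetric] powr_realpow mult.commute[of "real d"])
  also have "\<dots> \<le> 2 powr real ?w" by (intro powr_mono) (use ge in linarith, simp)
  also have "\<dots> = 2 ^ ?w" by (simp add: powr_realpow)
  finally show "B ^ d \<le> 2 ^ ?w" .
qed

text \<open>The input is followed by two arrays of \<open>m\<close> powers, for the lengths at
  register 20 and for the costs at register 21, and then by the table at register 26.\<close>

definition read_header :: com where
  "read_header =
    Load 1 (Imm 0) ;; Load 2 (Imm 1) ;; Load 3 (Imm 2) ;; Load 4 (Imm 3) ;; Load 5 (Imm 4) ;; Load 6 (Imm 5) ;;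
    Op 20 Mul (Reg 2) (Imm 4) ;; incr 20 (Imm 6) ;; Op 21 Add (Reg 20) (Reg 2) ;; Op 26 Add (Reg 21) (Reg 2)"

text \<open>If the costs were exhausted first, the two columns, the arrays and the budgets exchange
  their roles.\<close>

definition solver :: com where
  "solver =
    read_header ;; discover ;;
    If (Equal (Reg 19) (Imm 0)) (mov 7 (Imm 2) ;; mov 8 (Imm 3) ;; mov 9 (Reg 20))
      (mov 7 (Imm 3) ;; mov 8 (Imm 2) ;; mov 9 (Reg 21) ;; mov 15 (Reg 5) ;; mov 5 (Reg 6) ;; mov 6 (Reg 15)) ;;
    dp_prog"

lemma wp_dp_prog_ranked:
  fixes \<sigma> :: state and wA wB :: "wedge \<Rightarrow> nat" and qs :: "wedge list"
  defines "m \<equiv> length qs"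
  assumes n: "0 < n" and ends: "\<And>e. e \<in> set qs \<Longrightarrow> esrc e < n \<and> edst e < n"
    and rk: "fully_ranked n m ib (\<lambda>i. wA (qs ! i)) k (mem \<sigma>)"
    and regs: "reg \<sigma> 0 = 0" "reg \<sigma> 1 = n" "reg \<sigma> 2 = m" "reg \<sigma> 3 = s" "reg \<sigma> 4 = t"
      "reg \<sigma> 5 = bA" "reg \<sigma> 6 = bB" "reg \<sigma> 7 = cA" "reg \<sigma> 8 = cB" "reg \<sigma> 9 = ib"
      "reg \<sigma> 10 = n ^ k" "reg \<sigma> 26 = Z"
    and mem: "\<And>i. i < m \<Longrightarrow> mem \<sigma> (6 + 4 * i) = esrc (qs ! i) \<and> mem \<sigma> (7 + 4 * i) = edst (qs ! i) \<and>
        mem \<sigma> (6 + 4 * i + cA) = wA (qs ! i) \<and> mem \<sigma> (6 + 4 * i + cB) = wB (qs ! i)"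
      "\<And>a. Z \<le> a \<Longrightarrow> mem \<sigma> a = 0"
    and X: "\<And>e. e \<in> set qs \<Longrightarrow> wA e \<le> X \<and> wB e \<le> X"
    and bnd: "s < n" "t < n" "cA \<le> 3" "cB \<le> 3" "6 + 4 * m \<le> Z" "ib + m \<le> Z" "n * X < 2 ^ w"
      "Z + 9 * (n ^ k * n) + 10 < 2 ^ w"
    and Q: "\<And>u \<sigma>'. u \<le> n ^ k * (40 * m + 20) + 9 \<Longrightarrow>
      reg \<sigma>' 0 = of_bool (\<exists>p. walk (set qs) s p t \<and> length p < n \<and> sum_list (map wA p) \<le> bA \<and> sum_list (map wB p) \<le> bB) \<Longrightarrow>
      Q u \<sigma>'"
  shows "wp w dp_prog Q \<sigma>"
proof -
  have im: "(\<lambda>i. wA (qs ! i)) ` {..<m} = wA ` set qs"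
    unfolding m_def by (auto simp: set_conv_nth)
  from rk obtain f where fr: "bij_betw f (wA ` set qs) {..<k}" "\<And>i. i < m \<Longrightarrow> mem \<sigma> (ib + i) = n ^ f (wA (qs ! i))"
    unfolding fully_ranked_def im by auto
  interpret dp n k Z s qs wA wB f
    using n ends fr(1) by unfold_locales auto
  show ?thesis
    by (rule wp_dp_prog[OF regs[unfolded m_def] _ _ X bnd[unfolded m_def]])
      (use mem fr(2) Q in \<open>auto simp: m_def pe_def hit_def sumA_def sumB_def\<close>)
qed

lemma wp_solver:
  fixes I :: bicriteria
  assumes I: "I \<in> bicriteria_instances" and qs: "set qs = wedges I"
    and n_def: "n = num_verts I" and m_def: "m = length qs"
    and k_def: "k = min (num_lengths I) (num_costs I)"
    and X: "\<And>e. e \<in> set qs \<Longrightarrow> elen e \<le> X \<and> ecost e \<le> X"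
    and bnd: "n * X < 2 ^ w" "16 + 6 * m + 9 * (n ^ k * n) < 2 ^ w" "length_budget I < 2 ^ w" "cost_budget I < 2 ^ w"
  shows "wp w solver (\<lambda>u \<sigma>'. u \<le> 40 + (k + 1) * (24 * m + 17) + n ^ k * (40 * m + 20) \<and>
    reg \<sigma>' 0 = of_bool (has_bicriteria_path I)) (initial (header I m @ flat qs))"
proof -
  from I interpret pair_fin_digraph "graph I" by (simp add: bicriteria_instances_def)
  have st: "source I < n" "target I < n" and V: "pverts (graph I) = {..<n}"
    using I by (auto simp: bicriteria_instances_def n_def)
  then have n: "0 < n" by auto
  have ends: "esrc e < n \<and> edst e < n" if "e \<in> set qs" for e
    using that V arc_fst_in_verts arc_snd_in_verts unfolding qs wedges_def by fastforce
  have Xi: "elen (qs ! i) \<le> X \<and> ecost (qs ! i) \<le> X" if "i < m" for i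
    using that X by (simp add: m_def)
  have nk: "n \<le> n ^ k * n" "n ^ k \<le> n ^ k * n" using n by simp_all
  have sz: "n < 2 ^ w" "n ^ k < 2 ^ w" "10 + 6 * m < 2 ^ w" "X \<le> n * X"
    using bnd nk n by (linarith | simp)+
  have Xw: "elen (qs ! i) < 2 ^ w" "ecost (qs ! i) < 2 ^ w" if "i < m" for i
    using Xi[OF that] sz(4) bnd(1) by linarith+
  have im: "(\<lambda>i. g (qs ! i)) ` {..<m} = g ` set qs" for g :: "wedge \<Rightarrow> nat"
    unfolding m_def by (auto simp: set_conv_nth)
  have "elen ` wedges I = edge_length I ` parcs (graph I)" "ecost ` wedges I = edge_cost I ` parcs (graph I)"
    unfolding wedges_def by (auto simp: image_image)
  then have k: "min (card ((\<lambda>i. elen (qs ! i)) ` {..<m})) (card ((\<lambda>i. ecost (qs ! i)) ` {..<m})) = k"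
    unfolding im k_def num_lengths_def num_costs_def by (simp add: qs)
  define \<sigma> where "\<sigma> = initial (header I m @ flat qs)"
  have hd: "mem \<sigma> 0 = n" "mem \<sigma> (Suc 0) = m" "mem \<sigma> 2 = source I" "mem \<sigma> 3 = target I"
    "mem \<sigma> 4 = length_budget I" "mem \<sigma> 5 = cost_budget I"
    by (simp_all add: \<sigma>_def initial_def header_def n_def)
  have cells: "mem \<sigma> (6 + (4 * i + j)) = quad_list (qs ! i) ! j" if "i < m" "j < 4" for i j
    using that nth_flat[of i qs j] by (simp add: \<sigma>_def initial_def header_def nth_append m_def)
  have edge: "mem \<sigma> (6 + 4 * i) = esrc (qs ! i)" "mem \<sigma> (7 + 4 * i) = edst (qs ! i)"
    "mem \<sigma> (8 + 4 * i) = elen (qs ! i)" "mem \<sigma> (9 + 4 * i) = ecost (qs ! i)" if "i < m" for i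
    using cells[OF that, of 0] cells[OF that, of 1] cells[OF that, of 2] cells[OF that, of 3]
    by (simp_all add: quad_list_def)
  have zero: "mem \<sigma> a = 0" if "6 + 4 * m \<le> a" for a
    using that by (simp add: \<sigma>_def initial_def header_def m_def)
  have reg0: "reg \<sigma> r = 0" for r by (simp add: \<sigma>_def initial_def)
  have path: "has_bicriteria_path I \<longleftrightarrow> (\<exists>p. walk (set qs) (source I) p (target I) \<and> length p < n \<and>
      sum_list (map elen p) \<le> length_budget I \<and> sum_list (map ecost p) \<le> cost_budget I)"
    using has_path_iff_walk(2)[OF I] by (simp add: qs n_def within_budgets_def)
  define \<tau> where "\<tau> = \<sigma>\<lparr>reg := (reg \<sigma>)(1 := n, 2 := m, 3 := source I, 4 := target I, 5 := length_budget I,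
      6 := cost_budget I, 20 := 6 + 4 * m, 21 := 6 + 5 * m, 26 := 6 + 6 * m)\<rparr>"
  define ans :: nat where "ans = of_bool (has_bicriteria_path I)"
  define T where "T = 40 + (k + 1) * (24 * m + 17) + n ^ k * (40 * m + 20)"
  let ?Q = "\<lambda>u \<sigma>'. u \<le> T \<and> reg \<sigma>' 0 = ans"
  have main: "wp w (discover ;; 
    If (Equal (Reg 19) (Imm 0)) (mov 7 (Imm 2) ;; mov 8 (Imm 3) ;; mov 9 (Reg 20))
      (mov 7 (Imm 3) ;; mov 8 (Imm 2) ;; mov 9 (Reg 21) ;; mov 15 (Reg 5) ;; mov 5 (Reg 6) ;; mov 6 (Reg 15)) ;;
    dp_prog) (\<lambda>u. ?Q (10 + u)) \<tau>"
    unfolding wp_Seq[of w discover]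
  proof (rule wp_discover[where n = n and m = m and wl = "\<lambda>i. elen (qs ! i)" and wc = "\<lambda>i. ecost (qs ! i)"], unfold k)
    show "reg \<tau> 1 = n" "reg \<tau> 2 = m" "reg \<tau> 20 = 6 + 4 * m" "reg \<tau> 21 = 6 + 5 * m" by (simp_all add: \<tau>_def)
    show "mem \<tau> (8 + 4 * i) = elen (qs ! i) \<and> elen (qs ! i) < 2 ^ w" if "i < m" for i
      using edge[OF that] Xw[OF that] by (simp add: \<tau>_def)
    show "mem \<tau> (9 + 4 * i) = ecost (qs ! i) \<and> ecost (qs ! i) < 2 ^ w" if "i < m" for i
      using edge[OF that] Xw[OF that] by (simp add: \<tau>_def)
    show "mem \<tau> a = 0" if "6 + 4 * m \<le> a" for a using zero[OF that] by (simp add: \<tau>_def)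
    fix u :: nat and \<tau>1 :: state
    assume u: "u \<le> (k + 1) * (24 * m + 17) + 4" and r: "\<And>r. r \<notin> {10..19} \<Longrightarrow> reg \<tau>1 r = reg \<tau> r"
      and M: "\<And>a. a < 6 + 4 * m \<or> 6 + 6 * m \<le> a \<Longrightarrow> mem \<tau>1 a = mem \<tau> a" and pw: "reg \<tau>1 10 = n ^ k"
      and fin: "reg \<tau>1 19 = 0 \<and> fully_ranked n m (6 + 4 * m) (\<lambda>i. elen (qs ! i)) k (mem \<tau>1) \<or>
       reg \<tau>1 19 = 1 \<and> fully_ranked n m (6 + 5 * m) (\<lambda>i. ecost (qs ! i)) k (mem \<tau>1)"
    have r1: "reg \<tau>1 0 = 0" "reg \<tau>1 (Suc 0) = n" "reg \<tau>1 2 = m" "reg \<tau>1 3 = source I" "reg \<tau>1 4 = target I"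
      "reg \<tau>1 5 = length_budget I" "reg \<tau>1 6 = cost_budget I" "reg \<tau>1 20 = 6 + 4 * m" "reg \<tau>1 21 = 6 + 5 * m"
      "reg \<tau>1 26 = 6 + 6 * m"
      using r reg0 by (simp_all add: \<tau>_def)
    have M1: "mem \<tau>1 (6 + 4 * i) = esrc (qs ! i)" "mem \<tau>1 (7 + 4 * i) = edst (qs ! i)"
      "mem \<tau>1 (8 + 4 * i) = elen (qs ! i)" "mem \<tau>1 (9 + 4 * i) = ecost (qs ! i)" if "i < m" for i
      using that edge[OF that] M by (simp_all add: \<tau>_def)
    have Z1: "mem \<tau>1 a = 0" if "6 + 6 * m \<le> a" for a using that M zero by (simp add: \<tau>_def)
    have b: "2 < (2::nat) ^ w" "3 < (2::nat) ^ w" "6 + 4 * m < 2 ^ w" "6 + 5 * m < 2 ^ w" using sz(3) by linarith+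
    from fin show "wp w (If (Equal (Reg 19) (Imm 0)) (mov 7 (Imm 2) ;; mov 8 (Imm 3) ;; mov 9 (Reg 20))
      (mov 7 (Imm 3) ;; mov 8 (Imm 2) ;; mov 9 (Reg 21) ;; mov 15 (Reg 5) ;; mov 5 (Reg 6) ;; mov 6 (Reg 15)) ;;
      dp_prog) (\<lambda>t'. (\<lambda>u. ?Q (10 + u)) (u + t')) \<tau>1"
    proof (elim disjE conjE)
      assume "reg \<tau>1 19 = 0" "fully_ranked n m (6 + 4 * m) (\<lambda>i. elen (qs ! i)) k (mem \<tau>1)"
      then show ?thesis using b r1
        apply simp
        apply (rule wp_dp_prog_ranked[where wA = elen and wB = ecost and qs = qs and X = X and cA = 2 and cB = 3 and n = n and k = k
            and s = "source I" and t = "target I" and Z = "6 + 6 * m" and ib = "6 + 4 * m"])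
        using n ends r1 pw M1 Z1 X st bnd u
        by (simp_all add: m_def[symmetric] ans_def path T_def conj_commute del: of_bool_eq_1_iff of_bool_eq_0_iff split del: split_of_bool)
    next
      assume "reg \<tau>1 19 = 1" "fully_ranked n m (6 + 5 * m) (\<lambda>i. ecost (qs ! i)) k (mem \<tau>1)"
      then show ?thesis using b r1 bnd(3,4)
        apply simp
        apply (rule wp_dp_prog_ranked[where wA = ecost and wB = elen and qs = qs and X = X and cA = 3 and cB = 2 and n = n and k = k
            and s = "source I" and t = "target I" and Z = "6 + 6 * m" and ib = "6 + 5 * m"])
        using n ends r1 pw M1 Z1 X st bnd u
        by (simp_all add: m_def[symmetric] ans_def path T_def conj_commute del: of_bool_eq_1_iff of_bool_eq_0_iff split del: split_of_bool)
    qed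
  qed (use n sz in auto)
  have b: "0 < (2::nat) ^ w" "Suc 0 < 2 ^ w" "2 < (2::nat) ^ w" "3 < (2::nat) ^ w" "4 < (2::nat) ^ w" "5 < (2::nat) ^ w"
    "m * 4 < 2 ^ w" "6 + 4 * m < 2 ^ w" "6 + 5 * m < 2 ^ w" "6 + 6 * m < 2 ^ w" "m < 2 ^ w"
    "source I < 2 ^ w" "target I < 2 ^ w" using sz st by linarith+
  have ar: "m * 4 + 6 = 6 + 4 * m" "6 + 4 * m + m = 6 + 5 * m" "6 + 5 * m + m = 6 + 6 * m" by simp_all
  have init: "wp w read_header (\<lambda>u \<sigma>'. u = 10 \<and> \<sigma>' = \<tau>) \<sigma>"
    unfolding read_header_def by (simp add: hd b bnd sz ar \<tau>_def)
  show ?thesis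
    unfolding solver_def \<sigma>_def[symmetric] ans_def[symmetric] T_def[symmetric] by (rule wp_SeqI[OF init]) (use main in simp)
qed

text \<open>The passes of the discovery are paid for by \<open>k + 1 <= 2 * n ^ k\<close>. This
  holds even for \<open>n = 1\<close>, where there is at most one edge.\<close>

lemma solver_time:
  fixes n m k :: nat
  assumes n: "0 < n" and m: "m \<le> n ^ 2" and k: "k \<le> m"
  shows "40 + (k + 1) * (24 * m + 17) + n ^ k * (40 * m + 20) \<le> 250 * n ^ (k + 2)"
proof -
  have k1: "k + 1 \<le> 2 * n ^ k"
  proof (cases "n = 1")
    case True
    then show ?thesis using m k by simp
  next
    case False
    with n have "2 ^ k \<le> n ^ k" by (intro power_mono) auto
    moreover have "k < 2 ^ k" by (rule less_exp)
    ultimately show ?thesis by linarith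
  qed
  define N where "N = n ^ 2"
  have N: "1 \<le> N" "m \<le> N" using n m by (simp_all add: N_def)
  have p: "1 \<le> n ^ k" using n by simp
  then have pN: "1 \<le> n ^ k * N" using N by simp
  define Y where "Y = n ^ k * N"
  have "(k + 1) * (24 * m + 17) \<le> (2 * n ^ k) * (41 * N)"
    using k1 N by (intro mult_mono) auto
  then have "(k + 1) * (24 * m + 17) \<le> 82 * Y" by (simp add: Y_def)
  moreover have "n ^ k * (40 * m + 20) \<le> n ^ k * (60 * N)"
    using N by (intro mult_mono) auto
  then have "n ^ k * (40 * m + 20) \<le> 60 * Y" by (simp add: Y_def)
  ultimately have "40 + (k + 1) * (24 * m + 17) + n ^ k * (40 * m + 20) \<le> 250 * Y"
    using pN unfolding Y_def[symmetric] by linarith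
  then show ?thesis by (simp add: Y_def N_def power_add power2_eq_square algebra_simps)
qed

theorem bicriteria_upper_bound:
  "solvable_in_time bicriteria_encoding bicriteria_instances has_bicriteria_path
      (\<lambda>I. real (num_verts I) ^ (min (num_lengths I) (num_costs I) + 2))"
  unfolding solvable_in_time_def
proof (intro exI[of _ solver] exI[of _ "250 :: real"] ballI allI impI)
  fix I xs assume I: "I \<in> bicriteria_instances" and enc: "bicriteria_encoding I xs"
  define n where "n = num_verts I"
  define k where "k = min (num_lengths I) (num_costs I)"
  obtain qs where qs: "xs = header I (length qs) @ flat qs" "set qs = wedges I" "distinct qs"
    "length qs = card (parcs (graph I))" using enc by (rule bicriteria_encodingE)
  define m where "m = length qs"
  from I interpret pair_fin_digraph "graph I" by (simp add: bicriteria_instances_def)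
  have V: "pverts (graph I) = {..<n}" "source I < n"
    using I by (auto simp: bicriteria_instances_def n_def)
  then have n: "0 < n" by auto
  have "parcs (graph I) \<subseteq> {..<n} \<times> {..<n}"
    using V(1) arc_fst_in_verts arc_snd_in_verts by fastforce
  from card_mono[OF _ this] have m: "m \<le> n ^ 2"
    by (simp add: m_def qs(4) card_cartesian_product power2_eq_square)
  have k: "k \<le> m"
    unfolding k_def m_def qs(4) num_lengths_def using card_image_le[OF pair_finite_arcs, of "edge_length I"] by simp
  define X where "X = Max (insert 0 (set xs))"
  have X: "x \<le> X" if "x \<in> set xs" for x using that by (simp add: X_def)
  have Xq: "elen e \<le> X \<and> ecost e \<le> X" if "e \<in> set qs" for e
    using that by (intro conjI X) (auto simp: qs(1) flat_def quad_list_def)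
  have Xh: "n \<le> X" "length_budget I \<le> X" "cost_budget I \<le> X"
    by (intro X; simp add: qs(1) header_def n_def)+
  define T where "T = real n ^ (k + 2)"
  define B where "B = 2 + real (length xs) + real X + T"
  have "length xs = 6 + 4 * m" by (simp add: qs(1) header_def m_def)
  moreover have T: "1 \<le> T" unfolding T_def using n by (intro one_le_power) simp
  ultimately have B: "8 \<le> B" "6 + 4 * real m \<le> B" "real X + 1 \<le> B" "T \<le> B" by (simp_all add: B_def)
  \<comment> \<open>All addresses, sums and products are at most \<open>B ^ 2\<close> up to constant
    factors, and \<open>8 <= B\<close> lets the remaining powers of \<open>B\<close> absorb
    these.\<close>
  obtain w where w: "B ^ 5 \<le> 2 ^ w" "real w \<le> real (5 + 1) * log 2 B"
    using word_exists[of B 5] B(1) by auto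
  have bnd: "x < 2 ^ w" if "real x < B ^ 5" for x :: nat
  proof -
    from that w(1) have "real x < 2 ^ w" by linarith
    then show ?thesis by simp
  qed
  have B5: "B ^ 5 = B ^ 2 * B ^ 3" "B ^ 5 = B * B ^ 4" by (simp_all flip: power_add power_Suc)
  have "8 ^ 3 \<le> B ^ 3" "8 ^ 4 \<le> B ^ 4" using B(1) by (intro power_mono; simp)+
  then have "B ^ 2 * 512 \<le> B ^ 2 * B ^ 3" "B * 4096 \<le> B * B ^ 4"
    using B(1) by (intro mult_left_mono; simp)+
  then have big: "512 * B ^ 2 \<le> B ^ 5" "4096 * B \<le> B ^ 5" unfolding B5(1)[symmetric] B5(2)[symmetric] by simp_all
  have "0 < B ^ 2" using B(1) by simp
  have "real n * real X \<le> B * B" using Xh(1) B by (intro mult_mono) auto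
  then have "real n * real X < B ^ 5"
    using big(1) \<open>0 < B ^ 2\<close> unfolding power2_eq_square by linarith
  then have 1: "n * X < 2 ^ w" by (intro bnd) simp
  have "real (n ^ k * n) \<le> T"
    unfolding T_def using n by (simp add: power_add mult_left_mono self_le_power)
  then have 2: "16 + 6 * m + 9 * (n ^ k * n) < 2 ^ w" using big(2) B by (intro bnd) simp
  have 3: "length_budget I < 2 ^ w" "cost_budget I < 2 ^ w" using Xh B big(2) by (intro bnd; simp)+
  have "wp w solver (\<lambda>u \<sigma>'. u \<le> 40 + (k + 1) * (24 * m + 17) + n ^ k * (40 * m + 20) \<and>
    reg \<sigma>' 0 = of_bool (has_bicriteria_path I)) (initial (header I m @ flat qs))"
    by (rule wp_solver[OF I qs(2) n_def m_def k_def Xq 1 2 3])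
  then obtain u \<sigma> where run: "run w solver (initial xs) u \<sigma>"
    "u \<le> 40 + (k + 1) * (24 * m + 17) + n ^ k * (40 * m + 20)" "reg \<sigma> 0 = of_bool (has_bicriteria_path I)"
    unfolding wp_def qs(1) m_def by auto
  have "real u \<le> real (250 * n ^ (k + 2))"
    using run(2) solver_time[OF n m k] by (simp only: of_nat_le_iff)
  then have t: "real u \<le> 250 * T" by (simp add: T_def)
  have "real w \<le> 250 * log 2 B" using w(2) B(1) zero_le_log_cancel_iff[of 2 B] by simp
  with run t show "\<exists>w t \<sigma>. run w solver (initial xs) t \<sigma> \<and>
      real t \<le> 250 * real (num_verts I) ^ (min (num_lengths I) (num_costs I) + 2) \<and>
      real w \<le> 250 * log 2 (2 + real (length xs) + real (Max (insert 0 (set xs))) +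
        real (num_verts I) ^ (min (num_lengths I) (num_costs I) + 2)) \<and>
      reg \<sigma> 0 = (if has_bicriteria_path I then 1 else 0)"
    by (intro exI[of _ w] exI[of _ u] exI[of _ \<sigma>]) (auto simp: T_def B_def X_def n_def k_def)
qed

section \<open>From assignments to bicriteria paths\<close>

text \<open>The construction for an abstract satisfaction problem: \<open>G\<close> groups of
  \<open>D\<close> blocks with \<open>q\<close> values each, and \<open>sat t p a\<close> if the
  value \<open>a\<close> of block \<open>p\<close> satisfies the condition of round
  \<open>t\<close>. Round 0 is the reference round, where every block passes.\<close>

locale reduction =
  fixes G D q M :: nat and sat :: "nat \<Rightarrow> nat \<Rightarrow> nat \<Rightarrow> bool"
  assumes pos: "0 < G" "0 < D" "0 < q" "0 < M"
    and sat_0: "sat 0 p a"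
begin

definition P :: nat where "P = G * D"
text \<open>The constants are chosen so that nothing carries: \<open>Q\<close> exceeds every sum of
  \<open>M\<close> numbers below \<open>q\<close>, \<open>H\<close> is at least \<open>M\<close>
  times any code, and \<open>B\<close> exceeds the sum of the positions in the \<open>D\<close>
  blocks of a group over all \<open>M + 1\<close> rounds.\<close>

definition Q :: nat where "Q = (M + 1) * q"
definition H :: nat where "H = (M + 1) * q ^ 2 * Q ^ D"
definition B :: nat where "B = (M + 1) * D * H + 1"
definition J :: nat where "J = (M + 1) * P"

abbreviation grp :: "nat \<Rightarrow> nat" where "grp p \<equiv> p div D"
abbreviation dig :: "nat \<Rightarrow> nat" where "dig p \<equiv> p mod D"
abbreviation stage :: "nat \<Rightarrow> nat" where "stage j \<equiv> j div P"
abbreviation blk :: "nat \<Rightarrow> nat" where "blk j \<equiv> j mod P"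

text \<open>The quadratic term makes the codes strictly convex: if \<open>M\<close> codes have the average of one code,
  then they all equal it.\<close>

definition code :: "nat \<Rightarrow> nat \<Rightarrow> nat" where
  "code p a = a * Q ^ dig p + a * a * Q ^ D"

text \<open>If a block has the same value in all rounds, its positions add up to \<open>H\<close>
  independently of that value.\<close>

definition drop_at :: "nat \<Rightarrow> nat \<Rightarrow> nat" where
  "drop_at j a = (if stage j = 0 then H - M * code (blk j) a else code (blk j) a)"

definition wgt :: "nat \<Rightarrow> nat" where "wgt j = B ^ grp (blk j)"

text \<open>Position \<open>i\<close> on rail \<open>l\<close> of ladder \<open>j\<close>. Rails 0 and 1 are the upper ones, rails 2 and 3 the lower ones; on rails 1
  and 3 the clause of the current round has already been satisfied.\<close>

definition vx :: "nat \<Rightarrow> nat \<Rightarrow> nat \<Rightarrow> nat" where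
  "vx j l i = 4 * (j * (H + 1) + i) + l"

definition rail :: "nat \<Rightarrow> nat \<Rightarrow> wedge list" where
  "rail j i = [(vx j 0 i, vx j 0 (i + 1), wgt j, 0), (vx j 1 i, vx j 1 (i + 1), wgt j, 0),
    (vx j 2 i, vx j 2 (i + 1), 0, wgt j), (vx j 3 i, vx j 3 (i + 1), 0, wgt j)]"

text \<open>The third edge, from rail 0 to rail 3, is the only passage within a round from the rails
  without to those with a satisfied clause.\<close>

definition rung :: "nat \<Rightarrow> nat \<Rightarrow> wedge list" where
  "rung j a = (let i = drop_at j a in
    [(vx j 0 i, vx j 2 i, 0, 0), (vx j 1 i, vx j 3 i, 0, 0)] @
    (if sat (stage j) (blk j) a then [(vx j 0 i, vx j 3 i, 0, 0)] else []))"

text \<open>After the last block of a round only rail 3 goes on, which enforces that the clause is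
  satisfied; the next round starts on rail 0 again.\<close>

definition link :: "nat \<Rightarrow> wedge list" where
  "link j = (if blk j = P - 1 then [(vx j 3 H, vx (j + 1) 0 0, 0, 0)]
    else [(vx j 2 H, vx (j + 1) 0 0, 0, 0), (vx j 3 H, vx (j + 1) 1 0, 0, 0)])"

definition ladder :: "nat \<Rightarrow> wedge list" where
  "ladder j = concat (map (rail j) [0..<H]) @ concat (map (rung j) [0..<q]) @ link j"

definition ladders :: "nat \<Rightarrow> wedge list" where
  "ladders n = concat (map ladder [0..<n])"

definition geo :: nat where "geo = (\<Sum>g<G. B ^ g)"
text \<open>The length when the positions of each group add up to \<open>D * H\<close>.
  \<open>Cbud\<close> is what then remains of the common total
  \<open>(M + 1) * D * H * geo\<close>.\<close>

definition Lbud :: nat where "Lbud = D * H * geo"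
definition Cbud :: nat where "Cbud = M * (D * H) * geo"

lemma P_pos: "0 < P" using pos by (simp add: P_def)
lemma Q_pos: "0 < Q" using pos by (simp add: Q_def)
lemma H_pos: "0 < H" using pos Q_pos by (simp add: H_def)

lemma code_le: "a < q \<Longrightarrow> M * code p a \<le> H" "a < q \<Longrightarrow> code p a \<le> H"
proof -
  assume a: "a < q"
  have "Q ^ dig p \<le> Q ^ D" using Q_pos pos(2) by (intro power_increasing) (auto simp: less_imp_le)
  then have "code p a \<le> a * Q ^ D + a * a * Q ^ D" unfolding code_def by simp
  also have "\<dots> = a * (a + 1) * Q ^ D" by (simp add: algebra_simps)
  also have "\<dots> \<le> q * q * Q ^ D" using a by (intro mult_le_mono) auto
  finally have c: "code p a \<le> q ^ 2 * Q ^ D" by (simp add: power2_eq_square)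
  have "M * code p a \<le> (M + 1) * (q ^ 2 * Q ^ D)" by (rule mult_le_mono[OF _ c]) simp
  then show "M * code p a \<le> H" by (simp only: H_def mult.assoc)
  moreover have "code p a \<le> M * code p a" using pos(4) by simp
  ultimately show "code p a \<le> H" by linarith
qed

lemma drop_at_le: "a < q \<Longrightarrow> drop_at j a \<le> H"
  using code_le by (simp add: drop_at_def)

lemma code_less: "a < b \<Longrightarrow> code p a < code p b"
  unfolding code_def using Q_pos by (intro add_less_le_mono) (auto intro!: mult_le_mono)

text \<open>Rungs at the same position would be parallel edges, which the graphs of the instances
  cannot have.\<close>

lemma drop_at_inj: "a < q \<Longrightarrow> b < q \<Longrightarrow> drop_at j a = drop_at j b \<Longrightarrow> a = b"
proof -
  assume *: "a < q" "b < q" "drop_at j a = drop_at j b"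
  have "M * code (blk j) a = M * code (blk j) b \<or> code (blk j) a = code (blk j) b"
    using *(3) code_le(1)[OF *(1), of "blk j"] code_le(1)[OF *(2), of "blk j"]
    unfolding drop_at_def by (metis diff_diff_cancel)
  then have "code (blk j) a = code (blk j) b" using pos(4) by simp
  then show "a = b" using code_less[of a b] code_less[of b a] by (metis nat_neq_iff)
qed

lemma vx_inj: "vx j l i = vx j' l' i' \<Longrightarrow> l < 4 \<Longrightarrow> l' < 4 \<Longrightarrow> i \<le> H \<Longrightarrow> i' \<le> H \<Longrightarrow> j = j' \<and> l = l' \<and> i = i'"
proof -
  assume *: "vx j l i = vx j' l' i'" "l < 4" "l' < 4" "i \<le> H" "i' \<le> H"
  have "(4 * x + y) mod 4 = y" if "y < 4" for x y :: nat using that by simp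
  then have l: "l = l'" using *(1-3) unfolding vx_def by metis
  with *(1) have "j * (H + 1) + i = j' * (H + 1) + i'" by (simp add: vx_def)
  moreover have "(x * K + y) div K = x" "(x * K + y) mod K = y" if "y < K" for x y K :: nat
    using that by simp_all
  moreover have "i < H + 1" "i' < H + 1" using *(4,5) by simp_all
  ultimately show ?thesis using l by metis
qed

section \<open>The invariant of walks through the ladders\<close>

definition is_edge :: "nat \<Rightarrow> wedge \<Rightarrow> bool" where
  "is_edge j e \<longleftrightarrow>
    (\<exists>i<H. \<exists>f<2. e = (vx j f i, vx j f (i + 1), wgt j, 0)) \<or>
    (\<exists>i<H. \<exists>f<2. e = (vx j (2 + f) i, vx j (2 + f) (i + 1), 0, wgt j)) \<or>
    (\<exists>a<q. \<exists>f<2. e = (vx j f (drop_at j a), vx j (2 + f) (drop_at j a), 0, 0)) \<or>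
    (\<exists>a<q. sat (stage j) (blk j) a \<and> e = (vx j 0 (drop_at j a), vx j 3 (drop_at j a), 0, 0)) \<or>
    (blk j = P - 1 \<and> e = (vx j 3 H, vx (j + 1) 0 0, 0, 0)) \<or>
    (blk j \<noteq> P - 1 \<and> (\<exists>f<2. e = (vx j (2 + f) H, vx (j + 1) f 0, 0, 0)))"

lemma ex_less_2: "(\<exists>f<2::nat. R f) \<longleftrightarrow> R 0 \<or> R 1"
  by (auto simp: less_2_cases_iff)

lemma is_edge_iff: "e \<in> set (ladder j) \<longleftrightarrow> is_edge j e"
proof -
  have rail: "e \<in> set (rail j i) \<longleftrightarrow> (\<exists>f<2. e = (vx j f i, vx j f (i + 1), wgt j, 0)) \<or>
      (\<exists>f<2. e = (vx j (2 + f) i, vx j (2 + f) (i + 1), 0, wgt j))" for i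
    unfolding ex_less_2 rail_def by (simp add: disj_ac)
  have rung: "e \<in> set (rung j a) \<longleftrightarrow> (\<exists>f<2. e = (vx j f (drop_at j a), vx j (2 + f) (drop_at j a), 0, 0)) \<or>
      sat (stage j) (blk j) a \<and> e = (vx j 0 (drop_at j a), vx j 3 (drop_at j a), 0, 0)" for a
    unfolding ex_less_2 rung_def Let_def by auto
  have link: "e \<in> set (link j) \<longleftrightarrow> (blk j = P - 1 \<and> e = (vx j 3 H, vx (j + 1) 0 0, 0, 0)) \<or>
      (blk j \<noteq> P - 1 \<and> (\<exists>f<2. e = (vx j (2 + f) H, vx (j + 1) f 0, 0, 0)))"
    unfolding ex_less_2 link_def by simp
  have "e \<in> set (ladder j) \<longleftrightarrow> (\<exists>i<H. e \<in> set (rail j i)) \<or> (\<exists>a<q. e \<in> set (rung j a)) \<or> e \<in> set (link j)"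
    by (auto simp: ladder_def)
  then show ?thesis unfolding rail rung link is_edge_def by blast
qed

text \<open>Length and cost of the path that drops down in ladder \<open>j'\<close> at the position for \<open>as j'\<close>.\<close>

definition LL :: "(nat \<Rightarrow> nat) \<Rightarrow> nat \<Rightarrow> nat" where
  "LL as j = (\<Sum>j'<j. wgt j' * drop_at j' (as j'))"
definition CC :: "(nat \<Rightarrow> nat) \<Rightarrow> nat \<Rightarrow> nat" where
  "CC as j = (\<Sum>j'<j. wgt j' * (H - drop_at j' (as j')))"

definition satisfied :: "(nat \<Rightarrow> nat) \<Rightarrow> nat \<Rightarrow> nat \<Rightarrow> bool" where
  "satisfied as t b \<longleftrightarrow> (\<exists>p<b. sat t p (as (t * P + p)))"

text \<open>The invariant of a walk that ends in \<open>v\<close> with length \<open>l\<close> and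
  cost \<open>c\<close>; \<open>as\<close> records its drops. On an upper rail \<open>as j\<close>
  is still open, on a lower rail it is fixed. The flag \<open>f = 1\<close> only implies
  satisfaction, since a walk need not take a cross edge that is available.\<close>

definition reached :: "nat \<Rightarrow> nat \<Rightarrow> nat \<Rightarrow> bool" where
  "reached v l c \<longleftrightarrow> (\<exists>as j f i. (\<forall>x. as x < q) \<and> f < 2 \<and> i \<le> H \<and>
    (\<forall>t<stage j. satisfied as t P) \<and>
    (v = vx j f i \<and> l = LL as j + wgt j * i \<and> c = CC as j \<and> (f = 1 \<longrightarrow> satisfied as (stage j) (blk j)) \<or>
     v = vx j (2 + f) i \<and> drop_at j (as j) \<le> i \<and> l = LL as (Suc j) \<and>
       c = CC as j + wgt j * (i - drop_at j (as j)) \<and> (f = 1 \<longrightarrow> satisfied as (stage j) (Suc (blk j)))))"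

lemma LL_upd [simp]: "j \<le> x \<Longrightarrow> LL (as(x := a)) j = LL as j"
  and CC_upd [simp]: "j \<le> x \<Longrightarrow> CC (as(x := a)) j = CC as j"
  unfolding LL_def CC_def by (auto intro!: sum.cong)

lemma index_less: "t < stage j \<Longrightarrow> p < P \<Longrightarrow> t * P + p < j"
proof -
  assume *: "t < stage j" "p < P"
  then have "t * P + p < (t + 1) * P" by simp
  also have "\<dots> \<le> stage j * P" using *(1) by (intro mult_le_mono1) simp
  also have "\<dots> \<le> j" by simp
  finally show ?thesis .
qed

lemma satisfied_upd:
  "t < stage j \<Longrightarrow> satisfied (as(j := a)) t P \<longleftrightarrow> satisfied as t P"
  "satisfied (as(j := a)) (stage j) (blk j) \<longleftrightarrow> satisfied as (stage j) (blk j)"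
proof -
  show "t < stage j \<Longrightarrow> satisfied (as(j := a)) t P \<longleftrightarrow> satisfied as t P"
    unfolding satisfied_def using index_less[of t j] by (metis fun_upd_other less_irrefl)
  have "stage j * P + p < j" if "p < blk j" for p
    using that div_mult_mod_eq[of j P] by linarith
  then show "satisfied (as(j := a)) (stage j) (blk j) \<longleftrightarrow> satisfied as (stage j) (blk j)"
    unfolding satisfied_def by (metis fun_upd_other less_irrefl)
qed

lemma satisfied_Suc:
  "satisfied as (stage j) (Suc (blk j)) \<longleftrightarrow> satisfied as (stage j) (blk j) \<or> sat (stage j) (blk j) (as j)"
proof -
  have "stage j * P + blk j = j" by (rule div_mult_mod_eq)
  then show ?thesis unfolding satisfied_def by (metis less_Suc_eq)
qed

lemma reached_init: "reached (vx 0 0 0) 0 0"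
  unfolding reached_def using pos by (intro exI[of _ "\<lambda>_. 0"] exI[of _ 0]) (auto simp: LL_def CC_def)

lemma reached_upE:
  assumes "reached (vx j f i) l c" "f < 2" "i \<le> H"
  obtains as where "\<forall>x. as x < q" "\<forall>t<stage j. satisfied as t P" "l = LL as j + wgt j * i" "c = CC as j"
    "f = 1 \<longrightarrow> satisfied as (stage j) (blk j)"
proof -
  from assms(1) obtain as j' f' i' where *: "\<forall>x. as x < q" "f' < 2" "i' \<le> H" "\<forall>t<stage j'. satisfied as t P"
    "vx j f i = vx j' f' i' \<and> l = LL as j' + wgt j' * i' \<and> c = CC as j' \<and> (f' = 1 \<longrightarrow> satisfied as (stage j') (blk j')) \<or>
     vx j f i = vx j' (2 + f') i' \<and> drop_at j' (as j') \<le> i' \<and> l = LL as (Suc j') \<and>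
       c = CC as j' + wgt j' * (i' - drop_at j' (as j')) \<and> (f' = 1 \<longrightarrow> satisfied as (stage j') (Suc (blk j')))"
    unfolding reached_def by blast
  from *(5) show ?thesis
  proof (elim disjE conjE)
    assume a: "vx j f i = vx j' f' i'" "l = LL as j' + wgt j' * i'" "c = CC as j'" "f' = 1 \<longrightarrow> satisfied as (stage j') (blk j')"
    have "j = j' \<and> f = f' \<and> i = i'" using vx_inj[OF a(1)] assms(2,3) *(2,3) by simp
    then show ?thesis using that[of as] a * by simp
  next
    assume "vx j f i = vx j' (2 + f') i'"
    from vx_inj[OF this] assms(2,3) *(2,3) show ?thesis by simp
  qed
qed

lemma reached_lowE:
  assumes "reached (vx j (2 + f) i) l c" "f < 2" "i \<le> H"
  obtains as where "\<forall>x. as x < q" "\<forall>t<stage j. satisfied as t P" "drop_at j (as j) \<le> i" "l = LL as (Suc j)"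
    "c = CC as j + wgt j * (i - drop_at j (as j))" "f = 1 \<longrightarrow> satisfied as (stage j) (Suc (blk j))"
proof -
  from assms(1) obtain as j' f' i' where *: "\<forall>x. as x < q" "f' < 2" "i' \<le> H" "\<forall>t<stage j'. satisfied as t P"
    "vx j (2 + f) i = vx j' f' i' \<and> l = LL as j' + wgt j' * i' \<and> c = CC as j' \<and> (f' = 1 \<longrightarrow> satisfied as (stage j') (blk j')) \<or>
     vx j (2 + f) i = vx j' (2 + f') i' \<and> drop_at j' (as j') \<le> i' \<and> l = LL as (Suc j') \<and>
       c = CC as j' + wgt j' * (i' - drop_at j' (as j')) \<and> (f' = 1 \<longrightarrow> satisfied as (stage j') (Suc (blk j')))"
    unfolding reached_def by blast
  from *(5) show ?thesis
  proof (elim disjE conjE)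
    assume "vx j (2 + f) i = vx j' f' i'"
    from vx_inj[OF this] assms(2,3) *(2,3) show ?thesis by simp
  next
    assume a: "vx j (2 + f) i = vx j' (2 + f') i'" "drop_at j' (as j') \<le> i'" "l = LL as (Suc j')"
       "c = CC as j' + wgt j' * (i' - drop_at j' (as j'))" "f' = 1 \<longrightarrow> satisfied as (stage j') (Suc (blk j'))"
    have "j = j' \<and> f = f' \<and> i = i'" using vx_inj[OF a(1)] assms(2,3) *(2,3) by simp
    then show ?thesis using that[of as] a * by simp
  qed
qed

lemma reached_upI:
  assumes "\<forall>x. as x < q" "\<forall>t<stage j. satisfied as t P" "f < 2" "i \<le> H" "l = LL as j + wgt j * i" "c = CC as j"
    "f = 1 \<longrightarrow> satisfied as (stage j) (blk j)"
  shows "reached (vx j f i) l c"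
  unfolding reached_def using assms by blast

lemma reached_lowI:
  assumes "\<forall>x. as x < q" "\<forall>t<stage j. satisfied as t P" "f < 2" "i \<le> H" "drop_at j (as j) \<le> i" "l = LL as (Suc j)"
    "c = CC as j + wgt j * (i - drop_at j (as j))" "f = 1 \<longrightarrow> satisfied as (stage j) (Suc (blk j))"
  shows "reached (vx j (2 + f) i) l c"
  unfolding reached_def using assms by blast

lemma stage_Suc: "stage (Suc j) = (if blk j = P - 1 then Suc (stage j) else stage j)"
  and blk_Suc: "blk (Suc j) = (if blk j = P - 1 then 0 else Suc (blk j))"
  using P_pos by (auto simp: div_Suc mod_Suc)

text \<open>The drop is the moment at which \<open>as j\<close> is chosen. Everything recorded so
  far depends on earlier ladders only and survives the update.\<close>

lemma reached_drop:
  assumes r: "reached (vx j f (drop_at j a)) l c" and f: "f < 2" and a: "a < q"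
    and f': "f' < 2" "f' = 1 \<longrightarrow> f = 1 \<or> sat (stage j) (blk j) a"
  shows "reached (vx j (2 + f') (drop_at j a)) l c"
proof -
  from r f drop_at_le[OF a] obtain as where as: "\<forall>x. as x < q" "\<forall>t<stage j. satisfied as t P"
    "l = LL as j + wgt j * drop_at j a" "c = CC as j" "f = 1 \<longrightarrow> satisfied as (stage j) (blk j)"
    by (rule reached_upE)
  show ?thesis
  proof (rule reached_lowI[where as = "as(j := a)"])
    show "f' = 1 \<longrightarrow> satisfied (as(j := a)) (stage j) (Suc (blk j))"
      using as(5) f'(2) by (auto simp: satisfied_Suc satisfied_upd)
    have "LL (as(j := a)) (Suc j) = LL (as(j := a)) j + wgt j * drop_at j a" by (simp add: LL_def)
    then show "l = LL (as(j := a)) (Suc j)" by (simp add: as(3))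
  qed (use as a f' drop_at_le in \<open>auto simp: satisfied_upd\<close>)
qed

lemma reached_step:
  assumes r: "reached (esrc e) l c" and e: "is_edge j e"
  shows "reached (edst e) (l + elen e) (c + ecost e)"
proof -
  from e consider
    (up) i f where "i < H" "f < 2" "e = (vx j f i, vx j f (i + 1), wgt j, 0)"
  | (low) i f where "i < H" "f < 2" "e = (vx j (2 + f) i, vx j (2 + f) (i + 1), 0, wgt j)"
  | (rung) a f where "a < q" "f < 2" "e = (vx j f (drop_at j a), vx j (2 + f) (drop_at j a), 0, 0)"
  | (cross) a where "a < q" "sat (stage j) (blk j) a" "e = (vx j 0 (drop_at j a), vx j 3 (drop_at j a), 0, 0)"
  | (last) "blk j = P - 1" "e = (vx j 3 H, vx (j + 1) 0 0, 0, 0)"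
  | (link) f where "blk j \<noteq> P - 1" "f < 2" "e = (vx j (2 + f) H, vx (j + 1) f 0, 0, 0)"
    unfolding is_edge_def by blast
  then show ?thesis
  proof cases
    case up
    with r obtain as where as: "\<forall>x. as x < q" "\<forall>t<stage j. satisfied as t P" "l = LL as j + wgt j * i" "c = CC as j"
      "f = 1 \<longrightarrow> satisfied as (stage j) (blk j)" by (auto elim: reached_upE)
    with up show ?thesis by (auto intro!: reached_upI[where as = as] simp: algebra_simps)
  next
    case low
    then have "i \<le> H" by simp
    from r low(3) have "reached (vx j (2 + f) i) l c" by simp
    from reached_lowE[OF this low(2) \<open>i \<le> H\<close>] obtain as where as: "\<forall>x. as x < q" "\<forall>t<stage j. satisfied as t P" "drop_at j (as j) \<le> i" "l = LL as (Suc j)"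
      "c = CC as j + wgt j * (i - drop_at j (as j))" "f = 1 \<longrightarrow> satisfied as (stage j) (Suc (blk j))" by metis
    have "reached (vx j (2 + f) (i + 1)) l (c + wgt j)"
      using as low(1,2) by (intro reached_lowI[where as = as]) (auto simp: Suc_diff_le)
    then show ?thesis by (simp add: low(3))
  next
    case rung
    with r show ?thesis using reached_drop[of j f a l c f] by simp
  next
    case cross
    with r show ?thesis using reached_drop[of j 0 a l c 1] by simp
  next
    case last
    from r last(2) have "reached (vx j (2 + 1) H) l c" by simp
    from reached_lowE[OF this] obtain as where as: "\<forall>x. as x < q" "\<forall>t<stage j. satisfied as t P" "drop_at j (as j) \<le> H" "l = LL as (Suc j)"
      "c = CC as j + wgt j * (H - drop_at j (as j))" "satisfied as (stage j) (Suc (blk j))" by (metis le_refl one_less_numeral_iff semiring_norm(76))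
    have "reached (vx (Suc j) 0 0) l c"
    proof (rule reached_upI[where as = as])
      show "\<forall>t<stage (Suc j). satisfied as t P"
        using as(2,6) last(1) P_pos by (auto simp: stage_Suc less_Suc_eq)
    qed (use as in \<open>auto simp: CC_def\<close>)
    then show ?thesis by (simp add: last(2))
  next
    case link
    from r link(3) have "reached (vx j (2 + f) H) l c" by simp
    from reached_lowE[OF this link(2)] obtain as where as: "\<forall>x. as x < q" "\<forall>t<stage j. satisfied as t P" "drop_at j (as j) \<le> H" "l = LL as (Suc j)"
      "c = CC as j + wgt j * (H - drop_at j (as j))" "f = 1 \<longrightarrow> satisfied as (stage j) (Suc (blk j))" by (metis le_refl)
    have "reached (vx (Suc j) f 0) l c"
      by (rule reached_upI[where as = as]) (use as link in \<open>auto simp: CC_def stage_Suc blk_Suc\<close>)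
    then show ?thesis by (simp add: link(3))
  qed
qed

lemma set_ladders: "e \<in> set (ladders n) \<longleftrightarrow> (\<exists>j<n. is_edge j e)"
  by (auto simp: ladders_def is_edge_iff)

lemma walk_reached:
  "walk (set (ladders n)) 0 p v \<Longrightarrow> reached v (sum_list (map elen p)) (sum_list (map ecost p))"
proof (induction rule: walk.induct)
  case Nil
  then show ?case using reached_init by (simp add: vx_def)
next
  case (snoc p u e)
  then show ?case using reached_step[of e] by (auto simp: set_ladders)
qed

end

section \<open>Exact budgets force equal assignments in all rounds\<close>

lemma sum_lessThan_add: "(\<Sum>j<a + b. f j) = (\<Sum>j<a. f j) + (\<Sum>p<b. f (a + p :: nat) :: nat)"
  by (induction b) (simp_all add: add.assoc)

lemma sum_grid: "(\<Sum>j<n * k. f j) = (\<Sum>t<n. \<Sum>p<k. f (t * k + p :: nat) :: nat)"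
proof (induction n)
  case (Suc n)
  have "(\<Sum>j<Suc n * k. f j) = (\<Sum>j<n * k + k. f j)" by (simp add: add.commute)
  then show ?case by (simp add: sum_lessThan_add Suc)
qed simp

text \<open>The hypotheses make the sum of all squared deviations from \<open>a i\<close> vanish.
  The means are known for each \<open>i\<close>, the squares only in total, which is all that a
  common leading digit can provide.\<close>

lemma average_eq:
  fixes b :: "'i \<Rightarrow> nat \<Rightarrow> nat" and a :: "'i \<Rightarrow> nat"
  assumes I: "finite I" and lin: "\<And>i. i \<in> I \<Longrightarrow> (\<Sum>t<M. b i t) = M * a i"
    and sq: "(\<Sum>i\<in>I. \<Sum>t<M. b i t * b i t) = (\<Sum>i\<in>I. M * (a i * a i))"
    and i: "i \<in> I" "t < M"
  shows "b i t = a i"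
proof -
  let ?d = "\<lambda>i t. (int (b i t) - int (a i)) ^ 2"
  have row: "(\<Sum>t<M. ?d i t) = (\<Sum>t<M. int (b i t * b i t)) - int (M * (a i * a i))" if "i \<in> I" for i
  proof -
    have "(\<Sum>t<M. ?d i t) = (\<Sum>t<M. int (b i t * b i t)) - 2 * int (a i) * (\<Sum>t<M. int (b i t)) + int M * (int (a i) * int (a i))"
      by (simp add: power2_eq_square algebra_simps sum.distrib sum_subtractf sum_distrib_left)
    also have "(\<Sum>t<M. int (b i t)) = int (M * a i)" using lin[OF that] by (metis of_nat_sum)
    finally show ?thesis by (simp add: algebra_simps)
  qed
  have "(\<Sum>i\<in>I. \<Sum>t<M. ?d i t) = int (\<Sum>i\<in>I. \<Sum>t<M. b i t * b i t) - int (\<Sum>i\<in>I. M * (a i * a i))"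
    by (simp add: row sum_subtractf)
  also have "\<dots> = 0" by (simp only: sq)
  finally have "(\<Sum>i\<in>I. \<Sum>t<M. ?d i t) = 0" .
  then have "\<forall>i\<in>I. (\<Sum>t<M. ?d i t) = 0"
    using sum_nonneg_eq_0_iff[OF I, of "\<lambda>i. \<Sum>t<M. ?d i t"] by (simp add: sum_nonneg)
  with i(1) have "(\<Sum>t<M. ?d i t) = 0" by blast
  then have "\<forall>t\<in>{..<M}. ?d i t = 0"
    using sum_nonneg_eq_0_iff[of "{..<M}" "?d i"] by simp
  with i(2) show ?thesis by simp
qed

context reduction
begin

definition posn :: "nat \<Rightarrow> nat \<Rightarrow> nat \<Rightarrow> nat" where "posn t g i = t * P + (g * D + i)"

text \<open>The digit of the total length at \<open>B ^ g\<close>.\<close>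

definition load :: "(nat \<Rightarrow> nat) \<Rightarrow> nat \<Rightarrow> nat" where
  "load as g = (\<Sum>i<D. \<Sum>t<M + 1. drop_at (posn t g i) (as (posn t g i)))"

lemma block_less: "g < G \<Longrightarrow> i < D \<Longrightarrow> g * D + i < P"
proof -
  assume "g < G" "i < D"
  then have "g * D + i < (g + 1) * D" by simp
  also have "\<dots> \<le> P" using \<open>g < G\<close> unfolding P_def by (intro mult_le_mono1) simp
  finally show ?thesis .
qed

lemma posn: "g < G \<Longrightarrow> i < D \<Longrightarrow> stage (posn t g i) = t \<and> blk (posn t g i) = g * D + i \<and> grp (g * D + i) = g \<and> dig (g * D + i) = i"
  using block_less[of g i] by (simp add: posn_def)

lemma sum_J: "(\<Sum>j<J. wgt j * h j) = (\<Sum>g<G. (\<Sum>i<D. \<Sum>t<M + 1. h (posn t g i)) * B ^ g)" for h :: "nat \<Rightarrow> nat"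
proof -
  have "(\<Sum>j<J. wgt j * h j) = (\<Sum>t<M + 1. \<Sum>g<G. \<Sum>i<D. wgt (posn t g i) * h (posn t g i))"
    unfolding J_def sum_grid P_def posn_def ..
  also have "\<dots> = (\<Sum>t<M + 1. \<Sum>g<G. \<Sum>i<D. B ^ g * h (posn t g i))"
    by (intro sum.cong refl) (simp add: wgt_def posn)
  also have "\<dots> = (\<Sum>g<G. \<Sum>t<M + 1. \<Sum>i<D. B ^ g * h (posn t g i))"
    by (rule sum.swap)
  also have "\<dots> = (\<Sum>g<G. \<Sum>i<D. \<Sum>t<M + 1. B ^ g * h (posn t g i))"
    by (intro sum.cong refl sum.swap)
  also have "\<dots> = (\<Sum>g<G. (\<Sum>i<D. \<Sum>t<M + 1. h (posn t g i)) * B ^ g)"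
    by (simp only: sum_distrib_right mult.commute[of "B ^ _"])
  finally show ?thesis .
qed

lemma LL_J: "LL as J = (\<Sum>g<G. load as g * B ^ g)"
  unfolding LL_def sum_J load_def ..

text \<open>Whatever the drops are, every position of every ladder is paid once. The sum of the
  budgets therefore has no slack.\<close>

lemma LL_CC:
  assumes "\<And>x. as x < q"
  shows "LL as J + CC as J = Lbud + Cbud"
proof -
  have "LL as J + CC as J = (\<Sum>j<J. wgt j * H)"
    unfolding LL_def CC_def sum.distrib[symmetric]
    by (intro sum.cong refl) (use drop_at_le[OF assms] in \<open>simp flip: distrib_left\<close>)
  also have "\<dots> = (\<Sum>g<G. (D * ((M + 1) * H)) * B ^ g)" unfolding sum_J by simp
  also have "\<dots> = D * ((M + 1) * H) * geo" unfolding geo_def sum_distrib_left ..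
  finally show ?thesis by (simp add: Lbud_def Cbud_def algebra_simps)
qed

text \<open>The codes of the reference round stand on the left so that no truncated subtraction
  remains.\<close>

lemma load_alt:
  assumes "g < G" "\<And>x. as x < q"
  shows "load as g + M * (\<Sum>i<D. code (g * D + i) (as (posn 0 g i))) =
    D * H + (\<Sum>i<D. \<Sum>t<M. code (g * D + i) (as (posn (Suc t) g i)))"
proof -
  have "load as g = (\<Sum>i<D. (H - M * code (g * D + i) (as (posn 0 g i))) + (\<Sum>t<M. code (g * D + i) (as (posn (Suc t) g i))))"
    unfolding load_def Suc_eq_plus1[symmetric] sum.lessThan_Suc_shift
    by (intro sum.cong refl) (simp add: drop_at_def posn[OF assms(1)])
  moreover have "(\<Sum>i<D. H - M * code (g * D + i) (as (posn 0 g i))) + (\<Sum>i<D. M * code (g * D + i) (as (posn 0 g i))) = D * H"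
    unfolding sum.distrib[symmetric] using code_le(1)[OF assms(2)] by simp
  ultimately show ?thesis by (simp add: sum.distrib sum_distrib_left)
qed

lemma load_less: "(\<And>x. as x < q) \<Longrightarrow> load as g < B"
proof -
  assume "\<And>x. as x < q"
  then have "load as g \<le> (\<Sum>i<D. \<Sum>t<M + 1. H)" unfolding load_def by (intro sum_mono drop_at_le)
  then show ?thesis by (simp add: B_def algebra_simps)
qed

text \<open>In base \<open>Q\<close>, digit \<open>i < D\<close> of both sides is the sum of the
  values of block \<open>i\<close> over the rounds, and the leading coefficient is the total of all
  squares. These are the hypotheses of \<open>average_eq\<close>.\<close>

lemma code_sum_eq:
  fixes b :: "nat \<Rightarrow> nat \<Rightarrow> nat" and a :: "nat \<Rightarrow> nat"
  assumes q: "\<And>i t. b i t < q" "\<And>i. a i < q"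
    and eq: "(\<Sum>i<D. \<Sum>t<M. code (g * D + i) (b i t)) = M * (\<Sum>i<D. code (g * D + i) (a i))"
    and i: "i < D" "t < M"
  shows "b i t = a i"
proof -
  have l: "(\<Sum>i<D. \<Sum>t<M. code (g * D + i) (b i t)) =
      (\<Sum>i<D. (\<Sum>t<M. b i t) * Q ^ i) + (\<Sum>i<D. \<Sum>t<M. b i t * b i t) * Q ^ D"
    by (simp add: code_def sum.distrib sum_distrib_right)
  have r: "M * (\<Sum>i<D. code (g * D + i) (a i)) =
      (\<Sum>i<D. (M * a i) * Q ^ i) + (\<Sum>i<D. M * (a i * a i)) * Q ^ D"
    by (simp add: code_def sum.distrib sum_distrib_left sum_distrib_right distrib_left mult.assoc)
  have MQ: "M * x < Q" if "x < q" for x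
  proof -
    have "M * x \<le> M * q" using that by simp
    also have "\<dots> < Q" using pos by (simp add: Q_def)
    finally show ?thesis .
  qed
  have bQ: "(\<Sum>t<M. b i t) < Q" for i
  proof -
    have "b i t \<le> q - 1" for t using q(1)[of i t] by simp
    then have "(\<Sum>t<M. b i t) \<le> (\<Sum>t<M. q - 1)" by (intro sum_mono)
    also have "\<dots> = M * (q - 1)" by simp
    also have "\<dots> < Q" using MQ[of "q - 1"] pos(3) by simp
    finally show ?thesis .
  qed
  have "(\<forall>i<D. (\<Sum>t<M. b i t) = M * a i) \<and> (\<Sum>i<D. \<Sum>t<M. b i t * b i t) = (\<Sum>i<D. M * (a i * a i))"
    by (rule digits_eq[OF bQ MQ[OF q(2)]]) (use eq l r in simp)
  then show ?thesis using average_eq[where I = "{..<D}" and M = M and b = b and a = a] i by auto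
qed

lemma budgets_force:
  assumes as: "\<And>x. as x < q" and len: "LL as J \<le> Lbud" and cost: "CC as J \<le> Cbud"
    and j: "g < G" "i < D" "t < M"
  shows "as (posn (Suc t) g i) = as (posn 0 g i)"
proof -
  \<comment> \<open>Two upper bounds whose sum is attained are both attained.\<close>
  have "LL as J = Lbud" using LL_CC[of as] as len cost by simp
  then have eq: "(\<Sum>g<G. load as g * B ^ g) + 0 * B ^ G = (\<Sum>g<G. (D * H) * B ^ g) + 0 * B ^ G"
    unfolding LL_J by (simp add: Lbud_def geo_def sum_distrib_left)
  \<comment> \<open>Both sides are now expansions in base \<open>B\<close>, so the groups can be
    compared one by one.\<close>
  have "D * H < B" by (simp add: B_def algebra_simps)
  then have "(\<forall>g<G. load as g = D * H) \<and> (0 :: nat) = 0"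
    using load_less[OF as] by (intro digits_eq[OF _ _ eq]) simp_all
  then have "load as g = D * H" using j(1) by simp
  then have "(\<Sum>i<D. \<Sum>t<M. code (g * D + i) (as (posn (Suc t) g i))) = M * (\<Sum>i<D. code (g * D + i) (as (posn 0 g i)))"
    using load_alt[of g as] j(1) as by simp
  from code_sum_eq[OF as as this j(2,3)] show ?thesis .
qed

lemma stage_J: "stage J = M + 1" "blk J = 0"
  using P_pos by (simp_all add: J_def)

theorem walk_imp_assignment:
  assumes w: "walk (set (ladders J)) 0 p (vx J 0 0)"
    and len: "sum_list (map elen p) \<le> Lbud" and cost: "sum_list (map ecost p) \<le> Cbud"
  shows "\<exists>\<alpha>. (\<forall>p. \<alpha> p < q) \<and> (\<forall>t\<le>M. \<exists>p<P. sat t p (\<alpha> p))"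
proof -
  from walk_reached[OF w] obtain as where as: "\<forall>x. as x < q" "\<forall>t<stage J. satisfied as t P"
    "sum_list (map elen p) = LL as J + wgt J * 0" "sum_list (map ecost p) = CC as J"
    by (rule reached_upE) auto
  have const: "as (t * P + p) = as p" if "t \<le> M" "p < P" for t p
  proof (cases t)
    case (Suc t')
    have "p div D < G" using that(2) by (simp add: P_def less_mult_imp_div_less)
    moreover have "p mod D < D" using pos(2) by simp
    ultimately have "as (posn (Suc t') (p div D) (p mod D)) = as (posn 0 (p div D) (p mod D))"
      using as len cost that Suc by (intro budgets_force) auto
    then show ?thesis by (simp add: posn_def Suc)
  qed simp
  show ?thesis
  proof (intro exI[of _ as] conjI allI impI)
    fix t assume t: "t \<le> M"
    then obtain p where "p < P" "sat t p (as (t * P + p))"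
      using as(2) by (auto simp: stage_J satisfied_def less_Suc_eq_le)
    then show "\<exists>p<P. sat t p (as p)" using const[OF t] by auto
  qed (use as in auto)
qed

section \<open>The walk of a satisfying assignment\<close>

definition walkto :: "nat \<Rightarrow> nat \<Rightarrow> nat \<Rightarrow> bool" where
  "walkto v l c \<longleftrightarrow> (\<exists>p. walk (set (ladders J)) 0 p v \<and> sum_list (map elen p) = l \<and> sum_list (map ecost p) = c)"

lemma walkto_step: "walkto u l c \<Longrightarrow> is_edge j (u, v, l', c') \<Longrightarrow> j < J \<Longrightarrow> walkto v (l + l') (c + c')"
proof -
  assume "walkto u l c" "is_edge j (u, v, l', c')" "j < J"
  then obtain p where p: "walk (set (ladders J)) 0 p u" "sum_list (map elen p) = l" "sum_list (map ecost p) = c"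
    by (auto simp: walkto_def)
  moreover have "(u, v, l', c') \<in> set (ladders J)" using \<open>is_edge _ _\<close> \<open>j < J\<close> by (auto simp: set_ladders)
  ultimately show ?thesis unfolding walkto_def
    by (intro exI[of _ "p @ [(u, v, l', c')]"]) simp
qed

lemma walkto_up: "walkto (vx j f 0) l c \<Longrightarrow> f < 2 \<Longrightarrow> j < J \<Longrightarrow> i \<le> H \<Longrightarrow> walkto (vx j f i) (l + wgt j * i) c"
proof (induction i)
  case (Suc i)
  then have "walkto (vx j f i) (l + wgt j * i) c" by simp
  moreover have "is_edge j (vx j f i, vx j f (i + 1), wgt j, 0)"
    using Suc.prems unfolding is_edge_def by (metis Suc_le_lessD)
  ultimately show ?case using walkto_step[of "vx j f i" _ _ j "vx j f (i + 1)"] Suc.prems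
    by (fastforce simp: algebra_simps)
qed simp

lemma walkto_low: "walkto (vx j (2 + f) i) l c \<Longrightarrow> f < 2 \<Longrightarrow> j < J \<Longrightarrow> i + n \<le> H \<Longrightarrow> walkto (vx j (2 + f) (i + n)) l (c + wgt j * n)"
proof (induction n)
  case (Suc n)
  then have "walkto (vx j (2 + f) (i + n)) l (c + wgt j * n)" by simp
  moreover have "i + n < H" using Suc.prems by simp
  then have "is_edge j (vx j (2 + f) (i + n), vx j (2 + f) (i + n + 1), 0, wgt j)"
    using Suc.prems unfolding is_edge_def by metis
  ultimately show ?case using walkto_step[of "vx j (2 + f) (i + n)" _ _ j "vx j (2 + f) (i + n + 1)"] Suc.prems
    by (fastforce simp: algebra_simps)
qed simp

text \<open>The walk uses the same values in every round and takes the cross edge at the first block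
  that satisfies the clause; \<open>flag j\<close> says whether this lies before ladder
  \<open>j\<close> in its round.\<close>

theorem assignment_imp_walk:
  assumes \<alpha>: "\<And>p. \<alpha> p < q" and sat: "\<And>t. t \<le> M \<Longrightarrow> \<exists>p<P. sat t p (\<alpha> p)"
  shows "\<exists>p. walk (set (ladders J)) 0 p (vx J 0 0) \<and>
    sum_list (map elen p) \<le> Lbud \<and> sum_list (map ecost p) \<le> Cbud"
proof -
  define as where "as j = \<alpha> (blk j)" for j
  define flag :: "nat \<Rightarrow> nat" where "flag j = of_bool (\<exists>p<blk j. sat (stage j) p (\<alpha> p))" for j
  have "j \<le> J \<Longrightarrow> walkto (vx j (flag j) 0) (LL as j) (CC as j)" for j
  proof (induction j)
    case 0
    then show ?case unfolding walkto_def by (intro exI[of _ "[]"]) (simp add: vx_def flag_def LL_def CC_def)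
  next
    case (Suc j)
    define a where "a = \<alpha> (blk j)"
    define f' :: nat where "f' = of_bool (\<exists>p<Suc (blk j). sat (stage j) p (\<alpha> p))"
    have j: "j < J" and a: "a < q" and f: "flag j < 2" "f' < 2" using Suc.prems \<alpha> by (auto simp: a_def flag_def f'_def)
    note d = drop_at_le[OF a, of j]
    from Suc have "walkto (vx j (flag j) 0) (LL as j) (CC as j)" by simp
    from walkto_up[OF this f(1) j d] have 1: "walkto (vx j (flag j) (drop_at j a)) (LL as (Suc j)) (CC as j)"
      by (simp add: LL_def as_def a_def)
    have "f' = flag j \<or> flag j = 0 \<and> f' = 1 \<and> sat (stage j) (blk j) a"
      by (auto simp: f'_def flag_def a_def less_Suc_eq)
    then have "is_edge j (vx j (flag j) (drop_at j a), vx j (2 + f') (drop_at j a), 0, 0)"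
    proof
      assume "f' = flag j"
      then show ?thesis using a f(1) unfolding is_edge_def by blast
    next
      assume *: "flag j = 0 \<and> f' = 1 \<and> sat (stage j) (blk j) a"
      then have "vx j (2 + f') (drop_at j a) = vx j 3 (drop_at j a)" by simp
      with * show ?thesis using a unfolding is_edge_def by metis
    qed
    from walkto_step[OF 1 this j] have 2: "walkto (vx j (2 + f') (drop_at j a)) (LL as (Suc j)) (CC as j)" by simp
    have "walkto (vx j (2 + f') H) (LL as (Suc j)) (CC as (Suc j))"
      using walkto_low[OF 2 f(2) j, of "H - drop_at j a"] d by (simp add: CC_def as_def a_def)
    moreover have "is_edge j (vx j (2 + f') H, vx (Suc j) (flag (Suc j)) 0, 0, 0)"
    proof (cases "blk j = P - 1")
      case True
      have "stage j \<le> M" using j by (simp add: J_def less_mult_imp_div_less flip: less_Suc_eq_le)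
      from sat[OF this] True P_pos have "f' = 1" by (auto simp: f'_def)
      moreover have "flag (Suc j) = 0" using True P_pos by (simp add: flag_def blk_Suc)
      ultimately show ?thesis using True by (simp add: is_edge_def)
    next
      case False
      then have "flag (Suc j) = f'" by (simp add: flag_def f'_def blk_Suc stage_Suc)
      with False f(2) show ?thesis unfolding is_edge_def by (metis Suc_eq_plus1)
    qed
    ultimately show ?case using walkto_step[OF _ _ j] by force
  qed
  from this[of J] obtain p where p: "walk (set (ladders J)) 0 p (vx J 0 0)" "sum_list (map elen p) = LL as J"
    "sum_list (map ecost p) = CC as J" by (auto simp: walkto_def flag_def stage_J)
  have q: "\<And>x. as x < q" using \<alpha> by (simp add: as_def)
  have "load as g = D * H" if "g < G" for g
    using load_alt[OF that, of as] q by (simp add: as_def posn[OF that] sum_distrib_left)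
  then have "LL as J = Lbud" unfolding LL_J by (simp add: Lbud_def geo_def sum_distrib_left)
  with LL_CC[of as] q p show ?thesis by auto
qed

end

section \<open>The ladders have no parallel edges\<close>

lemma distinct_concat_map:
  assumes "\<And>i. i < n \<Longrightarrow> distinct (F i)" "\<And>i x. i < n \<Longrightarrow> x \<in> set (F i) \<Longrightarrow> key x = k i"
    "\<And>i j. i < n \<Longrightarrow> j < n \<Longrightarrow> k i = k j \<Longrightarrow> i = j"
  shows "distinct (concat (map F [0..<n]))"
  using assms
proof (induction n)
  case (Suc n)
  have "set (F n) \<inter> set (concat (map F [0..<n])) = {}"
  proof (rule ccontr)
    assume "\<not> ?thesis"
    then obtain x i where x: "x \<in> set (F n)" "i < n" "x \<in> set (F i)" by auto
    then have "k i = k n" using Suc.prems(2)[of n x] Suc.prems(2)[of i x] by simp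
    then show False using Suc.prems(3)[of i n] x(2) by simp
  qed
  moreover have "distinct (concat (map F [0..<n]))" using Suc.prems by (intro Suc.IH) auto
  ultimately show ?case using Suc.prems(1)[of n] by auto
qed simp

text \<open>The weights of an instance are functions of the pair of end vertices, so this pair must
  determine the edge in the list.\<close>

definition ends :: "wedge \<Rightarrow> nat \<times> nat" where "ends e = (esrc e, edst e)"

lemma ends_simp [simp]: "ends (u, v, l, c) = (u, v)"
  by (simp add: ends_def)

context reduction
begin

lemma vx_div: "l < 4 \<Longrightarrow> vx j l i div 4 = j * (H + 1) + i \<and> vx j l i mod 4 = l"
proof -
  assume "l < 4"
  then have "(4 * x + l) div 4 = x \<and> (4 * x + l) mod 4 = l" for x by simp
  then show ?thesis unfolding vx_def by blast
qed

lemma distinct_rails: "distinct (concat (map (\<lambda>i. map ends (rail j i)) [0..<H]))"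
proof (rule distinct_concat_map[where key = "\<lambda>e. fst e div 4" and k = "\<lambda>i. j * (H + 1) + i"])
  show "distinct (map ends (rail j i))" for i by (simp add: rail_def vx_def)
  show "fst x div 4 = j * (H + 1) + i" if "x \<in> set (map ends (rail j i))" for i x
    using that vx_div[of _ j i] by (auto simp: rail_def simp del: vx_def)
qed simp

lemma distinct_rungs: "distinct (concat (map (\<lambda>a. map ends (rung j a)) [0..<q]))"
proof (rule distinct_concat_map[where key = "\<lambda>e. fst e div 4" and k = "\<lambda>a. j * (H + 1) + drop_at j a"])
  show "distinct (map ends (rung j a))" for a by (simp add: rung_def Let_def vx_def)
  show "fst x div 4 = j * (H + 1) + drop_at j a" if "x \<in> set (map ends (rung j a))" for a x
    using that vx_div[of _ j "drop_at j a"] by (auto simp: rung_def Let_def split: if_splits)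
  show "a = b" if "a < q" "b < q" "j * (H + 1) + drop_at j a = j * (H + 1) + drop_at j b" for a b
    using that drop_at_inj by simp
qed

lemma vx_Suc: "vx j l (i + 1) = vx j l i + 4" "vx (j + 1) l 0 = 4 * (j * (H + 1) + H) + 4 + l"
  by (simp_all add: vx_def)

lemma vx_split: "vx j l i = 4 * (j * (H + 1) + i) + l"
  by (simp add: vx_def)

lemma ends_rail: "e \<in> ends ` set (rail j i) \<Longrightarrow> snd e = fst e + 4"
  by (auto simp: rail_def vx_def)

lemma ends_rung: "e \<in> ends ` set (rung j a) \<Longrightarrow> snd e < fst e + 4 \<and> fst e mod 4 < 2"
  using vx_div[of 0 j "drop_at j a"] vx_div[of 1 j "drop_at j a"]
  by (auto simp: rung_def Let_def vx_split simp del: distrib_left_numeral split: if_splits)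

lemma ends_link: "e \<in> ends ` set (link j) \<Longrightarrow> snd e < fst e + 4 \<and> 2 \<le> fst e mod 4"
  using vx_div[of 2 j H] vx_div[of 3 j H] vx_Suc(2)[of j]
  by (auto simp: link_def vx_split add_ac simp del: distrib_left_numeral split: if_splits)

text \<open>The numbering of the vertices separates the kinds of edges: rails advance by exactly 4,
  rungs and links by less, and rungs start on rails 0 and 1 but links on rails 2 and 3.\<close>

lemma distinct_ladder: "distinct (map ends (ladder j))"
proof -
  have link: "distinct (map ends (link j))" by (simp add: link_def vx_def)
  have "map ends (ladder j) = concat (map (\<lambda>i. map ends (rail j i)) [0..<H]) @
      concat (map (\<lambda>a. map ends (rung j a)) [0..<q]) @ map ends (link j)"
    by (simp add: ladder_def map_concat o_def)
  moreover have "e \<in> set (concat (map (\<lambda>i. map ends (rail j i)) [0..<H])) \<Longrightarrow> snd e = fst e + 4" for e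
    unfolding set_concat set_map image_image UN_iff by (elim bexE) (rule ends_rail)
  moreover have "e \<in> set (concat (map (\<lambda>a. map ends (rung j a)) [0..<q])) \<Longrightarrow> snd e < fst e + 4 \<and> fst e mod 4 < 2" for e
    unfolding set_concat set_map image_image UN_iff by (elim bexE) (rule ends_rung)
  moreover have "e \<in> set (map ends (link j)) \<Longrightarrow> snd e < fst e + 4 \<and> 2 \<le> fst e mod 4" for e
    unfolding set_map by (rule ends_link)
  ultimately show ?thesis
    unfolding distinct_append using distinct_rails distinct_rungs link
    by (simp only: distinct_append disjoint_iff set_append Un_iff)
      (metis less_irrefl linorder_not_le)
qed

lemma is_edge_src:
  assumes "is_edge j e"
  shows "esrc e div 4 div (H + 1) = j"
proof -
  have *: "vx j l i div 4 div (H + 1) = j" if "l < 4" "i \<le> H" for l i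
  proof -
    have "(x * K + y) div K = x" if "y < K" for x y K :: nat using that by simp
    moreover have "i < H + 1" using that(2) by simp
    ultimately show ?thesis using vx_div[OF that(1), of j i] by metis
  qed
  have "\<exists>l<4. \<exists>i\<le>H. esrc e = vx j l i"
  proof -
    have "\<exists>l i. l < 4 \<and> i \<le> H \<and> esrc e = vx j l i"
      using assms drop_at_le unfolding is_edge_def
      by (elim disjE exE conjE) (simp, (intro exI conjI; (rule refl)?; simp))+
    then show ?thesis by blast
  qed
  with * show ?thesis by auto
qed

lemma distinct_ladders: "distinct (map ends (ladders n))"
proof -
  have "map ends (ladders n) = concat (map (\<lambda>j. map ends (ladder j)) [0..<n])"
    by (simp add: ladders_def map_concat o_def)
  also have "distinct \<dots>"
  proof (rule distinct_concat_map[where key = "\<lambda>e. fst e div 4 div (H + 1)" and k = id])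
    show "fst x div 4 div (H + 1) = id j" if "x \<in> set (map ends (ladder j))" for j x
    proof -
      from that obtain e where "is_edge j e" "x = ends e" by (auto simp: is_edge_iff)
      with is_edge_src[of j e] show ?thesis by (simp add: ends_def)
    qed
  qed (auto simp: distinct_ladder)
  finally show ?thesis .
qed

lemma is_edge_bounds:
  assumes e: "is_edge j e" and j: "j < J"
  shows "esrc e < vx J 0 0" "edst e \<le> vx J 0 0"
    "elen e \<in> insert 0 ((\<lambda>g. B ^ g) ` {..<G})" "ecost e \<in> insert 0 ((\<lambda>g. B ^ g) ` {..<G})"
proof -
  have "grp (blk j) < G"
    using P_pos mod_less_divisor[of P j] by (simp add: P_def less_mult_imp_div_less)
  then have w: "wgt j \<in> (\<lambda>g. B ^ g) ` {..<G}" by (simp add: wgt_def)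
  have mono: "vx (Suc j) 0 0 \<le> vx J 0 0" using j unfolding vx_def by (intro add_le_mono mult_le_mono) auto
  have less: "vx j l i < vx J 0 0" if "l < 4" "i \<le> H" for l i
    using mono that unfolding vx_def by simp
  \<comment> \<open>A link to rail 1 of ladder \<open>J\<close> would overshoot the target. It
    cannot occur because ladder \<open>J - 1\<close> closes a round and is linked to rail 0
    only.\<close>
  have last: "vx (Suc j) f 0 < vx J 0 0" if "blk j \<noteq> P - 1" "f < 4" for f
  proof -
    have "Suc j \<noteq> J" using that(1) blk_Suc[of j] stage_J(2) by auto
    with j have "Suc j < J" by simp
    then have "vx (Suc (Suc j)) 0 0 \<le> vx J 0 0" unfolding vx_def by (intro add_le_mono mult_le_mono) auto
    then show ?thesis using that(2) unfolding vx_def by simp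
  qed
  show "esrc e < vx J 0 0"
    using e drop_at_le unfolding is_edge_def by (elim disjE exE conjE) (simp_all add: less)
  show "edst e \<le> vx J 0 0"
    using e drop_at_le mono unfolding is_edge_def
    by (elim disjE exE conjE) (simp_all add: less less_imp_le last)
  show "elen e \<in> insert 0 ((\<lambda>g. B ^ g) ` {..<G})" "ecost e \<in> insert 0 ((\<lambda>g. B ^ g) ` {..<G})"
    using e w unfolding is_edge_def by (elim disjE exE conjE; simp)+
qed

end

section \<open>The instance given by a list of weighted edges\<close>

definition instance_of :: "nat \<Rightarrow> nat \<Rightarrow> nat \<Rightarrow> nat \<Rightarrow> nat \<Rightarrow> wedge list \<Rightarrow> bicriteria" where
  "instance_of N s t L C qs = \<lparr>graph = \<lparr>pverts = {..<N}, parcs = ends ` set qs\<rparr>,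
    edge_length = \<lambda>e. the (map_of (map (\<lambda>q. (ends q, elen q)) qs) e),
    edge_cost = \<lambda>e. the (map_of (map (\<lambda>q. (ends q, ecost q)) qs) e),
    source = s, target = t, length_budget = L, cost_budget = C\<rparr>"

lemma instance_of:
  fixes N s t L C :: nat and qs :: "wedge list"
  assumes d: "distinct (map ends qs)" and qs: "\<And>e. e \<in> set qs \<Longrightarrow> esrc e < N \<and> edst e < N"
    and st: "s < N" "t < N"
  defines "I \<equiv> instance_of N s t L C qs"
  shows "I \<in> bicriteria_instances" "wedges I = set qs" "num_verts I = N"
    "num_lengths I = card (elen ` set qs)" "num_costs I = card (ecost ` set qs)"
    "bicriteria_encoding I ([N, length qs, s, t, L, C] @ flat qs)"
    "source I = s" "target I = t" "length_budget I = L" "cost_budget I = C"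
proof -
  show "source I = s" "target I = t" "length_budget I = L" "cost_budget I = C"
    by (simp_all add: I_def instance_of_def)
  have lookup: "map_of (map (\<lambda>q. (ends q, h q)) qs) (ends e) = Some (h e)" if "e \<in> set qs" for h :: "wedge \<Rightarrow> nat" and e
    using d that by (intro map_of_is_SomeI) (auto simp: o_def)
  then have len: "edge_length I (ends e) = elen e" "edge_cost I (ends e) = ecost e" if "e \<in> set qs" for e
    using that by (simp_all add: I_def instance_of_def)
  have g: "parcs (graph I) = ends ` set qs" "pverts (graph I) = {..<N}" by (simp_all add: I_def instance_of_def)
  then show N: "num_verts I = N" by (simp add: num_verts_def)
  have "pair_fin_digraph (graph I)"
    by unfold_locales (use g qs in \<open>auto simp: ends_def\<close>)
  then show "I \<in> bicriteria_instances"
    using st N by (simp add: bicriteria_instances_def g) (simp add: I_def instance_of_def)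
  show "num_lengths I = card (elen ` set qs)" "num_costs I = card (ecost ` set qs)"
    unfolding num_lengths_def num_costs_def g image_image using len
    by (auto intro!: arg_cong[where f = card] image_cong)
  have edge: "(fst (ends e), snd (ends e), edge_length I (ends e), edge_cost I (ends e)) = e" if "e \<in> set qs" for e
    using len[OF that] by (cases e) simp
  show "wedges I = set qs"
    unfolding wedges_def g image_image using edge by (metis (no_types, lifting) image_cong image_ident)
  show "bicriteria_encoding I ([N, length qs, s, t, L, C] @ flat qs)"
    unfolding bicriteria_encoding_def
  proof (intro exI[of _ "map ends qs"] conjI)
    have "concat (map (\<lambda>e. [fst e, snd e, edge_length I e, edge_cost I e]) (map ends qs)) = flat qs"
      unfolding flat_def map_map o_def
      by (intro arg_cong[where f = concat] map_cong refl) (use len in \<open>auto simp: quad_list_def ends_def\<close>)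
    then show "[N, length qs, s, t, L, C] @ flat qs = [num_verts I, length (map ends qs), source I, target I, length_budget I, cost_budget I] @
      concat (map (\<lambda>e. [fst e, snd e, edge_length I e, edge_cost I e]) (map ends qs))"
      by (simp add: N) (simp add: I_def instance_of_def)
  qed (use d g in auto)
qed

lemma (in reduction) reduction_correct:
  assumes d: "d = G + 1"
  defines "I \<equiv> instance_of (vx J 0 0 + 1) 0 (vx J 0 0) Lbud Cbud (ladders J)"
  shows "I \<in> bicriteria_instances" "num_verts I = vx J 0 0 + 1" "num_lengths I \<le> d" "num_costs I \<le> d"
    "bicriteria_encoding I ([vx J 0 0 + 1, length (ladders J), 0, vx J 0 0, Lbud, Cbud] @ flat (ladders J))"
    "has_bicriteria_path I \<longleftrightarrow> (\<exists>\<alpha>. (\<forall>p. \<alpha> p < q) \<and> (\<forall>t\<le>M. \<exists>p<P. sat t p (\<alpha> p)))"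
proof -
  have e: "esrc e < vx J 0 0 + 1 \<and> edst e < vx J 0 0 + 1" if "e \<in> set (ladders J)" for e
  proof -
    from that obtain j where "j < J" "is_edge j e" by (auto simp: set_ladders)
    from is_edge_bounds(1,2)[OF this(2,1)] show ?thesis by simp
  qed
  note inst = instance_of[OF distinct_ladders[of J] e, of 0 "vx J 0 0" Lbud Cbud, folded I_def, simplified]
  show I: "I \<in> bicriteria_instances" "num_verts I = vx J 0 0 + 1"
    "bicriteria_encoding I ([vx J 0 0 + 1, length (ladders J), 0, vx J 0 0, Lbud, Cbud] @ flat (ladders J))"
    using inst by simp_all
  have c: "card (insert 0 ((\<lambda>g. B ^ g) ` {..<G})) \<le> d"
    unfolding d using card_insert_le_m1[of "G + 1" "(\<lambda>g. B ^ g) ` {..<G}" 0] card_image_le[of "{..<G}" "\<lambda>g. B ^ g"] by simp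
  have "elen ` set (ladders J) \<subseteq> insert 0 ((\<lambda>g. B ^ g) ` {..<G})" "ecost ` set (ladders J) \<subseteq> insert 0 ((\<lambda>g. B ^ g) ` {..<G})"
    using is_edge_bounds(3,4) by (fastforce simp: set_ladders)+
  then have "card (elen ` set (ladders J)) \<le> d" "card (ecost ` set (ladders J)) \<le> d"
    using c by (meson card_mono finite_imageI finite_insert finite_lessThan le_trans)+
  then show "num_lengths I \<le> d" "num_costs I \<le> d" using inst by simp_all
  have "has_bicriteria_path I \<longleftrightarrow> (\<exists>p. walk (set (ladders J)) 0 p (vx J 0 0) \<and>
      sum_list (map elen p) \<le> Lbud \<and> sum_list (map ecost p) \<le> Cbud)"
    using has_path_iff_walk(1)[OF I(1)] inst by (simp add: within_budgets_def)
  also have "\<dots> \<longleftrightarrow> (\<exists>\<alpha>. (\<forall>p. \<alpha> p < q) \<and> (\<forall>t\<le>M. \<exists>p<P. sat t p (\<alpha> p)))"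
    using walk_imp_assignment assignment_imp_walk by blast
  finally show "has_bicriteria_path I \<longleftrightarrow> (\<exists>\<alpha>. (\<forall>p. \<alpha> p < q) \<and> (\<forall>t\<le>M. \<exists>p<P. sat t p (\<alpha> p)))" .
qed

section \<open>Writing the reduction as a program\<close>

definition pow_body :: "nat \<Rightarrow> nat \<Rightarrow> nat \<Rightarrow> com" where
  "pow_body r b c = Op r Mul (Reg r) (Reg b) ;; Op c Sub (Reg c) (Imm 1)"

definition pow :: "nat \<Rightarrow> nat \<Rightarrow> operand \<Rightarrow> nat \<Rightarrow> com" where
  "pow r b e c = mov c e ;; mov r (Imm 1) ;; While (Less (Imm 0) (Reg c)) (pow_body r b c)"

lemma wp_pow:
  fixes \<sigma> :: state
  assumes rbc: "r \<noteq> b" "r \<noteq> c" "b \<noteq> c" and b: "reg \<sigma> b = x" "0 < x" and e: "val \<sigma> e = n"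
    and bnd: "x ^ n < 2 ^ w" "n < 2 ^ w" "1 < (2::nat) ^ w"
    and Q: "\<And>t \<sigma>'. t \<le> 3 * n + 3 \<Longrightarrow> \<sigma>' = \<sigma>\<lparr>reg := (reg \<sigma>)(c := 0, r := x ^ n)\<rparr> \<Longrightarrow> Q t \<sigma>'"
  shows "wp w (pow r b e c) Q \<sigma>"
proof -
  define I where "I i \<tau> \<longleftrightarrow> \<tau> = \<sigma>\<lparr>reg := (reg \<sigma>)(c := n - i, r := x ^ i)\<rparr>" for i and \<tau> :: state
  have pw: "x ^ i < 2 ^ w" if "i \<le> n" for i
    using power_increasing[OF that, of x] b(2) bnd(1) by linarith
  have loop: "wp w (While (Less (Imm 0) (Reg c)) (pow_body r b c)) Q' \<tau>"
    if "I 0 \<tau>" "\<And>t \<tau>. I n \<tau> \<Longrightarrow> t \<le> n * (2 + 1) + 1 \<Longrightarrow> Q' t \<tau>" for Q' \<tau>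
  proof (rule wp_While[where I = I and n = n and T = 2])
    fix i \<tau> assume i: "i < n" "I i \<tau>"
    have "(reg \<sigma>)(c := n - i, r := x ^ Suc i, c := n - Suc i) = (reg \<sigma>)(c := n - Suc i, r := x ^ Suc i)"
      using rbc by auto
    then show "holds \<tau> (Less (Imm 0) (Reg c)) \<and> wp w (pow_body r b c) (\<lambda>t \<tau>'. t \<le> 2 \<and> I (Suc i) \<tau>') \<tau>"
      using i rbc b bnd pw[of "Suc i"] by (auto simp: pow_body_def I_def mult.commute)
  qed (use that rbc in \<open>auto simp: I_def\<close>)
  show ?thesis
    unfolding pow_def using e bnd rbc
    by (auto intro!: loop Q simp: I_def)
qed

definition outm :: "(nat \<Rightarrow> nat) \<Rightarrow> nat \<Rightarrow> wedge list \<Rightarrow> nat \<Rightarrow> nat" where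
  "outm M0 b qs = (\<lambda>a. if b \<le> a \<and> a < b + 4 * length qs then flat qs ! (a - b) else M0 a)"

lemma outm_below: "a < b \<Longrightarrow> outm M0 b qs a = M0 a"
  by (simp add: outm_def)

lemma outm_Nil: "outm M0 b [] = M0"
  by (simp add: outm_def fun_eq_iff)

lemma outm_snoc:
  assumes "p = b + 4 * length qs"
  shows "(outm M0 b qs)(p := esrc e, p + 1 := edst e, p + 2 := elen e, p + 3 := ecost e) = outm M0 b (qs @ [e])"
proof
  fix a
  consider "a < p" | "a = p" | "a = p + 1" | "a = p + 2" | "a = p + 3" | "p + 4 \<le> a" by linarith
  then show "((outm M0 b qs)(p := esrc e, p + 1 := edst e, p + 2 := elen e, p + 3 := ecost e)) a = outm M0 b (qs @ [e]) a"
    by cases (auto simp: outm_def nth_append quad_list_def assms)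
qed

text \<open>Register 11 is the write pointer and register 20 the vertex on rail 0 at the current
  position. The end vertices are given by offsets from it, the weights by operands.\<close>

definition emit :: "nat \<times> nat \<times> operand \<times> operand \<Rightarrow> com" where
  "emit = (\<lambda>(c1, c2, o3, o4).
    Op 21 Add (Reg 20) (Imm c1) ;; Store (Reg 11) (Reg 21) ;; incr 11 (Imm 1) ;;
    Op 21 Add (Reg 20) (Imm c2) ;; Store (Reg 11) (Reg 21) ;; incr 11 (Imm 1) ;;
    Store (Reg 11) o3 ;; incr 11 (Imm 1) ;; Store (Reg 11) o4 ;; incr 11 (Imm 1))"

primrec emits :: "(nat \<times> nat \<times> operand \<times> operand) list \<Rightarrow> com" where
  "emits [] = Skip"
| "emits (e # es) = emit e ;; emits es"

primrec opv :: "(nat \<Rightarrow> nat) \<Rightarrow> operand \<Rightarrow> nat" where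
  "opv R (Imm k) = k"
| "opv R (Reg r) = R r"

definition mk_edge :: "nat \<Rightarrow> (nat \<Rightarrow> nat) \<Rightarrow> nat \<times> nat \<times> operand \<times> operand \<Rightarrow> wedge" where
  "mk_edge x R = (\<lambda>(c1, c2, o3, o4). (x + c1, x + c2, opv R o3, opv R o4))"

text \<open>\<open>R\<close> is a snapshot of the registers, from which only those in
  \<open>S\<close> may deviate, and \<open>qs\<close> is the list of edges written so far.\<close>

definition writing :: "(nat \<Rightarrow> nat) \<Rightarrow> nat \<Rightarrow> nat set \<Rightarrow> (nat \<Rightarrow> nat) \<Rightarrow> wedge list \<Rightarrow> state \<Rightarrow> bool" where
  "writing M0 b S R qs \<sigma> \<longleftrightarrow> (\<forall>r. r \<notin> S \<longrightarrow> reg \<sigma> r = R r) \<and>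
    reg \<sigma> 11 = b + 4 * length qs \<and> mem \<sigma> = outm M0 b qs"

lemma wp_emits:
  assumes "writing M0 b {11, 21} R qs \<sigma>" "R 20 = x"
    and "\<forall>(c1, c2, o3, o4)\<in>set es. c1 \<le> 7 \<and> c2 \<le> 7 \<and> o3 \<in> {Imm 0, Reg 15} \<and> o4 \<in> {Imm 0, Reg 15}"
    and bnd: "x + 7 < 2 ^ w" "R 15 < 2 ^ w" "b + 4 * (length qs + length es) < 2 ^ w"
    and Q: "\<And>\<sigma>'. writing M0 b {11, 21} R (qs @ map (mk_edge x R) es) \<sigma>' \<Longrightarrow> Q (10 * length es + 1) \<sigma>'"
  shows "wp w (emits es) Q \<sigma>"
proof -
  have "wp w (emits es) (\<lambda>t \<sigma>'. t = 10 * length es + 1 \<and> writing M0 b {11, 21} R (qs @ map (mk_edge x R) es) \<sigma>') \<sigma>"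
    using assms(1,3) bnd(3)
  proof (induction es arbitrary: qs \<sigma>)
    case (Cons e es)
    obtain c1 c2 o3 o4 where e: "e = (c1, c2, o3, o4)" by (cases e) auto
    have c: "c1 \<le> 7" "c2 \<le> 7" and o: "o3 = Imm 0 \<or> o3 = Reg 15" "o4 = Imm 0 \<or> o4 = Reg 15"
      using Cons.prems(2) by (auto simp: e)
    define p where "p = b + 4 * length qs"
    have \<sigma>: "reg \<sigma> 11 = p" "reg \<sigma> 20 = x" "reg \<sigma> 15 = R 15" "mem \<sigma> = outm M0 b qs" "\<forall>r. r \<notin> {11, 21} \<longrightarrow> reg \<sigma> r = R r"
      using Cons.prems(1) assms(2) by (auto simp: writing_def p_def)
    have o_val: "val \<tau> o3 = opv R o3" "val \<tau> o4 = opv R o4" if "reg \<tau> 15 = R 15" for \<tau> :: state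
      using o that by auto
    have o_bnd: "opv R o3 < 2 ^ w" "opv R o4 < 2 ^ w" using o bnd(2) by auto
    have b: "p < 2 ^ w" "Suc p < 2 ^ w" "Suc (Suc p) < 2 ^ w" "Suc (Suc (Suc p)) < 2 ^ w" "Suc (Suc (Suc (Suc p))) < 2 ^ w"
      "x + c1 < 2 ^ w" "x + c2 < 2 ^ w"
      using Cons.prems(3) bnd(1) c by (simp_all add: p_def)
    have m: "(outm M0 b qs)(p := x + c1, Suc p := x + c2, Suc (Suc p) := opv R o3, Suc (Suc (Suc p)) := opv R o4) =
        outm M0 b (qs @ [mk_edge x R e])"
      using outm_snoc[of p b qs M0 "mk_edge x R e"] by (simp add: p_def mk_edge_def e numeral_eq_Suc)
    have "wp w (emit e) (\<lambda>t \<sigma>'. t = 10 \<and> writing M0 b {11, 21} R (qs @ [mk_edge x R e]) \<sigma>') \<sigma>"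
      unfolding emit_def e prod.case
      by (simp add: \<sigma> b o_val o_bnd) (simp add: writing_def \<sigma> m[unfolded e] p_def m[unfolded e p_def])
    then show ?case
      unfolding emits.simps
    proof (rule wp_SeqI, elim conjE)
      fix t :: nat and \<tau> assume t: "t = 10" and \<tau>: "writing M0 b {11, 21} R (qs @ [mk_edge x R e]) \<tau>"
      have "wp w (emits es) (\<lambda>t \<sigma>'. t = 10 * length es + 1 \<and>
          writing M0 b {11, 21} R ((qs @ [mk_edge x R e]) @ map (mk_edge x R) es) \<sigma>') \<tau>"
        by (rule Cons.IH[OF \<tau>]) (use Cons.prems in auto)
      then show "wp w (emits es) (\<lambda>t'. (\<lambda>t \<sigma>'. t = 10 * length (e # es) + 1 \<and>
          writing M0 b {11, 21} R (qs @ map (mk_edge x R) (e # es)) \<sigma>') (t + t')) \<tau>"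
        by (rule wp_mono) (simp add: t)
    qed
  qed simp
  then show ?thesis by (rule wp_mono) (use Q in auto)
qed

section \<open>Testing a clause under an assignment of one block\<close>

definition clause_list :: "literal list list \<Rightarrow> nat list" where
  "clause_list Cs = concat (map (\<lambda>C. length C # map literal_code C) Cs)"

lemma clause_list_simps [simp]:
  "clause_list [] = []" "clause_list (C # Cs) = length C # map literal_code C @ clause_list Cs"
  "clause_list (As @ Cs) = clause_list As @ clause_list Cs"
  by (simp_all add: clause_list_def)

text \<open>Register 23 counts the remaining literals, 24 points to the last one read, 25 holds the
  sign of the literal and 26 its variable; 3, 18 and 19 hold \<open>blen\<close>, the block and its
  assignment. A true literal sets register 22.\<close>

definition lit_body :: com where
  "lit_body =
    incr 24 (Imm 1) ;; Load 25 (Reg 24) ;; Op 26 Div (Reg 25) (Imm 2) ;; Op 25 Mod (Reg 25) (Imm 2) ;;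
    Op 27 Div (Reg 26) (Reg 3) ;;
    If (Equal (Reg 27) (Reg 18))
      (Op 26 Mod (Reg 26) (Reg 3) ;; Op 26 Shr (Reg 19) (Reg 26) ;; Op 26 Mod (Reg 26) (Imm 2) ;;
       If (Equal (Reg 26) (Reg 25)) (mov 22 (Imm 1)) Skip) Skip ;;
    Op 23 Sub (Reg 23) (Imm 1)"

definition sat_prog :: com where
  "sat_prog = If (Equal (Reg 17) (Imm 0)) (mov 22 (Imm 1))
    (mov 22 (Imm 0) ;; Load 23 (Reg 13) ;; mov 24 (Reg 13) ;; While (Less (Imm 0) (Reg 23)) lit_body)"

locale ksat_reduction =
  fixes G D k n :: nat and Cs :: "literal list list"
  assumes GD: "0 < G" "0 < D" and Cs: "Cs \<noteq> []"
    and lits: "\<And>C. C \<in> set Cs \<Longrightarrow> set C \<subseteq> {..<n} \<times> UNIV \<and> length C \<le> k"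
begin

text \<open>Rounded up generously so that the \<open>G * D\<close> blocks cover all variables; in
  the size of the instance this costs only a constant factor.\<close>

definition blen :: nat where "blen = n div (G * D) + 1"

definition M :: nat where "M = length Cs"

text \<open>An assignment of a block is a number whose bits are the values of its variables. In the
  code \<open>c\<close> of a literal the variable is \<open>c div 2\<close>, and the parity is the
  sign.\<close>

definition lit_ok :: "nat \<Rightarrow> nat \<Rightarrow> nat \<Rightarrow> bool" where
  "lit_ok p a c \<longleftrightarrow> c div 2 div blen = p \<and> drop_bit (c div 2 mod blen) a mod 2 = c mod 2"

text \<open>Round 0 is the reference round, so the clauses are shifted by one.\<close>

definition satf :: "nat \<Rightarrow> nat \<Rightarrow> nat \<Rightarrow> bool" where
  "satf t p a \<longleftrightarrow> t = 0 \<or> (\<exists>x<length (Cs ! (t - 1)). lit_ok p a (literal_code (Cs ! (t - 1) ! x)))"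

sublocale reduction G D "2 ^ blen" M satf
  by unfold_locales (use GD Cs in \<open>auto simp: M_def satf_def\<close>)

text \<open>An upper bound on the length of the input that is computable from \<open>M\<close>
  alone. The output is first written behind it because the clauses are read once for every block and
  assignment.\<close>

definition Z :: nat where "Z = 2 + M * (k + 1)"

definition input :: "nat list" where "input = [n, M] @ clause_list Cs"

definition M0 :: "nat \<Rightarrow> nat" where "M0 = mem (initial input)"

definition caddr :: "nat \<Rightarrow> nat" where "caddr i = 2 + length (clause_list (take i Cs))"

lemma caddr_0: "caddr 0 = 2"
  by (simp add: caddr_def)

lemma caddr_Suc: "i < M \<Longrightarrow> caddr (Suc i) = Suc (caddr i + length (Cs ! i))"
  by (simp add: caddr_def M_def take_Suc_conv_app_nth)

lemma caddr_M: "caddr M = length input"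
  by (simp add: caddr_def M_def input_def)

lemma caddr_le: "i \<le> M \<Longrightarrow> caddr i \<le> 2 + i * (k + 1)"
proof (induction i)
  case (Suc i)
  then have "length (Cs ! i) \<le> k" using lits by (simp add: M_def)
  with Suc show ?case by (simp add: caddr_Suc)
qed (simp add: caddr_0)

lemma input_le: "length input \<le> Z"
  using caddr_le[of M] by (simp add: caddr_M Z_def)

lemma caddr_mono: "i \<le> j \<Longrightarrow> j \<le> M \<Longrightarrow> caddr i \<le> caddr j"
  by (induction j rule: dec_induct) (auto simp: caddr_Suc)

lemma M0_clause:
  assumes i: "i < M"
  shows "M0 (caddr i) = length (Cs ! i)" "x < length (Cs ! i) \<Longrightarrow> M0 (Suc (caddr i + x)) = literal_code (Cs ! i ! x)"
    "caddr i + length (Cs ! i) < Z"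
proof -
  have "clause_list Cs = clause_list (take i Cs) @ (length (Cs ! i) # map literal_code (Cs ! i) @ clause_list (drop (Suc i) Cs))"
    using i by (subst id_take_nth_drop[of i Cs]) (simp_all add: M_def)
  then have inp: "input = ([n, M] @ clause_list (take i Cs)) @ (length (Cs ! i) # map literal_code (Cs ! i) @ clause_list (drop (Suc i) Cs))"
    by (simp add: input_def)
  have l: "caddr i = length ([n, M] @ clause_list (take i Cs))" by (simp add: caddr_def)
  have "caddr (Suc i) \<le> Z" using caddr_mono[of "Suc i" M] i input_le by (simp add: caddr_M)
  then show "caddr i + length (Cs ! i) < Z" by (simp add: caddr_Suc[OF i])
  then have "x < length (Cs ! i) \<Longrightarrow> Suc (caddr i + x) < length input" "caddr i < length input" for x
    unfolding inp l by simp_all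
  then show "M0 (caddr i) = length (Cs ! i)" "x < length (Cs ! i) \<Longrightarrow> M0 (Suc (caddr i + x)) = literal_code (Cs ! i ! x)"
    unfolding M0_def initial_def using inp l by (simp_all add: nth_append)
qed

lemma literal_code_le: "i < M \<Longrightarrow> x < length (Cs ! i) \<Longrightarrow> literal_code (Cs ! i ! x) \<le> 2 * n"
proof -
  assume "i < M" "x < length (Cs ! i)"
  then have "Cs ! i ! x \<in> {..<n} \<times> UNIV" using lits[of "Cs ! i"] nth_mem[of x "Cs ! i"] by (auto simp: M_def)
  then show ?thesis by (auto simp: literal_code_def)
qed

definition params :: "(nat \<Rightarrow> nat) \<Rightarrow> bool" where
  "params R \<longleftrightarrow> R 2 = M \<and> R 3 = blen \<and> R 4 = 2 ^ blen \<and> R 5 = Q \<and> R 6 = Q ^ D \<and> R 7 = H \<and> R 8 = B \<and>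
    R 9 = 4 * (H + 1) \<and> R 10 = J \<and> R 29 = Z"

text \<open>A common bound on addresses and values: \<open>36\<close> stands for four words for each
  of at most 9 edges per position, and \<open>B ^ (G + 1)\<close> covers weights and
  budgets.\<close>

definition lim :: nat where "lim = 2 * n + Z + 36 * (J * (H + 1)) + B ^ (G + 1) + 20"

lemma wp_sat_prog:
  fixes \<sigma> :: state
  assumes R: "reg \<sigma> 3 = blen" "reg \<sigma> 17 = t" "reg \<sigma> 18 = p" "reg \<sigma> 19 = a" "0 < t \<Longrightarrow> reg \<sigma> 13 = caddr (t - 1)"
    and t: "t \<le> M" and mem: "\<And>x. x < Z \<Longrightarrow> mem \<sigma> x = M0 x" and bnd: "lim < 2 ^ w" "a < 2 ^ w"
    and post: "\<And>u \<sigma>'. u \<le> 13 * k + 5 \<Longrightarrow> (\<And>r. r \<notin> {22..27} \<Longrightarrow> reg \<sigma>' r = reg \<sigma> r) \<Longrightarrow> mem \<sigma>' = mem \<sigma> \<Longrightarrow>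
      reg \<sigma>' 22 = of_bool (satf t p a) \<Longrightarrow> post u \<sigma>'"
  shows "wp w sat_prog post \<sigma>"
proof (cases "t = 0")
  case True
  then show ?thesis
    using bnd(1) R by (auto intro!: post simp: sat_prog_def satf_def lim_def)
next
  case False
  define i where "i = t - 1"
  have i: "i < M" "t - Suc 0 = i" "t - 1 = i" using False t by (auto simp: i_def)
  define C where "C = Cs ! i"
  define c where "c x = literal_code (C ! x)" for x
  define cp where "cp = caddr i"
  note cl = M0_clause[OF i(1), folded C_def cp_def]
  have "length C \<le> k" using lits[of C] i(1) by (simp add: C_def M_def)
  define I where "I x \<tau> \<longleftrightarrow> (\<forall>r. r \<notin> {22..27} \<longrightarrow> reg \<tau> r = reg \<sigma> r) \<and> mem \<tau> = mem \<sigma> \<and> reg \<tau> 23 = length C - x \<and>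
      reg \<tau> 24 = cp + x \<and> reg \<tau> 22 = of_bool (\<exists>y<x. lit_ok p a (c y))" for x and \<tau> :: state
  have body: "wp w lit_body (\<lambda>u \<tau>'. u \<le> 12 \<and> I (Suc x) \<tau>') \<tau>" if x: "x < length C" and inv: "I x \<tau>" for x \<tau>
  proof -
    have \<tau>: "reg \<tau> 3 = blen" "reg \<tau> 18 = p" "reg \<tau> 19 = a" "reg \<tau> 23 = length C - x" "reg \<tau> 24 = cp + x"
      "mem \<tau> (Suc (cp + x)) = c x"
      using inv R x cl(2)[OF x] cl(3) mem[of "Suc (cp + x)"] by (simp_all add: I_def c_def)
    have "c x \<le> 2 * n" using literal_code_le[OF i(1)] x by (simp add: c_def C_def)
    moreover have "c x div 2 \<le> c x" "c x div 2 div blen \<le> c x" "c x div 2 mod blen \<le> c x" "c x mod 2 \<le> c x"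
      by (auto intro: le_trans[OF div_le_dividend] le_trans[OF mod_less_eq_dividend])
    moreover have "drop_bit y a \<le> a" "drop_bit y a mod 2 \<le> a" for y
      by (auto simp: drop_bit_nat_def drop_bit_eq_div intro: le_trans[OF mod_less_eq_dividend])
    ultimately have b: "Suc (cp + x) < 2 ^ w" "c x < 2 ^ w" "c x div 2 < 2 ^ w" "c x mod 2 < 2 ^ w" "c x div 2 div blen < 2 ^ w"
      "c x div 2 mod blen < 2 ^ w" "drop_bit y a < 2 ^ w" "drop_bit y a mod 2 < 2 ^ w" "Suc 0 < 2 ^ w" "length C - Suc x < 2 ^ w" for y
      using bnd x cl(3) unfolding lim_def by (linarith | (meson le_less_trans))+
    have ok: "(\<exists>y<Suc x. lit_ok p a (c y)) \<longleftrightarrow> (\<exists>y<x. lit_ok p a (c y)) \<or> (c x div 2 div blen = p \<and> drop_bit (c x div 2 mod blen) a mod 2 = c x mod 2)"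
      by (auto simp: less_Suc_eq lit_ok_def)
    have d: "length C - x - Suc 0 = length C - Suc x" by simp
    have fr: "\<forall>r. r \<notin> {22..27} \<longrightarrow> reg \<tau> r = reg \<sigma> r" "mem \<tau> = mem \<sigma>" "reg \<tau> 22 = of_bool (\<exists>y<x. lit_ok p a (c y))"
      using inv by (simp_all add: I_def)
    consider "c x div 2 div blen \<noteq> p" | "c x div 2 div blen = p" "drop_bit (c x div 2 mod blen) a mod 2 \<noteq> c x mod 2"
      | "c x div 2 div blen = p" "drop_bit (c x div 2 mod blen) a mod 2 = c x mod 2" by blast
    then show ?thesis
    proof cases
      case 1
      then show ?thesis unfolding lit_body_def by (simp add: \<tau> b) (simp add: I_def ok fr d)
    next
      case 2
      then have "p < 2 ^ w" using b(5) by simp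
      with 2 show ?thesis unfolding lit_body_def by (simp add: \<tau> b) (simp add: I_def ok fr d)
    next
      case 3
      then have "p < 2 ^ w" using b(5) by simp
      with 3 show ?thesis unfolding lit_body_def by (simp add: \<tau> b) (simp add: I_def ok fr d)
    qed
  qed
  have loop: "wp w (While (Less (Imm 0) (Reg 23)) lit_body) Q' \<tau>"
    if "I 0 \<tau>" "\<And>u \<tau>. I (length C) \<tau> \<Longrightarrow> u \<le> 13 * k + 1 \<Longrightarrow> Q' u \<tau>" for Q' \<tau>
  proof (rule wp_While[where I = I and n = "length C" and T = 12])
    show "Q' u \<tau>" if "I (length C) \<tau>" "u \<le> length C * (12 + 1) + 1" for u \<tau>
      using that \<open>length C \<le> k\<close> \<open>\<And>u \<tau>. I (length C) \<tau> \<Longrightarrow> u \<le> 13 * k + 1 \<Longrightarrow> Q' u \<tau>\<close> by simp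
  qed (use that body in \<open>auto simp: I_def\<close>)
  have b: "cp < 2 ^ w" "length C < 2 ^ w" "0 < (2 :: nat) ^ w" using cl(3) bnd(1) by (simp_all add: lim_def)
  have st: "reg \<sigma> 13 = cp" "mem \<sigma> cp = length C" using R(5) False i cl(1,3) mem[of cp] by (simp_all add: cp_def)
  have fin: "satf t p a \<longleftrightarrow> (\<exists>y<length C. lit_ok p a (c y))"
    using False by (simp add: satf_def i C_def c_def)
  show ?thesis
    unfolding sat_prog_def
    by (simp add: R(2) False st b, rule loop)
      (auto intro!: post simp: I_def st fin)
qed

end

lemma wp_SeqT:
  assumes "wp w p (\<lambda>u \<tau>. u \<le> a \<and> P \<tau>) \<sigma>" "\<And>\<tau>. P \<tau> \<Longrightarrow> wp w q (\<lambda>u \<tau>'. u \<le> b \<and> R \<tau>') \<tau>" "a + b \<le> c"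
  shows "wp w (p ;; q) (\<lambda>u \<tau>'. u \<le> c \<and> R \<tau>') \<sigma>"
proof (rule wp_SeqI[OF assms(1)], elim conjE)
  fix t \<tau> assume "t \<le> a" "P \<tau>"
  from this(1) assms(3) show "wp w q (\<lambda>t'. (\<lambda>u \<tau>'. u \<le> c \<and> R \<tau>') (t + t')) \<tau>"
    by (intro wp_mono[OF assms(2)[OF \<open>P \<tau>\<close>]]) auto
qed

declare emits.simps [simp del]

section \<open>Writing one ladder\<close>

definition rail_vertex :: com where
  "rail_vertex = Op 20 Mul (Reg 19) (Imm 4) ;; incr 20 (Reg 14)"

definition rail_body :: com where
  "rail_body = rail_vertex ;;
    emits [(0, 4, Reg 15, Imm 0), (1, 5, Reg 15, Imm 0), (2, 6, Imm 0, Reg 15), (3, 7, Imm 0, Reg 15)] ;;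
    incr 19 (Imm 1)"

definition rung_vertex :: com where
  "rung_vertex =
    Op 20 Mul (Reg 19) (Reg 16) ;; Op 21 Mul (Reg 19) (Reg 19) ;; Op 21 Mul (Reg 21) (Reg 6) ;; incr 20 (Reg 21) ;;
    If (Equal (Reg 17) (Imm 0)) (Op 20 Mul (Reg 2) (Reg 20) ;; Op 20 Sub (Reg 7) (Reg 20)) Skip ;;
    Op 20 Mul (Reg 20) (Imm 4) ;; incr 20 (Reg 14)"

definition rung_body :: com where
  "rung_body = sat_prog ;; rung_vertex ;;
    If (Equal (Reg 22) (Imm 1)) (emits [(0, 2, Imm 0, Imm 0), (1, 3, Imm 0, Imm 0), (0, 3, Imm 0, Imm 0)])
      (emits [(0, 2, Imm 0, Imm 0), (1, 3, Imm 0, Imm 0)]) ;;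
    incr 19 (Imm 1)"

definition link_prog :: "nat \<Rightarrow> com" where
  "link_prog p = Op 20 Mul (Reg 7) (Imm 4) ;; incr 20 (Reg 14) ;; Op 21 Add (Reg 18) (Imm 1) ;;
    If (Equal (Reg 21) (Imm p)) (emits [(3, 4, Imm 0, Imm 0)])
      (emits [(2, 4, Imm 0, Imm 0), (3, 5, Imm 0, Imm 0)])"

definition ladder_prog :: "nat \<Rightarrow> com" where
  "ladder_prog p =
    mov 19 (Imm 0) ;; While (Less (Reg 19) (Reg 7)) rail_body ;;
    mov 19 (Imm 0) ;; While (Less (Reg 19) (Reg 4)) rung_body ;;
    link_prog p"

definition temps :: "nat set" where "temps = {11, 19, 20, 21, 22, 23, 24, 25, 26, 27, 28}"

text \<open>While edges are emitted, the current registers serve as the snapshot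
  (\<open>writing_self\<close>); afterwards the snapshot taken at the start of the ladder is
  reinstated.\<close>

lemma writing_local:
  assumes "\<And>r. r \<notin> temps \<Longrightarrow> R' r = R r" "writing M0 b {11, 21} R' qs \<sigma>"
  shows "writing M0 b temps R qs \<sigma>"
  using assms by (auto simp: writing_def temps_def)

lemma writing_self: "writing M0 b S R qs \<sigma> \<Longrightarrow> writing M0 b {11, 21} (reg \<sigma>) qs \<sigma>"
  by (auto simp: writing_def)

context ksat_reduction
begin

definition in_ladder :: "nat \<Rightarrow> (nat \<Rightarrow> nat) \<Rightarrow> bool" where
  "in_ladder j R \<longleftrightarrow> params R \<and> R 14 = vx j 0 0 \<and> R 15 = wgt j \<and> R 16 = Q ^ dig (blk j) \<and> R 17 = stage j \<and>
    R 18 = blk j \<and> (0 < stage j \<longrightarrow> R 13 = caddr (stage j - 1))"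

abbreviation wr :: "(nat \<Rightarrow> nat) \<Rightarrow> wedge list \<Rightarrow> state \<Rightarrow> bool" where
  "wr \<equiv> writing M0 (Z + 6) temps"

lemma vx_less: "j < J \<Longrightarrow> i \<le> H \<Longrightarrow> vx j 0 i + 8 \<le> 4 * (J * (H + 1)) + 4"
proof -
  assume "j < J" "i \<le> H"
  then have "j * (H + 1) + i + 1 \<le> (j + 1) * (H + 1)" by simp
  also have "\<dots> \<le> J * (H + 1)" using \<open>j < J\<close> by (intro mult_le_mono1) simp
  finally have "4 * (x + 1) \<le> 4 * y" if "x = j * (H + 1) + i" "y = J * (H + 1)" for x y using that by simp
  then show ?thesis unfolding vx_def by fastforce
qed

lemma wgt_le: "wgt j \<le> B ^ (G + 1)"
proof -
  have "blk j < P" using P_pos by simp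
  then have "grp (blk j) < G" by (simp add: P_def less_mult_imp_div_less)
  then show ?thesis unfolding wgt_def by (intro power_increasing) (auto simp: B_def)
qed

lemma lim_bounds:
  assumes "lim < 2 ^ w"
  shows "4 * (J * (H + 1)) + 20 < 2 ^ w" "wgt j < 2 ^ w" "Z + 6 + 36 * (J * (H + 1)) < 2 ^ w"
  using assms wgt_le[of j] unfolding lim_def by linarith+

lemma JH: "H \<le> J * (H + 1)" "J \<le> J * (H + 1)"
proof -
  have "1 \<le> J" using P_pos by (simp add: J_def)
  then have "1 * (H + 1) \<le> J * (H + 1)" by (rule mult_le_mono1)
  then show "H \<le> J * (H + 1)" "J \<le> J * (H + 1)" by simp_all
qed

lemma q_le_H: "2 ^ blen \<le> H"
proof -
  have "2 ^ blen * 1 \<le> (2 ^ blen) ^ 2 * Q ^ D"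
    using Q_pos by (intro mult_le_mono) (simp_all add: power2_eq_square Suc_leI)
  also have "\<dots> \<le> (M + 1) * ((2 ^ blen) ^ 2 * Q ^ D)" by simp
  finally show ?thesis by (simp only: H_def mult.assoc)
qed

lemma length_rails: "length (concat (map (rail j) [0..<i])) = 4 * i"
  by (induction i) (simp_all add: rail_def)

lemma length_rungs: "length (concat (map (rung j) [0..<a])) \<le> 3 * a"
  by (induction a) (simp_all add: rung_def Let_def)

text \<open>There are \<open>4 * H\<close> rail edges, at most 3 rungs for each of the
  \<open>q <= H\<close> assignments, and at most 2 links.\<close>

lemma length_ladder: "length (ladder j) \<le> 9 * (H + 1)"
proof -
  have "length (link j) \<le> 2" by (simp add: link_def)
  then show ?thesis using length_rungs[of j "2 ^ blen"] q_le_H by (simp add: ladder_def length_rails)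
qed

lemma ladders_Suc: "ladders (Suc j) = ladders j @ ladder j"
  by (simp add: ladders_def)

lemma length_ladders: "length (ladders j) \<le> 9 * (j * (H + 1))"
proof (induction j)
  case (Suc j)
  have "length (ladders (Suc j)) \<le> 9 * (j * (H + 1)) + 9 * (H + 1)"
    unfolding ladders_Suc length_append using Suc length_ladder by (rule add_mono)
  then show ?case by (simp add: algebra_simps)
qed (simp add: ladders_def)

lemma wp_rails:
  assumes R: "in_ladder j R" and j: "j < J" and wr: "wr R qs \<sigma>" and \<sigma>: "reg \<sigma> 19 = 0" and lim: "lim < 2 ^ w"
    and len: "Z + 6 + 4 * (length qs + 4 * H) < 2 ^ w"
    and post: "\<And>t \<sigma>'. t \<le> H * 45 + 1 \<Longrightarrow> wr R (qs @ concat (map (rail j) [0..<H])) \<sigma>' \<Longrightarrow> post t \<sigma>'"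
  shows "wp w (While (Less (Reg 19) (Reg 7)) rail_body) post \<sigma>"
proof -
  define I where "I i \<tau> \<longleftrightarrow> wr R (qs @ concat (map (rail j) [0..<i])) \<tau> \<and> reg \<tau> 19 = i" for i \<tau>
  note lb = lim_bounds[OF lim]
  show ?thesis
  proof (rule wp_While[where I = I and n = H and T = 44])
    fix i \<tau> assume i: "i < H" and inv: "I i \<tau>"
    have \<tau>: "reg \<tau> 19 = i" "reg \<tau> 14 = vx j 0 0" "reg \<tau> 15 = wgt j" "reg \<tau> 7 = H"
      using inv R by (auto simp: I_def writing_def temps_def in_ladder_def params_def)
    have x: "i * 4 + vx j 0 0 = vx j 0 i" "vx j 0 i + 8 \<le> 4 * (J * (H + 1)) + 4"
      using vx_less[OF j, of i] i by (simp_all add: vx_def)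
    then have b: "i * 4 < 2 ^ w" "vx j 0 i < 2 ^ w" "vx j 0 i + 7 < 2 ^ w" "Suc i < 2 ^ w"
      using lb(1) by linarith+
    define \<tau>1 where "\<tau>1 = \<tau>\<lparr>reg := (reg \<tau>)(20 := vx j 0 i)\<rparr>"
    have w1: "wr R (qs @ concat (map (rail j) [0..<i])) \<tau>1"
      using inv by (simp add: I_def writing_def temps_def \<tau>1_def)
    have "wp w (emits [(0, 4, Reg 15, Imm 0), (1, 5, Reg 15, Imm 0), (2, 6, Imm 0, Reg 15), (3, 7, Imm 0, Reg 15)])
      (\<lambda>u \<tau>2. u \<le> 41 \<and> wr R (qs @ concat (map (rail j) [0..<Suc i])) \<tau>2 \<and> reg \<tau>2 19 = i) \<tau>1"
    proof (rule wp_emits[OF writing_self[OF w1]])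
      show "reg \<tau>1 20 = vx j 0 i" by (simp add: \<tau>1_def)
      show "reg \<tau>1 15 < 2 ^ w" using lb(2) by (simp add: \<tau>1_def \<tau>)
      fix \<tau>2 assume w2: "writing M0 (Z + 6) {11, 21} (reg \<tau>1) ((qs @ concat (map (rail j) [0..<i])) @
           map (mk_edge (vx j 0 i) (reg \<tau>1)) [(0, 4, Reg 15, Imm 0), (1, 5, Reg 15, Imm 0), (2, 6, Imm 0, Reg 15), (3, 7, Imm 0, Reg 15)]) \<tau>2"
      have "map (mk_edge (vx j 0 i) (reg \<tau>1)) [(0, 4, Reg 15, Imm 0), (1, 5, Reg 15, Imm 0), (2, 6, Imm 0, Reg 15), (3, 7, Imm 0, Reg 15)] = rail j i"
        by (simp add: mk_edge_def rail_def vx_def \<tau>1_def \<tau>)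
      with w2 have w3: "writing M0 (Z + 6) {11, 21} (reg \<tau>1) (qs @ concat (map (rail j) [0..<Suc i])) \<tau>2"
        by simp
      have "reg \<tau>2 19 = i" using w3 \<tau> by (simp add: writing_def \<tau>1_def)
      moreover have "wr R (qs @ concat (map (rail j) [0..<Suc i])) \<tau>2"
        by (rule writing_local[OF _ w3]) (use w1 in \<open>simp add: writing_def\<close>)
      ultimately show "10 * length [(0, 4, Reg 15, Imm 0), (1, 5, Reg 15, Imm 0), (2, 6, Imm 0, Reg 15), (3, 7, Imm 0, Reg 15)] + 1 \<le> (41::nat) \<and>
        wr R (qs @ concat (map (rail j) [0..<Suc i])) \<tau>2 \<and> reg \<tau>2 19 = i" by simp
    qed (use b len i in \<open>auto simp: length_rails\<close>)
    then have E: "wp w (emits [(0, 4, Reg 15, Imm 0), (1, 5, Reg 15, Imm 0), (2, 6, Imm 0, Reg 15), (3, 7, Imm 0, Reg 15)] ;; incr 19 (Imm 1))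
      (\<lambda>u \<tau>'. u \<le> 42 \<and> I (Suc i) \<tau>') \<tau>1"
      by (rule wp_SeqT[where b = 1]) (use b in \<open>auto simp: I_def writing_def temps_def\<close>)
    have v: "wp w rail_vertex (\<lambda>u \<tau>'. u \<le> 2 \<and> \<tau>' = \<tau>1) \<tau>"
      unfolding rail_vertex_def by (simp add: \<tau> b x(1) \<tau>1_def)
    have "wp w rail_body (\<lambda>u \<tau>'. u \<le> 44 \<and> I (Suc i) \<tau>') \<tau>"
      unfolding rail_body_def by (rule wp_SeqT[OF v, where b = 42]) (use E in simp_all)
    then show "holds \<tau> (Less (Reg 19) (Reg 7)) \<and> wp w rail_body (\<lambda>u \<tau>'. u \<le> 44 \<and> I (Suc i) \<tau>') \<tau>"
      using \<tau> i by simp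
  next
    show "\<not> holds \<tau> (Less (Reg 19) (Reg 7))" if "I H \<tau>" for \<tau>
      using that R by (auto simp: I_def writing_def temps_def in_ladder_def params_def)
  qed (use wr \<sigma> post in \<open>auto simp: I_def\<close>)
qed

lemma wp_rung_vertex:
  fixes \<sigma> :: state
  assumes R: "in_ladder j R" and j: "j < J" and \<sigma>: "\<forall>r. r \<notin> temps \<longrightarrow> reg \<sigma> r = R r" and a: "reg \<sigma> 19 = a" "a < 2 ^ blen"
    and lim: "lim < 2 ^ w"
    and post: "\<And>t. t \<le> 10 \<Longrightarrow> post t (\<sigma>\<lparr>reg := (reg \<sigma>)(21 := a * a * Q ^ D, 20 := vx j 0 (drop_at j a))\<rparr>)"
  shows "wp w rung_vertex post \<sigma>"
proof -
  note lb = lim_bounds[OF lim] and c = code_le[OF a(2), of "blk j"] drop_at_le[OF a(2), of j]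
  have \<tau>: "reg \<sigma> 16 = Q ^ dig (blk j)" "reg \<sigma> 6 = Q ^ D" "reg \<sigma> 17 = stage j" "reg \<sigma> 2 = M" "reg \<sigma> 7 = H" "reg \<sigma> 14 = vx j 0 0"
    using \<sigma> R by (auto simp: temps_def in_ladder_def params_def)
  have cd: "a * Q ^ dig (blk j) + a * a * Q ^ D = code (blk j) a" by (simp add: code_def)
  have "a * a \<le> a * a * Q ^ D" using Q_pos by simp
  then have "a * a \<le> code (blk j) a" "a * Q ^ dig (blk j) \<le> code (blk j) a" "a * a * Q ^ D \<le> code (blk j) a"
    unfolding code_def by linarith+
  moreover have "4 * drop_at j a + vx j 0 0 = vx j 0 (drop_at j a)" by (simp add: vx_def)
  moreover note vx_less[OF j c(3)] JH(1)
  moreover have "4 * code (blk j) a \<le> 4 * H" "4 * (H - M * code (blk j) a) \<le> 4 * H" using c by simp_all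
  ultimately have b: "a * a < 2 ^ w" "a * Q ^ dig (blk j) < 2 ^ w" "a * a * Q ^ D < 2 ^ w" "code (blk j) a < 2 ^ w"
    "M * code (blk j) a < 2 ^ w" "H - M * code (blk j) a < 2 ^ w" "code (blk j) a * 4 < 2 ^ w" "(H - M * code (blk j) a) * 4 < 2 ^ w"
    "vx j 0 (drop_at j a) < 2 ^ w" and v: "drop_at j a * 4 + vx j 0 0 = vx j 0 (drop_at j a)"
    using lb(1) c by linarith+
  show ?thesis
  proof (cases "stage j = 0")
    case True
    then have d: "(H - M * code (blk j) a) * 4 + vx j 0 0 = vx j 0 (drop_at j a)" using v by (simp add: drop_at_def)
    show ?thesis unfolding rung_vertex_def
      by (simp add: a(1) \<tau> b cd d True) (rule post, simp)
  next
    case False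
    then have d: "code (blk j) a * 4 + vx j 0 0 = vx j 0 (drop_at j a)" using v by (simp add: drop_at_def)
    show ?thesis unfolding rung_vertex_def
      by (simp add: a(1) \<tau> b cd d False) (rule post, simp)
  qed
qed

lemma wp_rungs:
  assumes R: "in_ladder j R" and j: "j < J" and wr: "wr R qs \<sigma>" and \<sigma>: "reg \<sigma> 19 = 0" and lim: "lim < 2 ^ w"
    and len: "Z + 6 + 4 * (length qs + 3 * 2 ^ blen) < 2 ^ w"
    and post: "\<And>t \<sigma>'. t \<le> 2 ^ blen * (13 * k + 50) + 1 \<Longrightarrow> wr R (qs @ concat (map (rung j) [0..<2 ^ blen])) \<sigma>' \<Longrightarrow> post t \<sigma>'"
  shows "wp w (While (Less (Reg 19) (Reg 4)) rung_body) post \<sigma>"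
proof -
  define I where "I a \<tau> \<longleftrightarrow> wr R (qs @ concat (map (rung j) [0..<a])) \<tau> \<and> reg \<tau> 19 = a" for a \<tau>
  note lb = lim_bounds[OF lim]
  have "stage j \<le> M" using j by (simp add: J_def less_mult_imp_div_less flip: less_Suc_eq_le)
  show ?thesis
  proof (rule wp_While[where I = I and n = "2 ^ blen" and T = "13 * k + 49"])
    fix a \<tau> assume a: "a < 2 ^ blen" and inv: "I a \<tau>"
    have \<tau>: "reg \<tau> 19 = a" "reg \<tau> 4 = 2 ^ blen" "reg \<tau> 3 = blen" "reg \<tau> 17 = stage j" "reg \<tau> 18 = blk j"
      "0 < stage j \<Longrightarrow> reg \<tau> 13 = caddr (stage j - 1)" "\<forall>r. r \<notin> temps \<longrightarrow> reg \<tau> r = R r"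
      using inv R by (auto simp: I_def writing_def temps_def in_ladder_def params_def)
    have mem: "mem \<tau> x = M0 x" if "x < Z" for x
      using inv that by (simp add: I_def writing_def outm_below)
    have ba: "a < 2 ^ w" "Suc a < 2 ^ w" "Suc 0 < 2 ^ w" using a q_le_H JH(1) lb(1) by linarith+
    define S where "S \<tau>' \<longleftrightarrow> wr R (qs @ concat (map (rung j) [0..<a])) \<tau>' \<and> reg \<tau>' 19 = a \<and>
      reg \<tau>' 22 = of_bool (satf (stage j) (blk j) a)" for \<tau>'
    have sat: "wp w sat_prog (\<lambda>u \<tau>'. u \<le> 13 * k + 5 \<and> S \<tau>') \<tau>"
    proof (rule wp_sat_prog[OF \<tau>(3-5) \<tau>(1) \<tau>(6) \<open>stage j \<le> M\<close> mem lim ba(1)])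
      fix u and \<tau>' :: state assume *: "u \<le> 13 * k + 5" "\<And>r. r \<notin> {22..27} \<Longrightarrow> reg \<tau>' r = reg \<tau> r" "mem \<tau>' = mem \<tau>"
        "reg \<tau>' 22 = of_bool (satf (stage j) (blk j) a)"
      have "reg \<tau>' r = R r" if "r \<notin> temps" for r
      proof -
        have "r \<notin> {22..27}" using that by (auto simp: temps_def atLeastAtMost_def numeral_eq_Suc le_Suc_eq)
        then show ?thesis using *(2)[of r] that \<tau>(7) by simp
      qed
      moreover have "reg \<tau>' 11 = reg \<tau> 11" "reg \<tau>' 19 = reg \<tau> 19" using *(2) by simp_all
      ultimately show "u \<le> 13 * k + 5 \<and> S \<tau>'"
        using inv *(1,3,4) by (simp add: S_def I_def writing_def)
    qed auto
    define V where "V \<tau>' \<longleftrightarrow> S \<tau>' \<and> reg \<tau>' 20 = vx j 0 (drop_at j a)" for \<tau>'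
    have vert: "wp w rung_vertex (\<lambda>u \<tau>'. u \<le> 10 \<and> V \<tau>') \<tau>1" if S: "S \<tau>1" for \<tau>1
    proof (rule wp_rung_vertex[OF R j _ _ a lim])
      show "\<forall>r. r \<notin> temps \<longrightarrow> reg \<tau>1 r = R r" "reg \<tau>1 19 = a" using S by (auto simp: S_def writing_def)
      show "t \<le> 10 \<and> V (\<tau>1\<lparr>reg := (reg \<tau>1)(21 := a * a * Q ^ D, 20 := vx j 0 (drop_at j a))\<rparr>)" if "t \<le> 10" for t
        using S that by (auto simp: V_def S_def writing_def temps_def)
    qed
    have em: "wp w (emits es) (\<lambda>u \<tau>'. u \<le> 31 \<and> wr R (qs @ concat (map (rung j) [0..<Suc a])) \<tau>' \<and> reg \<tau>' 19 = a) \<tau>2"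
      if V: "V \<tau>2" and es: "map (mk_edge (vx j 0 (drop_at j a)) (reg \<tau>2)) es = rung j a" "length es \<le> 3"
        "\<forall>(c1, c2, o3, o4)\<in>set es. c1 \<le> 7 \<and> c2 \<le> 7 \<and> o3 \<in> {Imm 0, Reg 15} \<and> o4 \<in> {Imm 0, Reg 15}" for es \<tau>2
    proof -
      have w2: "wr R (qs @ concat (map (rung j) [0..<a])) \<tau>2" using V by (simp add: V_def S_def)
      show ?thesis
      proof (rule wp_emits[OF writing_self[OF w2] _ es(3)])
        show "reg \<tau>2 20 = vx j 0 (drop_at j a)" using V by (simp add: V_def)
        have "reg \<tau>2 15 = wgt j" using w2 R by (auto simp: writing_def temps_def in_ladder_def)
        then show "reg \<tau>2 15 < 2 ^ w" using lb(2) by simp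
        show "vx j 0 (drop_at j a) + 7 < 2 ^ w" using vx_less[OF j drop_at_le[OF a, of j]] lb(1) by linarith
        show "Z + 6 + 4 * (length (qs @ concat (map (rung j) [0..<a])) + length es) < 2 ^ w"
        proof (rule le_less_trans[OF _ len])
          have "c \<le> 3 * a \<Longrightarrow> e \<le> 3 \<Longrightarrow> a < y \<Longrightarrow> z + 6 + 4 * (l + c + e) \<le> z + 6 + 4 * (l + 3 * y)" for c e y z l :: nat
            by presburger
          from this[OF length_rungs[of j a] es(2) a] show "Z + 6 + 4 * (length (qs @ concat (map (rung j) [0..<a])) + length es)
            \<le> Z + 6 + 4 * (length qs + 3 * 2 ^ blen)"
            unfolding length_append .
        qed
        fix \<tau>3 assume "writing M0 (Z + 6) {11, 21} (reg \<tau>2) ((qs @ concat (map (rung j) [0..<a])) @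
            map (mk_edge (vx j 0 (drop_at j a)) (reg \<tau>2)) es) \<tau>3"
        then have w3: "writing M0 (Z + 6) {11, 21} (reg \<tau>2) (qs @ concat (map (rung j) [0..<Suc a])) \<tau>3"
          by (simp add: es(1))
        have "reg \<tau>3 19 = a" using w3 V by (simp add: writing_def V_def S_def)
        moreover have "wr R (qs @ concat (map (rung j) [0..<Suc a])) \<tau>3"
          by (rule writing_local[OF _ w3]) (use w2 in \<open>simp add: writing_def\<close>)
        ultimately show "10 * length es + 1 \<le> 31 \<and> wr R (qs @ concat (map (rung j) [0..<Suc a])) \<tau>3 \<and> reg \<tau>3 19 = a"
          using es(2) by simp
      qed
    qed
    let ?if = "If (Equal (Reg 22) (Imm 1)) (emits [(0, 2, Imm 0, Imm 0), (1, 3, Imm 0, Imm 0), (0, 3, Imm 0, Imm 0)])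
      (emits [(0, 2, Imm 0, Imm 0), (1, 3, Imm 0, Imm 0)])"
    have br: "wp w ?if (\<lambda>u \<tau>'. u \<le> 32 \<and> wr R (qs @ concat (map (rung j) [0..<Suc a])) \<tau>' \<and> reg \<tau>' 19 = a) \<tau>2"
      if V: "V \<tau>2" for \<tau>2
    proof (cases "satf (stage j) (blk j) a")
      case True
      have "map (mk_edge (vx j 0 (drop_at j a)) (reg \<tau>2)) [(0, 2, Imm 0, Imm 0), (1, 3, Imm 0, Imm 0), (0, 3, Imm 0, Imm 0)] = rung j a"
        using True by (simp add: mk_edge_def rung_def Let_def vx_def)
      from em[OF V this] True V show ?thesis by (auto simp: V_def S_def elim!: wp_mono)
    next
      case False
      have "map (mk_edge (vx j 0 (drop_at j a)) (reg \<tau>2)) [(0, 2, Imm 0, Imm 0), (1, 3, Imm 0, Imm 0)] = rung j a"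
        using False by (simp add: mk_edge_def rung_def Let_def vx_def)
      from em[OF V this] False V show ?thesis by (auto simp: V_def S_def elim!: wp_mono)
    qed
    have fin: "wp w (incr 19 (Imm 1)) (\<lambda>u \<tau>'. u \<le> 1 \<and> I (Suc a) \<tau>') \<tau>3"
      if "wr R (qs @ concat (map (rung j) [0..<Suc a])) \<tau>3 \<and> reg \<tau>3 19 = a" for \<tau>3
      using that ba by (auto simp: I_def writing_def temps_def)
    have "wp w rung_body (\<lambda>u \<tau>'. u \<le> 13 * k + 49 \<and> I (Suc a) \<tau>') \<tau>"
      unfolding rung_body_def
      by (rule wp_SeqT[OF sat, where b = 44], rule wp_SeqT[OF vert, where b = 33], assumption,
          rule wp_SeqT[OF br fin]) simp_all
    then show "holds \<tau> (Less (Reg 19) (Reg 4)) \<and> wp w rung_body (\<lambda>u \<tau>'. u \<le> 13 * k + 49 \<and> I (Suc a) \<tau>') \<tau>"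
      using \<tau> a by simp
  next
    show "\<not> holds \<tau> (Less (Reg 19) (Reg 4))" if "I (2 ^ blen) \<tau>" for \<tau>
      using that R by (auto simp: I_def writing_def temps_def in_ladder_def params_def)
    show "post t \<tau>" if "I (2 ^ blen) \<tau>" "t \<le> 2 ^ blen * (13 * k + 49 + 1) + 1" for t \<tau>
      using that by (intro post) (simp_all add: I_def add.commute)
  qed (use wr \<sigma> in \<open>auto simp: I_def\<close>)
qed

lemma wp_link:
  assumes R: "in_ladder j R" and j: "j < J" and wr: "wr R qs \<sigma>" and lim: "lim < 2 ^ w"
    and len: "Z + 6 + 4 * (length qs + 2) < 2 ^ w"
  shows "wp w (link_prog P) (\<lambda>t \<sigma>'. t \<le> 25 \<and> wr R (qs @ link j) \<sigma>') \<sigma>"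
proof -
  note lb = lim_bounds[OF lim]
  have \<tau>: "reg \<sigma> 7 = H" "reg \<sigma> 14 = vx j 0 0" "reg \<sigma> 15 = wgt j" "reg \<sigma> 18 = blk j"
    using wr R by (auto simp: writing_def temps_def in_ladder_def params_def)
  have x: "H * 4 + vx j 0 0 = vx j 0 H" "vx j 0 H + 8 \<le> 4 * (J * (H + 1)) + 4"
    using vx_less[OF j, of H] by (simp_all add: vx_def)
  have blk: "blk j < P" "P \<le> J" using P_pos by (simp_all add: J_def)
  have b: "H * 4 < 2 ^ w" "vx j 0 H < 2 ^ w" "vx j 0 H + 7 < 2 ^ w" "Suc (blk j) < 2 ^ w"
    using x lb(1) blk JH by linarith+
  define \<tau>1 where "\<tau>1 = \<sigma>\<lparr>reg := (reg \<sigma>)(20 := vx j 0 H, 21 := Suc (blk j))\<rparr>"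
  have w1: "wr R qs \<tau>1" using wr by (simp add: writing_def temps_def \<tau>1_def)
  have em: "wp w (emits es) (\<lambda>u \<tau>'. u \<le> 21 \<and> wr R (qs @ link j) \<tau>') \<tau>1"
    if es: "map (mk_edge (vx j 0 H) (reg \<tau>1)) es = link j" "length es \<le> 2"
      "\<forall>(c1, c2, o3, o4)\<in>set es. c1 \<le> 7 \<and> c2 \<le> 7 \<and> o3 \<in> {Imm 0, Reg 15} \<and> o4 \<in> {Imm 0, Reg 15}" for es
  proof (rule wp_emits[OF writing_self[OF w1] _ es(3)])
    show "reg \<tau>1 20 = vx j 0 H" "reg \<tau>1 15 < 2 ^ w" using lb(2) by (simp_all add: \<tau>1_def \<tau>)
    show "vx j 0 H + 7 < 2 ^ w" by (rule b)
    show "Z + 6 + 4 * (length qs + length es) < 2 ^ w"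
      using le_less_trans[OF _ len, of "Z + 6 + 4 * (length qs + length es)"] es(2) by simp
    fix \<tau>3 assume "writing M0 (Z + 6) {11, 21} (reg \<tau>1) (qs @ map (mk_edge (vx j 0 H) (reg \<tau>1)) es) \<tau>3"
    then have "writing M0 (Z + 6) {11, 21} (reg \<tau>1) (qs @ link j) \<tau>3" by (simp only: es(1))
    then have "wr R (qs @ link j) \<tau>3" by (rule writing_local[rotated]) (use w1 in \<open>simp add: writing_def\<close>)
    then show "10 * length es + 1 \<le> 21 \<and> wr R (qs @ link j) \<tau>3" using es(2) by simp
  qed
  show ?thesis
  proof (cases "blk j = P - 1")
    case True
    have "map (mk_edge (vx j 0 H) (reg \<tau>1)) [(3, 4, Imm 0, Imm 0)] = link j"
      using True by (simp add: mk_edge_def link_def vx_def)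
    from em[OF this] have E: "wp w (emits [(3, 4, Imm 0, Imm 0)]) (\<lambda>u \<tau>'. u \<le> 21 \<and> wr R (qs @ link j) \<tau>') \<tau>1" by simp
    have "Suc (blk j) = P" using True P_pos by simp
    with E b show ?thesis unfolding link_prog_def \<tau>1_def by (simp add: \<tau> x(1)) (erule wp_mono, simp)
  next
    case False
    have "map (mk_edge (vx j 0 H) (reg \<tau>1)) [(2, 4, Imm 0, Imm 0), (3, 5, Imm 0, Imm 0)] = link j"
      using False by (simp add: mk_edge_def link_def vx_def)
    from em[OF this] have E: "wp w (emits [(2, 4, Imm 0, Imm 0), (3, 5, Imm 0, Imm 0)]) (\<lambda>u \<tau>'. u \<le> 21 \<and> wr R (qs @ link j) \<tau>') \<tau>1" by simp
    have "Suc (blk j) \<noteq> P" using False by simp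
    with E b show ?thesis unfolding link_prog_def \<tau>1_def by (simp add: \<tau> x(1)) (erule wp_mono, simp)
  qed
qed

lemma wp_ladder:
  assumes R: "in_ladder j R" and j: "j < J" and wr: "wr R (ladders j) \<sigma>" and lim: "lim < 2 ^ w"
  shows "wp w (ladder_prog P) (\<lambda>t \<sigma>'. t \<le> H * 45 + 2 ^ blen * (13 * k + 50) + 30 \<and> wr R (ladders (Suc j)) \<sigma>') \<sigma>"
proof -
  define qs1 where "qs1 = ladders j @ concat (map (rail j) [0..<H])"
  define qs2 where "qs2 = qs1 @ concat (map (rung j) [0..<2 ^ blen])"
  have full: "qs2 @ link j = ladders (Suc j)" by (simp add: qs1_def qs2_def ladders_Suc ladder_def)
  have "(j + 1) * (H + 1) \<le> J * (H + 1)" using j by (intro mult_le_mono1) simp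
  then have jH: "j * (H + 1) + (H + 1) \<le> J * (H + 1)" by simp
  note lb = lim_bounds[OF lim]
  have l1: "length qs1 = length (ladders j) + 4 * H" by (simp add: qs1_def length_rails)
  have l2: "length qs2 \<le> length qs1 + 3 * 2 ^ blen" using length_rungs[of j "2 ^ blen"] by (simp add: qs2_def)
  have len: "Z + 6 + 4 * (length (ladders j) + 4 * H) < 2 ^ w" "Z + 6 + 4 * (length qs1 + 3 * 2 ^ blen) < 2 ^ w"
    "Z + 6 + 4 * (length qs2 + 2) < 2 ^ w"
  proof -
    define X where "X = j * (H + 1)"
    define Y where "Y = J * (H + 1)"
    have *: "length (ladders j) \<le> 9 * X" "X + (H + 1) \<le> Y" "Z + 6 + 36 * Y < 2 ^ w"
      using length_ladders[of j] jH lb(3) by (simp_all only: X_def Y_def)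
    have arith: "l1 = l + 4 * h \<Longrightarrow> l2 \<le> l1 + 3 * a \<Longrightarrow> a \<le> h \<Longrightarrow> l \<le> 9 * x \<Longrightarrow> x + (h + 1) \<le> y \<Longrightarrow>
      z + 6 + 4 * (l2 + 2) \<le> z + 6 + 36 * y \<and> z + 6 + 4 * (l1 + 3 * a) \<le> z + 6 + 36 * y"
      for l l1 l2 h a x y z :: nat by auto
    note arith = arith[OF l1 l2 q_le_H *(1,2), of Z]
    then have "Z + 6 + 4 * (length qs2 + 2) \<le> Z + 6 + 36 * Y" ..
    then show 3: "Z + 6 + 4 * (length qs2 + 2) < 2 ^ w" using *(3) by (rule le_less_trans)
    from arith have "Z + 6 + 4 * (length qs1 + 3 * 2 ^ blen) \<le> Z + 6 + 36 * Y" ..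
    then show 2: "Z + 6 + 4 * (length qs1 + 3 * 2 ^ blen) < 2 ^ w" using *(3) by (rule le_less_trans)
    then show "Z + 6 + 4 * (length (ladders j) + 4 * H) < 2 ^ w"
      by (rule le_less_trans[rotated]) (simp add: l1)
  qed
  have z: "wp w (mov 19 (Imm 0)) (\<lambda>u \<tau>. u \<le> 1 \<and> wr R qs \<tau> \<and> reg \<tau> 19 = 0) \<tau>" if "wr R qs \<tau>" for qs \<tau>
    using that by (auto simp: writing_def temps_def)
  have a: "wp w (While (Less (Reg 19) (Reg 7)) rail_body) (\<lambda>u \<tau>'. u \<le> H * 45 + 1 \<and> wr R qs1 \<tau>') \<tau>"
    if "wr R (ladders j) \<tau> \<and> reg \<tau> 19 = 0" for \<tau>
    using that by (intro wp_rails[OF R j _ _ lim len(1)]) (auto simp: qs1_def)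
  have b: "wp w (While (Less (Reg 19) (Reg 4)) rung_body) (\<lambda>u \<tau>'. u \<le> 2 ^ blen * (13 * k + 50) + 1 \<and> wr R qs2 \<tau>') \<tau>"
    if "wr R qs1 \<tau> \<and> reg \<tau> 19 = 0" for \<tau>
    using that by (intro wp_rungs[OF R j _ _ lim len(2)]) (auto simp: qs2_def)
  show ?thesis
    unfolding ladder_prog_def full[symmetric]
    by (rule wp_SeqT[OF z[OF wr]], rule wp_SeqT[OF a], assumption, rule wp_SeqT[OF z], assumption,
        rule wp_SeqT[OF b wp_link[OF R j _ lim len(3)]], assumption, assumption) (rule order_refl | simp)+
qed

end

section \<open>The loop over all ladders\<close>

definition prep :: "nat \<Rightarrow> nat \<Rightarrow> com" where
  "prep d p = Op 17 Div (Reg 12) (Imm p) ;; Op 18 Mod (Reg 12) (Imm p) ;;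
    Op 28 Div (Reg 18) (Imm d) ;; pow 15 8 (Reg 28) 27 ;;
    Op 28 Mod (Reg 18) (Imm d) ;; pow 16 5 (Reg 28) 27 ;; Op 14 Mul (Reg 12) (Reg 9)"

text \<open>At the end of a round the clause pointer in register 13 moves past the clause just used.
  The reference round uses none and leaves the pointer in place.\<close>

definition advance :: "nat \<Rightarrow> com" where
  "advance p = Op 20 Add (Reg 18) (Imm 1) ;;
    If (Equal (Reg 20) (Imm p))
      (If (Equal (Reg 17) (Imm 0)) Skip (Load 20 (Reg 13) ;; incr 13 (Reg 20) ;; incr 13 (Imm 1))) Skip ;;
    incr 12 (Imm 1)"

definition loop_body :: "nat \<Rightarrow> nat \<Rightarrow> com" where
  "loop_body d p = prep d p ;; ladder_prog p ;; advance p"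

definition setup_bases :: "nat \<Rightarrow> nat \<Rightarrow> com" where
  "setup_bases d p =
    Op 3 Div (Reg 1) (Imm p) ;; incr 3 (Imm 1) ;; Op 4 Shl (Imm 1) (Reg 3) ;;
    Op 5 Add (Reg 2) (Imm 1) ;; Op 5 Mul (Reg 5) (Reg 4) ;; pow 6 5 (Imm d) 27 ;;
    Op 7 Add (Reg 2) (Imm 1) ;; Op 7 Mul (Reg 7) (Reg 4) ;; Op 7 Mul (Reg 7) (Reg 4) ;; Op 7 Mul (Reg 7) (Reg 6) ;;
    Op 8 Add (Reg 2) (Imm 1) ;; Op 8 Mul (Reg 8) (Imm d) ;; Op 8 Mul (Reg 8) (Reg 7) ;; incr 8 (Imm 1) ;;
    Op 9 Add (Reg 7) (Imm 1) ;; Op 9 Mul (Reg 9) (Imm 4) ;; Op 10 Add (Reg 2) (Imm 1) ;; Op 10 Mul (Reg 10) (Imm p)"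

definition setup_pointers :: "nat \<Rightarrow> com" where
  "setup_pointers k =
    Op 29 Mul (Reg 2) (Imm (k + 1)) ;; incr 29 (Imm 2) ;; Op 11 Add (Reg 29) (Imm 6) ;;
    mov 12 (Imm 0) ;; mov 13 (Imm 2)"

context ksat_reduction
begin

text \<open>By truncation, \<open>stage j - 1\<close> puts the pointer on the first clause in both
  round 0 and round 1.\<close>

definition at_ladder :: "nat \<Rightarrow> state \<Rightarrow> bool" where
  "at_ladder j \<sigma> \<longleftrightarrow> params (reg \<sigma>) \<and> reg \<sigma> 12 = j \<and> reg \<sigma> 13 = caddr (stage j - 1) \<and>
    wr (reg \<sigma>) (ladders j) \<sigma>"

lemma DP: "D \<le> P" "G \<le> P" "1 \<le> P"
  using GD P_pos by (simp_all add: P_def)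

lemma P_le_J: "P \<le> J"
  by (simp add: J_def)

lemma Q_pow_le: "i \<le> D \<Longrightarrow> Q ^ i \<le> H"
proof -
  assume "i \<le> D"
  then have "Q ^ i \<le> 1 * Q ^ D" using Q_pos by (simp add: power_increasing Suc_leI)
  also have "1 * Q ^ D \<le> (M + 1) * (2 ^ blen) ^ 2 * Q ^ D"
    by (rule mult_le_mono1) (simp add: Suc_le_eq)
  finally show ?thesis by (simp only: H_def)
qed

lemma less_lim:
  assumes "lim < 2 ^ w"
  shows "x \<le> J * (H + 1) \<Longrightarrow> x < 2 ^ w" "x \<le> Z + 10 \<Longrightarrow> x < 2 ^ w" "x \<le> B ^ (G + 1) \<Longrightarrow> x < 2 ^ w"
    "x \<le> 4 * (J * (H + 1)) + 10 \<Longrightarrow> x < 2 ^ w" "x \<le> 2 * n + 10 \<Longrightarrow> x < 2 ^ w"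
  using assms unfolding lim_def by linarith+

lemma wp_prep:
  assumes at: "at_ladder j \<sigma>" and j: "j < J" and lim: "lim < 2 ^ w"
  shows "wp w (prep D P) (\<lambda>t \<tau>. t \<le> 6 * P + 12 \<and> in_ladder j (reg \<tau>) \<and> reg \<tau> 12 = j \<and>
    reg \<tau> 13 = caddr (stage j - 1) \<and> wr (reg \<tau>) (ladders j) \<tau>) \<sigma>"
proof -
  note ll = less_lim[OF lim]
  have \<sigma>: "reg \<sigma> 12 = j" "reg \<sigma> 8 = B" "reg \<sigma> 5 = Q" "reg \<sigma> 9 = 4 * (H + 1)"
    using at by (auto simp: at_ladder_def params_def)
  have blk: "blk j < P" using P_pos by simp
  then have g: "grp (blk j) < G" by (simp add: P_def less_mult_imp_div_less)
  have d: "dig (blk j) < D" using GD by simp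
  have B: "0 < B" by (simp add: B_def)
  have "B ^ grp (blk j) \<le> B ^ (G + 1)" using g B by (intro power_increasing) auto
  note b1 = ll(3)[OF this]
  have J1: "J \<le> J * (H + 1)" "H \<le> J * (H + 1)" by (rule JH)+
  have st: "stage j \<le> j" by (rule div_le_dividend)
  have bb: "blk j < 2 ^ w" "grp (blk j) < 2 ^ w" "dig (blk j) < 2 ^ w" "stage j < 2 ^ w" "1 < (2::nat) ^ w" "Q ^ dig (blk j) < 2 ^ w"
    using blk g d st j P_le_J DP J1 Q_pow_le[of "dig (blk j)"] by (intro ll(1); linarith)+
  have v1: "j * (4 * (H + 1)) = vx j 0 0" by (simp add: vx_def algebra_simps)
  have v2: "vx j 0 0 < 2 ^ w" by (rule ll(4)) (use vx_less[OF j, of 0] in linarith)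
  note v = v1 v2
  have p2: "wp w (pow 16 5 (Reg 28) 27) post \<tau>"
    if "reg \<tau> 5 = Q" "reg \<tau> 28 = dig (blk j)" "\<And>t. t \<le> 3 * P + 3 \<Longrightarrow> post t (\<tau>\<lparr>reg := (reg \<tau>)(27 := 0, 16 := Q ^ dig (blk j))\<rparr>)" for \<tau> post
    by (rule wp_pow[where x = Q and n = "dig (blk j)"]) (use that bb Q_pos d DP in auto)
  have p1: "wp w (pow 15 8 (Reg 28) 27) post \<tau>"
    if "reg \<tau> 8 = B" "reg \<tau> 28 = grp (blk j)" "\<And>t. t \<le> 3 * P + 3 \<Longrightarrow> post t (\<tau>\<lparr>reg := (reg \<tau>)(27 := 0, 15 := B ^ grp (blk j))\<rparr>)" for \<tau> post
    by (rule wp_pow[where x = B and n = "grp (blk j)"]) (use that bb b1 B g DP in auto)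
  show ?thesis
    unfolding prep_def
    apply (simp add: \<sigma> bb)
    apply (rule p1; simp add: \<sigma> bb)
    apply (rule p2; simp add: \<sigma> bb v[simplified])
    using at apply (auto simp: in_ladder_def at_ladder_def params_def wgt_def writing_def)
    done
qed

lemma wp_advance:
  assumes R: "in_ladder j R" "R 12 = j" "R 13 = caddr (stage j - 1)" and j: "j < J"
    and wr: "wr R (ladders (Suc j)) \<sigma>" and lim: "lim < 2 ^ w"
  shows "wp w (advance P) (\<lambda>t \<tau>. t \<le> 8 \<and> at_ladder (Suc j) \<tau>) \<sigma>"
proof -
  note ll = less_lim[OF lim]
  have \<sigma>: "reg \<sigma> 12 = j" "reg \<sigma> 13 = caddr (stage j - 1)" "reg \<sigma> 17 = stage j" "reg \<sigma> 18 = blk j" "params (reg \<sigma>)"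
    using R wr by (auto simp: writing_def temps_def in_ladder_def params_def)
  have blk: "blk j < P" using P_pos by simp
  have b: "Suc (blk j) < 2 ^ w" "Suc j < 2 ^ w" using blk j P_le_J JH(2) by (intro ll(1); linarith)+
  have fin: "at_ladder (Suc j) \<tau>"
    if "mem \<tau> = mem \<sigma>" "reg \<tau> 12 = Suc j" "reg \<tau> 13 = caddr (stage (Suc j) - 1)" "\<forall>r. r \<notin> {12, 13, 20} \<longrightarrow> reg \<tau> r = reg \<sigma> r" for \<tau>
    using that \<sigma>(5) wr by (auto simp: at_ladder_def params_def writing_def)
  show ?thesis
  proof (cases "blk j = P - 1 \<and> stage j \<noteq> 0")
    case True
    define i where "i = stage j - 1"
    have "stage j \<le> M" using j by (simp add: J_def less_mult_imp_div_less flip: less_Suc_eq_le)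
    then have i: "i < M" "stage j = Suc i" using True unfolding i_def by linarith+
    have next_clause: "caddr (stage (Suc j) - 1) = Suc (caddr i + length (Cs ! i))"
      using True P_pos i by (simp add: stage_Suc caddr_Suc)
    have m: "mem \<sigma> (caddr i) = length (Cs ! i)" and c: "caddr i + length (Cs ! i) < Z"
      using wr M0_clause(1,3)[OF i(1)] by (simp_all add: writing_def outm_below)
    then have bc: "caddr i < 2 ^ w" "length (Cs ! i) < 2 ^ w" "caddr i + length (Cs ! i) < 2 ^ w" "Suc (caddr i + length (Cs ! i)) < 2 ^ w"
      by (intro ll(2); linarith)+
    have "Suc (blk j) = P" using True P_pos by simp
    then show ?thesis unfolding advance_def using True b bc i
      by (simp add: \<sigma> m) (rule fin, simp_all add: next_clause[unfolded One_nat_def])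
  next
    case False
    have same: "caddr (stage (Suc j) - 1) = caddr (stage j - 1)"
      using False P_pos by (auto simp: stage_Suc)
    show ?thesis
    proof (cases "Suc (blk j) = P")
      case True
      then have "stage j = 0" using False by auto
      with True b show ?thesis unfolding advance_def
        by (simp add: \<sigma>) (rule fin, use same \<sigma> in simp_all)
    next
      case neq: False
      with b show ?thesis unfolding advance_def
        by (simp add: \<sigma>) (rule fin, use same \<sigma> in simp_all)
    qed
  qed
qed

definition ladder_time :: nat where
  "ladder_time = (H + 1) * (13 * k + 6 * P + 150)"

lemma wp_loop:
  assumes at: "at_ladder 0 \<sigma>" and lim: "lim < 2 ^ w"
  shows "wp w (While (Less (Reg 12) (Reg 10)) (loop_body D P))
    (\<lambda>t \<tau>. t \<le> J * (ladder_time + 1) + 1 \<and> at_ladder J \<tau>) \<sigma>"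
proof (rule wp_While[where I = at_ladder and n = J and T = ladder_time])
  fix j \<tau> assume j: "j < J" and inv: "at_ladder j \<tau>"
  have le: "(6 * P + 12) + ((H * 45 + 2 ^ blen * (13 * k + 50) + 30) + 8) \<le> ladder_time"
  proof -
    have "2 ^ blen * (13 * k + 50) \<le> H * (13 * k + 50)" using q_le_H by (rule mult_le_mono1)
    then show ?thesis unfolding ladder_time_def by (simp add: algebra_simps)
  qed
  have "wp w (loop_body D P) (\<lambda>t \<tau>'. t \<le> ladder_time \<and> at_ladder (Suc j) \<tau>') \<tau>"
    unfolding loop_body_def
  proof (rule wp_SeqT[OF wp_prep[OF inv j lim] _ le], elim conjE)
    fix \<tau>1 assume \<tau>1: "in_ladder j (reg \<tau>1)" "reg \<tau>1 12 = j" "reg \<tau>1 13 = caddr (stage j - 1)" "wr (reg \<tau>1) (ladders j) \<tau>1"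
    show "wp w (ladder_prog P ;; advance P) (\<lambda>u \<tau>'. u \<le> (H * 45 + 2 ^ blen * (13 * k + 50) + 30) + 8 \<and> at_ladder (Suc j) \<tau>') \<tau>1"
      by (rule wp_SeqT[OF wp_ladder[OF \<tau>1(1) j \<tau>1(4) lim] wp_advance[OF \<tau>1(1-3) j _ lim]]) simp_all
  qed
  then show "holds \<tau> (Less (Reg 12) (Reg 10)) \<and> wp w (loop_body D P) (\<lambda>t \<tau>'. t \<le> ladder_time \<and> at_ladder (Suc j) \<tau>') \<tau>"
    using inv j by (simp add: at_ladder_def params_def)
qed (use at in \<open>auto simp: at_ladder_def params_def\<close>)

lemma wp_setup:
  fixes \<sigma> :: state
  assumes \<sigma>: "reg \<sigma> 1 = n" "reg \<sigma> 2 = M" "mem \<sigma> = M0" and lim: "lim < 2 ^ w"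
  shows "wp w (setup_bases D P ;; setup_pointers k) (\<lambda>t \<tau>. t \<le> 3 * P + 30 \<and> at_ladder 0 \<tau>) \<sigma>"
proof -
  note ll = less_lim[OF lim]
  have J: "J \<le> J * (H + 1)" "H \<le> J * (H + 1)" by (rule JH)+
  have b0: "n div P < 2 ^ w" by (rule ll(5)) (simp add: div_le_dividend trans_le_add1 le_trans[OF div_le_dividend])
  have "blen < 2 ^ blen" by (rule less_exp)
  then have b1: "blen < 2 ^ w" "2 ^ blen < (2::nat) ^ w" using q_le_H J by (intro ll(1); linarith)+
  have M1: "Suc M \<le> J" using mult_le_mono2[OF DP(3), of "M + 1"] by (simp add: J_def)
  then have b2: "Suc M < 2 ^ w" "Suc 0 < 2 ^ w" "M < 2 ^ w" using J by (intro ll(1); linarith)+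
  have Q1: "Q ^ 1 \<le> H" "Q ^ D \<le> H" using GD by (intro Q_pow_le; simp)+
  then have b3: "Q < 2 ^ w" "Q ^ D < 2 ^ w" "D < 2 ^ w" using J DP P_le_J by (intro ll(1); simp)+
  have qd: "1 \<le> Q ^ D" using Q_pos by simp
  define x where "x = (2::nat) ^ blen"
  have H: "H = Suc M * x * x * Q ^ D" by (simp add: H_def x_def power2_eq_square algebra_simps)
  have "Suc M * x * x * 1 \<le> H" unfolding H using qd by (rule mult_le_mono2)
  moreover have "Suc M * x * 1 \<le> Suc M * x * x" by (rule mult_le_mono2) (simp add: x_def)
  ultimately have b4: "Suc M * x < 2 ^ w" "Suc M * x * x < 2 ^ w" "H < 2 ^ w" using J by (intro ll(1); linarith)+
  have BB: "B \<le> B ^ (G + 1)" by (rule self_le_power) (simp_all add: B_def)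
  have B: "Suc (Suc M * D * H) = B" by (simp add: B_def)
  have "Suc M * D * 1 \<le> Suc M * D * H" using H_pos by (intro mult_le_mono2) (simp add: Suc_leI)
  then have b5: "Suc M * D < 2 ^ w" "Suc M * D * H < 2 ^ w" "Suc (Suc M * D * H) < 2 ^ w"
    using BB B by (intro ll(3); linarith)+
  have b6: "Suc H < 2 ^ w" "Suc H * 4 < 2 ^ w" "Suc M * P < 2 ^ w"
  proof -
    show "Suc H * 4 < 2 ^ w" using J by (intro ll(4)) simp
    then show "Suc H < 2 ^ w" by simp
    show "Suc M * P < 2 ^ w" using J by (intro ll(1)) (simp add: J_def)
  qed
  have b7: "M * Suc k < 2 ^ w" "2 + M * Suc k < 2 ^ w" "8 + M * Suc k < 2 ^ w" "2 < (2::nat) ^ w"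
    by (intro ll(2); simp add: Z_def)+
  then have b8: "B < 2 ^ w" "Suc (Suc (M * Suc k)) < 2 ^ w" "Suc (7 * Suc 0 + M * Suc k) < 2 ^ w"
    using b5(3) B by simp_all
  have Qx: "Suc M * x = Q" by (simp add: Q_def x_def)
  have p: "wp w (pow 6 5 (Imm D) 27) post \<tau>"
    if "reg \<tau> 5 = Q" "\<And>t. t \<le> 3 * P + 3 \<Longrightarrow> post t (\<tau>\<lparr>reg := (reg \<tau>)(27 := 0, 6 := Q ^ D)\<rparr>)" for \<tau> post
    by (rule wp_pow[where x = Q and n = D]) (use that b2 b3 Q_pos DP in auto)
  have bl: "Suc (n div P) = blen" by (simp add: blen_def P_def)
  have fin: "at_ladder 0 \<tau>" if "params (reg \<tau>)" "reg \<tau> 12 = 0" "reg \<tau> 13 = 2" "reg \<tau> 11 = Z + 6" "mem \<tau> = mem \<sigma>" for \<tau>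
    using that \<sigma>(3) by (simp add: at_ladder_def writing_def ladders_def outm_Nil caddr_0)
  show ?thesis
    unfolding setup_bases_def setup_pointers_def
    apply (simp add: \<sigma>(1,2)[simplified] b0 bl b1 b2 Qx[unfolded x_def] b3 del: mult_Suc mult_Suc_right)
    apply (rule p)
     apply simp
    apply (simp add: \<sigma>(1,2)[simplified] b1 b2 b3 Qx[unfolded x_def] b4[unfolded Qx, unfolded x_def]
        H[unfolded Qx, unfolded x_def, symmetric] b5 b6 b7 b8 B del: mult_Suc mult_Suc_right)
    apply (rule fin)
        apply (simp_all add: params_def J_def Z_def \<sigma>(1,2)[simplified])
    done
qed

end

section \<open>The header, and moving the output to address 0\<close>

lemma wp_written:
  "wp w c Q \<sigma> \<Longrightarrow> wp w c (\<lambda>t \<tau>. Q t \<tau> \<and> (\<forall>r. r \<notin> written c \<longrightarrow> reg \<tau> r = reg \<sigma> r)) \<sigma>"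
  using run_written by (fastforce simp: wp_def)

text \<open>The number of edges depends on the formula and is known only from the final write
  pointer, so the header is filled in last, in the six words kept free at \<open>Z\<close>.\<close>

definition header_shape :: com where
  "header_shape =
    Op 20 Mul (Reg 10) (Reg 9) ;; Op 21 Add (Reg 20) (Imm 1) ;; Store (Reg 29) (Reg 21) ;;
    Op 22 Add (Reg 29) (Imm 6) ;; Op 22 Sub (Reg 11) (Reg 22) ;; Op 22 Div (Reg 22) (Imm 4) ;;
    Op 23 Add (Reg 29) (Imm 1) ;; Store (Reg 23) (Reg 22) ;; incr 23 (Imm 1) ;; Store (Reg 23) (Imm 0) ;;
    incr 23 (Imm 1) ;; Store (Reg 23) (Reg 20) ;; incr 23 (Imm 1)"

text \<open>Register 24 holds \<open>B ^ G\<close> on entry, and the geometric sum is obtained as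
  \<open>(B ^ G - 1) div (B - 1)\<close>.\<close>

definition header_budgets :: "nat \<Rightarrow> com" where
  "header_budgets d =
    Op 24 Sub (Reg 24) (Imm 1) ;; Op 25 Sub (Reg 8) (Imm 1) ;; Op 24 Div (Reg 24) (Reg 25) ;;
    Op 25 Mul (Reg 7) (Imm d) ;; Op 24 Mul (Reg 24) (Reg 25) ;; Store (Reg 23) (Reg 24) ;;
    incr 23 (Imm 1) ;; Op 24 Mul (Reg 24) (Reg 2) ;; Store (Reg 23) (Reg 24)"

definition copy_body :: com where
  "copy_body = Load 20 (Reg 13) ;; Store (Reg 12) (Reg 20) ;; incr 12 (Imm 1) ;; incr 13 (Imm 1)"

definition wipe_body :: com where
  "wipe_body = Store (Reg 12) (Imm 0) ;; incr 12 (Imm 1)"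

definition copy_prog :: com where
  "copy_prog = mov 12 (Imm 0) ;; mov 13 (Reg 29) ;; While (Less (Reg 13) (Reg 11)) copy_body ;;
    While (Less (Reg 12) (Reg 11)) wipe_body"

primrec clear :: "nat \<Rightarrow> com" where
  "clear 0 = Skip"
| "clear (Suc r) = mov r (Imm 0) ;; clear r"

lemma wp_clear: "wp w (clear r) (\<lambda>t \<tau>. t = r + 1 \<and> \<tau> = \<sigma>\<lparr>reg := \<lambda>i. if i < r then 0 else reg \<sigma> i\<rparr>) \<sigma>"
proof (induction r arbitrary: \<sigma>)
  case (Suc r)
  have "wp w (mov r (Imm 0)) (\<lambda>t \<tau>. t = 1 \<and> \<tau> = \<sigma>\<lparr>reg := (reg \<sigma>)(r := 0)\<rparr>) \<sigma>" by simp
  then show ?case unfolding clear.simps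
    by (rule wp_SeqI, elim conjE) (rule wp_mono[OF Suc.IH], auto simp: fun_eq_iff)
qed simp

text \<open>The source lies above the destination, so an ascending copy never overwrites a word that
  is still to be read. Wiping \<open>z\<close> further words removes the rest of the original
  output.\<close>

lemma wp_copy:
  fixes \<sigma> :: state
  assumes \<sigma>: "reg \<sigma> 29 = z" "reg \<sigma> 11 = z + l" "mem \<sigma> = m" and z: "0 < z" "z + l < 2 ^ w"
    and v: "\<And>i. i < l \<Longrightarrow> m (z + i) < 2 ^ w"
  shows "wp w copy_prog (\<lambda>t \<tau>. t \<le> 5 * l + 3 * z + 4 \<and>
    mem \<tau> = (\<lambda>a. if a < l then m (z + a) else if a < z + l then 0 else m a)) \<sigma>"
proof -
  define I where "I i \<tau> \<longleftrightarrow> reg \<tau> 11 = z + l \<and> reg \<tau> 12 = i \<and> reg \<tau> 13 = z + i \<and>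
    mem \<tau> = (\<lambda>a. if a < i then m (z + a) else m a)" for i and \<tau> :: state
  define K where "K i \<tau> \<longleftrightarrow> reg \<tau> 11 = z + l \<and> reg \<tau> 12 = l + i \<and>
    mem \<tau> = (\<lambda>a. if a < l then m (z + a) else if a < l + i then 0 else m a)" for i and \<tau> :: state
  have 1: "wp w (While (Less (Reg 13) (Reg 11)) copy_body) (\<lambda>t \<tau>'. t \<le> 5 * l + 1 \<and> I l \<tau>') \<tau>" if "I 0 \<tau>" for \<tau>
  proof (rule wp_While[where I = I and n = l and T = 4])
    fix i \<tau> assume i: "i < l" "I i \<tau>"
    have \<tau>: "reg \<tau> 11 = z + l" "reg \<tau> 12 = i" "reg \<tau> 13 = z + i" "mem \<tau> (z + i) = m (z + i)"
      using i z by (simp_all add: I_def)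
    have b: "z + i < 2 ^ w" "Suc (z + i) < 2 ^ w" "i < 2 ^ w" "Suc i < 2 ^ w" "m (z + i) < 2 ^ w" using i z v by simp_all
    have "(mem \<tau>)(i := m (z + i)) = (\<lambda>a. if a < Suc i then m (z + a) else m a)"
      using i by (auto simp: I_def fun_eq_iff less_Suc_eq)
    then show "holds \<tau> (Less (Reg 13) (Reg 11)) \<and> wp w copy_body (\<lambda>t \<tau>'. t \<le> 4 \<and> I (Suc i) \<tau>') \<tau>"
      unfolding copy_body_def using i(1) by (simp add: \<tau> b) (simp add: I_def \<tau>)
  qed (use that in \<open>auto simp: I_def\<close>)
  have 2: "wp w (While (Less (Reg 12) (Reg 11)) wipe_body) (\<lambda>t \<tau>'. t \<le> 3 * z + 1 \<and> K z \<tau>') \<tau>" if "I l \<tau>" for \<tau>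
  proof (rule wp_While[where I = K and n = z and T = 2])
    fix i \<tau> assume i: "i < z" "K i \<tau>"
    have \<tau>: "reg \<tau> 11 = z + l" "reg \<tau> 12 = l + i" using i by (simp_all add: K_def)
    have b: "l + i < 2 ^ w" "Suc (l + i) < 2 ^ w" "0 < (2::nat) ^ w" using i z by simp_all
    have "(mem \<tau>)(l + i := 0) = (\<lambda>a. if a < l then m (z + a) else if a < l + Suc i then 0 else m a)"
      using i by (auto simp: K_def fun_eq_iff less_Suc_eq)
    then show "holds \<tau> (Less (Reg 12) (Reg 11)) \<and> wp w wipe_body (\<lambda>t \<tau>'. t \<le> 2 \<and> K (Suc i) \<tau>') \<tau>"
      unfolding wipe_body_def using i(1) by (simp add: \<tau> b) (simp add: K_def \<tau>)
  qed (use that in \<open>auto simp: I_def K_def\<close>)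
  have 3: "wp w (mov 13 (Reg 29)) (\<lambda>t \<tau>. t \<le> 1 \<and> I 0 \<tau>) (\<sigma>\<lparr>reg := (reg \<sigma>)(12 := 0)\<rparr>)"
    using \<sigma> z by (simp add: I_def)
  have 0: "wp w (mov 12 (Imm 0)) (\<lambda>t \<tau>. t \<le> 1 \<and> \<tau> = \<sigma>\<lparr>reg := (reg \<sigma>)(12 := 0)\<rparr>) \<sigma>" by simp
  have "wp w copy_prog (\<lambda>t \<tau>. t \<le> 5 * l + 3 * z + 4 \<and> K z \<tau>) \<sigma>"
    unfolding copy_prog_def
  proof (rule wp_SeqT[OF 0, where b = "5 * l + 3 * z + 3"])
    fix \<tau> assume "\<tau> = \<sigma>\<lparr>reg := (reg \<sigma>)(12 := 0)\<rparr>"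
    then show "wp w (mov 13 (Reg 29) ;; While (Less (Reg 13) (Reg 11)) copy_body ;; While (Less (Reg 12) (Reg 11)) wipe_body)
        (\<lambda>t \<tau>. t \<le> 5 * l + 3 * z + 3 \<and> K z \<tau>) \<tau>"
      by (simp only:) (rule wp_SeqT[OF 3 wp_SeqT[OF 1 2 order_refl]], assumption, assumption, simp)
  qed simp
  then show ?thesis by (rule wp_mono) (auto simp: K_def fun_eq_iff)
qed

definition reduce_body :: "nat \<Rightarrow> nat \<Rightarrow> nat \<Rightarrow> com" where
  "reduce_body g d k =
    (setup_bases d (g * d) ;; setup_pointers k) ;;
    (mov 0 (Imm 0) ;; While (Less (Reg 12) (Reg 10)) (loop_body d (g * d))) ;;
    (header_shape ;; pow 24 8 (Imm g) 27 ;; header_budgets d) ;; copy_prog"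

lemma written_emits: "written (emits es) \<subseteq> {11, 21}"
  by (induction es) (auto simp: emits.simps emit_def split: prod.splits)

lemma written_reduce_body: "r \<in> written (reduce_body g d k) \<Longrightarrow> r < 30"
  using written_emits
  by (auto simp: reduce_body_def setup_bases_def setup_pointers_def loop_body_def prep_def ladder_prog_def advance_def
      header_shape_def header_budgets_def copy_prog_def copy_body_def wipe_body_def pow_def pow_body_def rail_body_def
      rail_vertex_def rung_body_def rung_vertex_def link_prog_def sat_prog_def lit_body_def dest!: subsetD[OF written_emits])

context ksat_reduction
begin

definition output_list :: "nat list" where
  "output_list = [vx J 0 0 + 1, length (ladders J), 0, vx J 0 0, Lbud, Cbud] @ flat (ladders J)"

lemma length_output_list: "length output_list = 6 + 4 * length (ladders J)"
  by (simp add: output_list_def)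

definition placed :: "nat \<Rightarrow> nat" where
  "placed a = (if Z \<le> a \<and> a < Z + length output_list then output_list ! (a - Z) else M0 a)"

lemma geo_eq: "(B ^ G - 1) div (B - 1) = geo"
proof -
  have B: "1 < B" using GD H_pos by (simp add: B_def)
  have "geo * (B - 1) = B ^ G - 1"
  proof -
    have "(\<Sum>g<k. B ^ g) * (B - 1) + 1 = B ^ k" for k
    proof (induction k)
      case (Suc k)
      have "(\<Sum>g<Suc k. B ^ g) * (B - 1) + 1 = B ^ k + B ^ k * (B - 1)" using Suc by (simp add: algebra_simps)
      also have "\<dots> = B ^ k * (1 + (B - 1))" by (simp only: distrib_left mult_1_right)
      also have "1 + (B - 1) = B" using B by simp
      finally show ?case by (simp add: mult.commute)
    qed simp
    from this[of G] show ?thesis unfolding geo_def by linarith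
  qed
  then show ?thesis using B by (metis nonzero_mult_div_cancel_right zero_less_diff not_gr0)
qed

lemma budgets_le: "Lbud \<le> B ^ (G + 1)" "Cbud \<le> B ^ (G + 1)" "geo \<le> B ^ (G + 1)" "D * H \<le> B ^ (G + 1)"
proof -
  have "geo \<le> B ^ G" unfolding geo_eq[symmetric] by (rule le_trans[OF div_le_dividend]) simp
  moreover have "(M * (D * H)) \<le> B" by (simp add: B_def algebra_simps)
  ultimately have "Cbud \<le> B * B ^ G" unfolding Cbud_def by (rule mult_le_mono[rotated])
  then show C: "Cbud \<le> B ^ (G + 1)" by simp
  have "1 * (D * H) * geo \<le> M * (D * H) * geo" using pos(4) by (intro mult_le_mono1) simp
  with C show "Lbud \<le> B ^ (G + 1)" unfolding Lbud_def Cbud_def by linarith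
  have "D * H * 1 \<le> B * B ^ G" by (rule mult_le_mono) (simp_all add: B_def algebra_simps Suc_leI)
  then show "D * H \<le> B ^ (G + 1)" by simp
  have "B ^ G \<le> B ^ (G + 1)" by (simp add: B_def)
  with \<open>geo \<le> B ^ G\<close> show "geo \<le> B ^ (G + 1)" by linarith
qed

lemma wp_header:
  assumes at: "at_ladder J \<sigma>" and lim: "lim < 2 ^ w"
  shows "wp w (header_shape ;; pow 24 8 (Imm G) 27 ;; header_budgets D)
    (\<lambda>t \<tau>. t \<le> 3 * P + 30 \<and> reg \<tau> 29 = Z \<and> reg \<tau> 11 = Z + length output_list \<and> mem \<tau> = placed) \<sigma>"
proof -
  note ll = less_lim[OF lim]
  define m where "m = length (ladders J)"
  have \<sigma>: "reg \<sigma> 2 = M" "reg \<sigma> 7 = H" "reg \<sigma> 8 = B" "reg \<sigma> 9 = 4 * (H + 1)" "reg \<sigma> 10 = J" "reg \<sigma> 29 = Z"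
    "reg \<sigma> 11 = Z + 6 + 4 * m" "mem \<sigma> = outm M0 (Z + 6) (ladders J)"
    using at by (auto simp: at_ladder_def params_def writing_def m_def)
  have t: "J * (4 * (H + 1)) = vx J 0 0" "vx J 0 0 = 4 * (J * (H + 1))" by (simp_all add: vx_def algebra_simps)
  have bt: "vx J 0 0 < 2 ^ w" "Suc (vx J 0 0) < 2 ^ w" unfolding t(2) by (intro ll(4); simp)+
  have m: "m \<le> 9 * (J * (H + 1))" unfolding m_def by (rule length_ladders)
  have bz: "Z < 2 ^ w" "Suc Z < 2 ^ w" "Suc (Suc Z) < 2 ^ w" "Suc (Suc (Suc Z)) < 2 ^ w" "Suc (Suc (Suc (Suc Z))) < 2 ^ w"
    "Suc (Suc (Suc (Suc (Suc Z)))) < 2 ^ w" "6 + Z < 2 ^ w" "Z + 6 < 2 ^ w" "0 < (2::nat) ^ w"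
    by (intro ll(2); simp)+
  have bm: "4 * m < 2 ^ w" "m < 2 ^ w" using m lim unfolding lim_def by linarith+
  have p: "Z + 6 + 4 * m - (6 + Z) = 4 * m" by simp
  have pw: "wp w (pow 24 8 (Imm G) 27) post \<tau>"
    if "reg \<tau> 8 = B" "\<And>t. t \<le> 3 * P + 3 \<Longrightarrow> post t (\<tau>\<lparr>reg := (reg \<tau>)(27 := 0, 24 := B ^ G)\<rparr>)" for \<tau> post
  proof (rule wp_pow[where x = B and n = G])
    show "B ^ G < 2 ^ w" by (rule ll(3)) (simp add: B_def)
    show "G < 2 ^ w" using DP(2) P_le_J JH(2) by (intro ll(1)) linarith
  qed (use that bz DP in \<open>auto simp: B_def\<close>)
  have "B - 1 \<le> B ^ (G + 1)"
    using self_le_power[of B "G + 1"] by (simp add: B_def)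
  then have bb: "B ^ G - Suc 0 < 2 ^ w" "B - Suc 0 < 2 ^ w" "geo < 2 ^ w" "H * D < 2 ^ w" "geo * (H * D) < 2 ^ w" "geo * (H * D) * M < 2 ^ w"
    using budgets_le by (auto intro!: ll(3) simp: Lbud_def Cbud_def mult_ac B_def)
  have g: "(B ^ G - Suc 0) div (B - Suc 0) = geo" using geo_eq by simp
  have out: "(outm M0 (Z + 6) (ladders J))(Z := Suc (vx J 0 0), Suc Z := m, Suc (Suc Z) := 0, Suc (Suc (Suc Z)) := vx J 0 0,
      Suc (Suc (Suc (Suc Z))) := geo * (H * D), Suc (Suc (Suc (Suc (Suc Z)))) := geo * (H * D) * M) = placed" (is "?m = _")
  proof
    fix a
    consider "a < Z" | "a = Z" | "a = Z + 1" | "a = Z + 2" | "a = Z + 3" | "a = Z + 4" | "a = Z + 5" | "Z + 6 \<le> a" by linarith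
    then show "?m a = placed a"
    proof cases
      case 8
      define b where "b = a - (Z + 6)"
      have "a = Z + 6 + b" using 8 by (simp add: b_def)
      then show ?thesis by (simp add: placed_def outm_def output_list_def m_def nth_append)
    qed (simp_all add: placed_def outm_def output_list_def m_def Lbud_def Cbud_def mult_ac)
  qed
  show ?thesis
    unfolding header_shape_def header_budgets_def
    apply (simp add: \<sigma>[simplified] t(1)[simplified] bt bz p bm m_def[symmetric])
    apply (rule pw)
     apply (simp add: \<sigma>)
    apply (simp add: \<sigma> bz bb g out)
    apply (simp add: length_output_list m_def)
    done
qed

lemma output_list_less:
  assumes lim: "lim < 2 ^ w" and i: "i < length output_list"
  shows "output_list ! i < 2 ^ w"
proof -
  note ll = less_lim[OF lim]
  have t: "vx J 0 0 = 4 * (J * (H + 1))" by (simp add: vx_def)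
  have w: "x < 2 ^ w" if "x \<in> insert 0 ((\<lambda>g. B ^ g) ` {..<G})" for x
  proof -
    have "B ^ g \<le> B ^ (G + 1)" if "g < G" for g using that by (intro power_increasing) (auto simp: B_def)
    then show ?thesis using that by (intro ll(3)) auto
  qed
  have "x < 2 ^ w" if "x \<in> set output_list" for x
  proof -
    from that consider "x \<in> {vx J 0 0 + 1, 0, vx J 0 0}" | "x = length (ladders J)" | "x \<in> {Lbud, Cbud}"
      | e where "e \<in> set (ladders J)" "x \<in> set (quad_list e)"
      by (auto simp: output_list_def flat_def)
    then show ?thesis
    proof cases
      case 1
      then show ?thesis by (intro ll(4)) (auto simp: t)
    next
      case 2
      then show ?thesis using length_ladders[of J] lim unfolding lim_def by linarith
    next
      case 3
      then show ?thesis using budgets_le by (intro ll(3)) auto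
    next
      case 4
      then obtain j where j: "j < J" "is_edge j e" by (auto simp: set_ladders)
      note b = is_edge_bounds[OF j(2,1)]
      from 4(2) consider "x = esrc e" | "x = edst e" | "x = elen e" | "x = ecost e" by (auto simp: quad_list_def)
      then show ?thesis
      proof cases
        case 1 then show ?thesis using b(1) by (intro ll(4)) (simp add: t)
      next
        case 2 then show ?thesis using b(2) by (intro ll(4)) (simp add: t)
      next
        case 3 then show ?thesis using w[OF b(3)] by simp
      next
        case 4 then show ?thesis using w[OF b(4)] by simp
      qed
    qed
  qed
  then show ?thesis using i nth_mem by blast
qed

definition reduce_time :: nat where
  "reduce_time = J * (ladder_time + 1) + 5 * length output_list + 3 * Z + 6 * P + 100"

text \<open>The final state is literally the initial state for the new input, so any run of the
  assumed algorithm can be appended.\<close>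

lemma wp_reduce_body:
  fixes \<sigma> :: state
  assumes \<sigma>: "reg \<sigma> 1 = n" "reg \<sigma> 2 = M" "mem \<sigma> = M0" "\<And>r. 30 \<le> r \<Longrightarrow> reg \<sigma> r = 0" and lim: "lim < 2 ^ w"
  shows "wp w (reduce_body G D k ;; clear 30) (\<lambda>t \<tau>. t \<le> reduce_time \<and> \<tau> = initial output_list) \<sigma>"
proof -
  have P: "G * D = P" by (simp add: P_def)
  have len: "Z + length output_list < 2 ^ w"
    using length_ladders[of J] lim unfolding length_output_list lim_def by linarith
  have Z: "0 < Z" by (simp add: Z_def)
  have m: "(\<lambda>a. if a < length output_list then placed (Z + a) else if a < Z + length output_list then 0 else placed a) = mem (initial output_list)"
  proof
    fix a
    \<comment> \<open>The formula ends before \<open>Z\<close>, so nothing of it survives behind the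
      copied output.\<close>
    have "M0 a = 0" if "Z \<le> a" using that input_le by (simp add: M0_def initial_def)
    then show "(if a < length output_list then placed (Z + a) else if a < Z + length output_list then 0 else placed a) = mem (initial output_list) a"
      by (auto simp: placed_def initial_def)
  qed
  have z: "wp w (mov 0 (Imm 0)) (\<lambda>t \<tau>'. t \<le> 1 \<and> at_ladder 0 \<tau>') \<tau>" if "at_ladder 0 \<tau>" for \<tau>
    using that by (simp add: at_ladder_def params_def writing_def)
  have copy: "wp w copy_prog (\<lambda>t \<tau>'. t \<le> 5 * length output_list + 3 * Z + 4 \<and> mem \<tau>' = mem (initial output_list)) \<tau>"
    if "reg \<tau> 29 = Z \<and> reg \<tau> 11 = Z + length output_list \<and> mem \<tau> = placed" for \<tau>
    unfolding m[symmetric] using that Z len output_list_less[OF lim]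
    by (intro wp_copy) (auto simp: placed_def)
  have lp: "wp w (mov 0 (Imm 0) ;; While (Less (Reg 12) (Reg 10)) (loop_body D P))
      (\<lambda>t \<tau>'. t \<le> J * (ladder_time + 1) + 2 \<and> at_ladder J \<tau>') \<tau>" if "at_ladder 0 \<tau>" for \<tau>
    by (rule wp_SeqT[OF z[OF that] wp_loop[OF _ lim]]) simp_all
  have "wp w (reduce_body G D k) (\<lambda>t \<tau>. t \<le> reduce_time - 31 \<and> mem \<tau> = mem (initial output_list)) \<sigma>"
    unfolding reduce_body_def P
    by (rule wp_SeqT[OF wp_setup[OF \<sigma>(1-3) lim] wp_SeqT[OF lp wp_SeqT[OF wp_header[OF _ lim] copy order_refl] order_refl]])
      (simp_all add: reduce_time_def)
  from wp_written[OF this] show ?thesis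
  proof (rule wp_SeqI, elim conjE)
    fix t :: nat and \<tau> :: state assume \<tau>: "t \<le> reduce_time - 31" "mem \<tau> = mem (initial output_list)"
      "\<forall>r. r \<notin> written (reduce_body G D k) \<longrightarrow> reg \<tau> r = reg \<sigma> r"
    \<comment> \<open>The reduction writes only to registers below 30, which \<open>clear\<close>
      resets.\<close>
    have "reg \<tau> r = 0" if "30 \<le> r" for r
      using \<tau>(3) written_reduce_body[of r G D k] \<sigma>(4)[OF that] that by fastforce
    then have "\<tau>\<lparr>reg := \<lambda>i. if i < 30 then 0 else reg \<tau> i\<rparr> = initial output_list"
      using \<tau>(2) by (auto simp: initial_def fun_eq_iff intro!: state.equality)
    then show "wp w (clear 30) (\<lambda>t'. (\<lambda>t \<tau>. t \<le> reduce_time \<and> \<tau> = initial output_list) (t + t')) \<tau>"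
      using \<tau>(1) by (intro wp_mono[OF wp_clear]) (auto simp: reduce_time_def)
  qed
qed

end

section \<open>Two weights: an adversary argument\<close>

text \<open>On a path with budgets 0 every edge length matters, and a fast algorithm has no time to look at all of them.\<close>

definition path_edges :: "nat \<Rightarrow> nat \<Rightarrow> wedge list" where
  "path_edges m x = map (\<lambda>i. (i, Suc i, of_bool (i = x), 0)) [0..<m]"

text \<open>Only edge \<open>x\<close> has length 1. For \<open>x = m\<close> there is no such edge,
  which gives the yes-instance with which the others are compared.\<close>

definition path_instance :: "nat \<Rightarrow> nat \<Rightarrow> bicriteria" where
  "path_instance m x = instance_of (Suc m) 0 m 0 0 (path_edges m x)"

definition path_code :: "nat \<Rightarrow> nat \<Rightarrow> nat list" where
  "path_code m x = [Suc m, m, 0, m, 0, 0] @ flat (path_edges m x)"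

lemma path_walk:
  "walk (set (path_edges m x)) 0 p v \<longleftrightarrow> v \<le> m \<and> p = path_edges v x"
proof
  show "walk (set (path_edges m x)) 0 p v \<Longrightarrow> v \<le> m \<and> p = path_edges v x"
    by (induction rule: walk.induct) (auto simp: path_edges_def)
  show "v \<le> m \<and> p = path_edges v x \<Longrightarrow> walk (set (path_edges m x)) 0 p v"
  proof (induction v arbitrary: p)
    case (Suc v)
    have "p = path_edges v x @ [(v, Suc v, of_bool (v = x), 0)]" using Suc.prems by (simp add: path_edges_def)
    moreover have "(v, Suc v, of_bool (v = x), 0) \<in> set (path_edges m x)"
      using Suc.prems by (auto simp: path_edges_def)
    ultimately show ?case using Suc by simp
  qed (simp add: path_edges_def)
qed

lemma path_instance:
  "path_instance m x \<in> bicriteria_instances" "num_verts (path_instance m x) = Suc m"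
  "num_lengths (path_instance m x) \<le> 2" "num_costs (path_instance m x) \<le> 2"
  "bicriteria_encoding (path_instance m x) (path_code m x)"
  "has_bicriteria_path (path_instance m x) \<longleftrightarrow> m \<le> x"
proof -
  have d: "distinct (map ends (path_edges m x))" by (simp add: path_edges_def o_def distinct_map inj_on_def)
  have e: "esrc e < Suc m \<and> edst e < Suc m" if "e \<in> set (path_edges m x)" for e
    using that by (auto simp: path_edges_def)
  note inst = instance_of[OF d e, of 0 m 0 0, folded path_instance_def, simplified]
  have c: "card A \<le> 2" if "A \<subseteq> {0, 1 :: nat}" for A
    using card_mono[OF _ that] by simp
  show I: "path_instance m x \<in> bicriteria_instances" "num_verts (path_instance m x) = Suc m"
    using inst by simp_all
  show "num_lengths (path_instance m x) \<le> 2" "num_costs (path_instance m x) \<le> 2"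
    unfolding inst by (intro c; auto simp: path_edges_def)+
  show "bicriteria_encoding (path_instance m x) (path_code m x)"
    using inst(6) by (simp add: path_code_def path_edges_def)
  have "sum_list (map elen (path_edges m x)) = 0 \<longleftrightarrow> m \<le> x" "sum_list (map ecost (path_edges m x)) = 0"
    by (auto simp: path_edges_def)
  then show "has_bicriteria_path (path_instance m x) \<longleftrightarrow> m \<le> x"
    using has_path_iff_walk(1)[OF I(1)] inst by (simp add: within_budgets_def path_walk)
qed

text \<open>Six header words, four words per edge, and the length in the third of them:
  \<open>8 + 4 * x\<close> is the address of the length of edge \<open>x\<close>.\<close>

lemma path_code_agree:
  assumes "a \<noteq> 8 + 4 * x"
  shows "mem (initial (path_code m x)) a = mem (initial (path_code m m)) a"
proof -
  have len: "length (path_code m y) = 6 + 4 * m" for y by (simp add: path_code_def path_edges_def)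
  consider "a < 6" | "6 + 4 * m \<le> a" | b where "a = 6 + b" "b < 4 * m"
    by (metis add.commute add_less_cancel_left le_add_diff_inverse2 not_le)
  then show ?thesis
  proof cases
    case 1
    then have "a = 0 \<or> a = 1 \<or> a = 2 \<or> a = 3 \<or> a = 4 \<or> a = 5" by auto
    then show ?thesis by (auto simp: initial_def len) (auto simp: path_code_def)
  next
    case 3
    define i where "i = b div 4"
    define j where "j = b mod 4"
    have b: "b = 4 * i + j" "i < m" "j < 4" using 3 by (auto simp: i_def j_def)
    have "flat (path_edges m y) ! b = [i, Suc i, of_bool (i = y), 0] ! j" for y
      using nth_flat[of i "path_edges m y" j] b by (simp add: path_edges_def quad_list_def)
    moreover have "j = 2 \<Longrightarrow> i \<noteq> x" using assms 3(1) b(1) by auto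
    moreover have "j = 0 \<or> j = 1 \<or> j = 2 \<or> j = 3" using b(3) by auto
    ultimately show ?thesis using 3 b(2) by (auto simp: initial_def path_code_def path_edges_def nth_append)
  qed (auto simp: initial_def len)
qed

text \<open>A run of fewer than \<open>m\<close> steps on the yes-instance misses the length of some
  edge. Raising this length to 1 makes the budget unattainable but leaves the run unchanged.\<close>

theorem two_weights_lower_bound:
  assumes \<epsilon>: "0 < \<epsilon>" and X: "\<And>m x. path_instance m x \<in> X"
  shows "\<not> solvable_in_time bicriteria_encoding X has_bicriteria_path (\<lambda>I. real (num_verts I) powr (1 - \<epsilon>))"
proof
  assume "solvable_in_time bicriteria_encoding X has_bicriteria_path (\<lambda>I. real (num_verts I) powr (1 - \<epsilon>))"
  then obtain p c where p: "\<And>I xs. I \<in> X \<Longrightarrow> bicriteria_encoding I xs \<Longrightarrow> \<exists>w t \<sigma>. run w p (initial xs) t \<sigma> \<and>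
      real t \<le> c * real (num_verts I) powr (1 - \<epsilon>) \<and> reg \<sigma> 0 = (if has_bicriteria_path I then 1 else 0)"
    unfolding solvable_in_time_def by blast
  have "eventually (\<lambda>m. c * real (Suc m) powr (1 - \<epsilon>) < real m) sequentially"
    using \<epsilon> by real_asymp
  then obtain m where m: "c * real (Suc m) powr (1 - \<epsilon>) < real m"
    by (auto simp: eventually_sequentially)
  obtain w t \<sigma> where run: "run w p (initial (path_code m m)) t \<sigma>" "real t \<le> c * real (Suc m) powr (1 - \<epsilon>)" "reg \<sigma> 0 = 1"
    using p[OF X path_instance(5), of m m] by (auto simp: path_instance)
  from run_reads_only[OF run(1)] obtain A where A: "finite A" "card A \<le> t" "reads_only w p (initial (path_code m m)) t \<sigma> A" by auto
  have "t < m" using run(2) m by linarith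
  have "\<exists>x<m. 8 + 4 * x \<notin> A"
  proof (rule ccontr)
    assume "\<not> ?thesis"
    then have "(\<lambda>x. 8 + 4 * x) ` {..<m} \<subseteq> A" by auto
    then have "card ((\<lambda>x. 8 + 4 * x) ` {..<m}) \<le> card A" by (rule card_mono[OF A(1)])
    moreover have "card ((\<lambda>x. 8 + 4 * x) ` {..<m}) = m" by (subst card_image) (auto simp: inj_on_def)
    ultimately show False using A(2) \<open>t < m\<close> by simp
  qed
  then obtain x where x: "x < m" "8 + 4 * x \<notin> A" by auto
  obtain \<tau> where \<tau>: "run w p (initial (path_code m x)) t \<tau>" "reg \<tau> = reg \<sigma>"
  proof (rule reads_onlyE[OF A(3), of "initial (path_code m x)"])
    show "\<forall>a\<in>A. mem (initial (path_code m x)) a = mem (initial (path_code m m)) a"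
      using x(2) path_code_agree by metis
  qed (auto simp: initial_def in_step_def)
  obtain w' t' \<sigma>' where run': "run w' p (initial (path_code m x)) t' \<sigma>'" "reg \<sigma>' 0 = 0"
    using p[OF X path_instance(5), of m x] x(1) by (auto simp: path_instance)
  \<comment> \<open>The run promised for the changed instance may use another word size; determinism
    holds across word sizes.\<close>
  have "\<sigma>' = \<tau>" using run_deterministic[OF run'(1) \<tau>(1)] by simp
  with \<tau>(2) run(3) run'(2) show False by simp
qed

section \<open>More weights: a reduction from satisfiability\<close>

context ksat_reduction
begin

section \<open>Truth assignments as tuples of block assignments\<close>

lemma literal_code_simps: "literal_code (v, b) div 2 = v" "literal_code (v, b) mod 2 = of_bool b"
  by (auto simp: literal_code_def)

lemma lit_ok_literal: "lit_ok p a (literal_code (v, b)) \<longleftrightarrow> v div blen = p \<and> (bit a (v mod blen) \<longleftrightarrow> b)"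
  unfolding lit_ok_def literal_code_simps unfolding bit_iff_odd_drop_bit mod_2_eq_odd by auto

text \<open>The value of variable \<open>v\<close> is bit \<open>v mod blen\<close> of the
  assignment of block \<open>v div blen\<close>.\<close>

lemma satisfiable_iff:
  "satisfiable (n, set (map set Cs)) \<longleftrightarrow> (\<exists>\<alpha>. (\<forall>p. \<alpha> p < 2 ^ blen) \<and> (\<forall>t\<le>M. \<exists>p<P. satf t p (\<alpha> p)))" (is "?L \<longleftrightarrow> ?R")
proof
  assume ?L
  then obtain A where A: "\<And>C. C \<in> set Cs \<Longrightarrow> \<exists>(v, b)\<in>set C. A v = b" by (auto simp: satisfiable_def)
  define \<alpha> :: "nat \<Rightarrow> nat" where "\<alpha> p = horner_sum of_bool 2 (map (\<lambda>i. A (p * blen + i)) [0..<blen])" for p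
  have "\<alpha> p < 2 ^ blen" for p
    unfolding \<alpha>_def using horner_sum_of_bool_2_less[of "map (\<lambda>i. A (p * blen + i)) [0..<blen]"] by simp
  moreover have bit: "bit (\<alpha> (v div blen)) (v mod blen) \<longleftrightarrow> A v" for v
  proof -
    have "v mod blen < blen" by (simp add: blen_def)
    then show ?thesis by (simp add: \<alpha>_def bit_horner_sum_bit_iff)
  qed
  moreover have "\<exists>p<P. satf t p (\<alpha> p)" if t: "t \<le> M" for t
  proof (cases t)
    case 0
    then show ?thesis using P_pos by (auto simp: satf_def)
  next
    case (Suc i)
    with t have C: "Cs ! i \<in> set Cs" by (simp add: M_def)
    from A[OF this] obtain v b where vb: "(v, b) \<in> set (Cs ! i)" "A v = b" by auto
    then obtain x where x: "x < length (Cs ! i)" "Cs ! i ! x = (v, b)" by (auto simp: in_set_conv_nth)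
    have "v < n" using vb(1) lits[OF C] by auto
    \<comment> \<open>The rounding in \<open>blen\<close> ensures that each variable falls into one
      of the \<open>P\<close> blocks.\<close>
    moreover have "n < blen * P"
    proof -
      have "n mod P < P" using P_pos by simp
      then have "n < (n div P) * P + P" using div_mult_mod_eq[of n P] by linarith
      then show ?thesis by (simp add: blen_def P_def)
    qed
    ultimately have "v div blen < P" by (simp add: less_mult_imp_div_less mult.commute)
    moreover have "satf t (v div blen) (\<alpha> (v div blen))"
      using x bit[of v] vb(2) Suc by (auto simp: satf_def lit_ok_literal intro!: exI[of _ x])
    ultimately show ?thesis by blast
  qed
  ultimately show ?R by blast
next
  assume ?R
  then obtain \<alpha> where \<alpha>: "\<And>t. t \<le> M \<Longrightarrow> \<exists>p<P. satf t p (\<alpha> p)" by blast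
  define A where "A v = bit (\<alpha> (v div blen)) (v mod blen)" for v
  have "\<exists>(v, b)\<in>set C. A v = b" if C: "C \<in> set Cs" for C
  proof -
    from C obtain i where i: "i < M" "Cs ! i = C" by (auto simp: in_set_conv_nth M_def)
    from \<alpha>[of "Suc i"] i obtain p x where x: "x < length C" "lit_ok p (\<alpha> p) (literal_code (C ! x))"
      by (auto simp: satf_def)
    obtain v b where vb: "C ! x = (v, b)" by (cases "C ! x")
    with x have "A v = b" by (auto simp: A_def lit_ok_literal)
    moreover have "(v, b) \<in> set C" using x(1) vb nth_mem by fastforce
    ultimately show ?thesis by blast
  qed
  then show ?L by (auto simp: satisfiable_def)
qed

section \<open>Size of the instance and time of the reduction\<close>

definition U :: nat where "U = J * (H + 1)"

lemma U_pos: "1 \<le> U" "J \<le> U" "H \<le> U" "P \<le> U" "M \<le> U"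
proof -
  show "J \<le> U" "H \<le> U" using JH by (simp_all add: U_def)
  then show "1 \<le> U" "P \<le> U" using DP(3) P_le_J by linarith+
  have "M * 1 \<le> (M + 1) * P" using DP(3) by (rule mult_le_mono[rotated]) simp
  then show "M \<le> U" using \<open>J \<le> U\<close> by (simp add: J_def)
qed

lemma Z_le: "Z \<le> 2 + U * (k + 1)"
  unfolding Z_def using U_pos(5) by (intro add_left_mono mult_le_mono1)

lemma num_verts_U: "vx J 0 0 + 1 = 4 * U + 1"
  by (simp add: U_def vx_def)

text \<open>Since \<open>B <= J * H + J = U\<close>, the weights and all other numbers are
  polynomial in \<open>U\<close> and \<open>n\<close>, which keeps the word size linear in
  \<open>n\<close>.\<close>

lemma lim_le: "lim \<le> (2 * n + k + 62) * U ^ (G + 1)"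
proof -
  have "(M + 1) * (D * H) \<le> (M + 1) * (P * H)" using DP(1) by (intro mult_le_mono) auto
  then have "(M + 1) * D * H \<le> J * H" by (simp only: J_def mult.assoc)
  moreover have "1 \<le> J" using P_le_J DP(3) by linarith
  ultimately have "B \<le> J * H + J" unfolding B_def by linarith
  then have "B \<le> U" by (simp add: U_def)
  then have "B ^ (G + 1) \<le> U ^ (G + 1)" by (rule power_mono) simp
  moreover have u: "U \<le> U ^ (G + 1)" "1 \<le> U ^ (G + 1)" using U_pos(1) by (auto intro!: self_le_power one_le_power)
  moreover have "U * (k + 1) \<le> U ^ (G + 1) * (k + 1)" using u(1) by (rule mult_le_mono1)
  moreover have "2 * n * 1 \<le> 2 * n * U ^ (G + 1)" using u(2) by (rule mult_le_mono2)
  moreover have "lim \<le> 2 * n + (2 + U * (k + 1)) + 36 * U + B ^ (G + 1) + 20"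
    unfolding lim_def U_def[symmetric] using Z_le by linarith
  ultimately have "lim \<le> 2 * n * U ^ (G + 1) + U ^ (G + 1) * (k + 1) + 36 * U ^ (G + 1) + U ^ (G + 1) + 22 * U ^ (G + 1)"
    by linarith
  also have "\<dots> \<le> (2 * n + k + 62) * U ^ (G + 1)" by (simp add: algebra_simps)
  finally show ?thesis .
qed

lemma reduce_time_le: "reduce_time \<le> U * (13 * k + 12 * P + 600 + 3 * (k + 1))"
proof -
  have 1: "J * (ladder_time + 1) = U * (13 * k + 6 * P + 150) + J"
    by (simp add: ladder_time_def U_def algebra_simps)
  have 2: "length output_list \<le> 6 + 36 * U"
    using length_ladders[of J] by (simp add: length_output_list U_def)
  have 3: "6 * P * 1 \<le> 6 * P * U" using U_pos(1) by (rule mult_le_mono2)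
  have arith: "a = x + j \<Longrightarrow> l \<le> 6 + 36 * u \<Longrightarrow> p * 1 \<le> r \<Longrightarrow> z \<le> 2 + y \<Longrightarrow> j \<le> u \<Longrightarrow>
      a + 5 * l + 3 * z + p + 100 \<le> x + u + 5 * (6 + 36 * u) + 3 * (2 + y) + r + 100"
    for a x j l u p r z y :: nat by (intro add_mono) auto
  have "reduce_time \<le> U * (13 * k + 6 * P + 150) + U + 5 * (6 + 36 * U) + 3 * (2 + U * (k + 1)) + 6 * P * U + 100"
    unfolding reduce_time_def by (rule arith[OF 1 2 3 Z_le U_pos(2)])
  also have "\<dots> \<le> U * (13 * k + 12 * P + 600 + 3 * (k + 1))"
    using U_pos(1) by (simp add: algebra_simps)
  finally show ?thesis .
qed

text \<open>\<open>H\<close> contributes \<open>q ^ 2\<close> and, through \<open>Q ^ D\<close>,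
  another \<open>q ^ D\<close>; the polynomially bounded powers of \<open>M + 1\<close> come from
  \<open>J\<close>, \<open>H\<close> and \<open>Q\<close>.\<close>

lemma U_bound: "U \<le> 2 * P * (M + 1) ^ (D + 2) * (2 ^ blen) ^ (D + 2)"
proof -
  have "H + 1 \<le> 2 * H" using H_pos by simp
  then have "U \<le> J * (2 * H)" unfolding U_def by (rule mult_le_mono2)
  also have "\<dots> = 2 * P * (M + 1) ^ (D + 2) * (2 ^ blen) ^ (D + 2)"
    by (simp only: J_def H_def Q_def power_mult_distrib power_add power2_eq_square mult_ac power_one_right)
  finally show ?thesis .
qed

text \<open>The entries are known to fit into every word that holds \<open>lim\<close>; for the
  smallest such word, \<open>2 ^ w\<close> is at most twice \<open>lim\<close>.\<close>

lemma max_output: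
  "Max (insert 0 (set output_list)) \<le> 2 * lim"
proof -
  obtain w where w: "lim < 2 ^ w" "2 ^ w \<le> 2 * lim"
  proof -
    have "\<exists>w. lim < 2 ^ w" using less_exp by blast
    define w where "w = (LEAST w. lim < 2 ^ w)"
    have 1: "lim < 2 ^ w" unfolding w_def using \<open>\<exists>w. lim < 2 ^ w\<close> by (rule LeastI_ex)
    then have "w \<noteq> 0" by (cases w) (auto simp: lim_def)
    then obtain v where v: "w = Suc v" by (cases w) auto
    then have "\<not> lim < 2 ^ v" using not_less_Least[of v "\<lambda>w. lim < 2 ^ w"] by (simp add: w_def)
    then show ?thesis by (intro that[OF 1]) (simp add: v)
  qed
  have "x \<le> 2 * lim" if "x \<in> set output_list" for x
  proof -
    from that obtain i where "i < length output_list" "output_list ! i = x" by (auto simp: in_set_conv_nth)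
    then show ?thesis using output_list_less[OF w(1)] w(2) by fastforce
  qed
  then show ?thesis by simp
qed

lemma length_output_le: "length output_list \<le> lim"
  using length_ladders[of J] unfolding length_output_list lim_def by (simp add: Z_def)

text \<open>The program itself tests for \<open>M = 0\<close>, since the construction presupposes a
  clause.\<close>

lemma reduction_run:
  assumes lim: "lim < 2 ^ w" and r: "run w p (initial output_list) t \<tau>"
  shows "\<exists>u. run w (Load 1 (Imm 0) ;; Load 2 (Imm 1) ;;
    If (Equal (Reg 2) (Imm 0)) (mov 0 (Imm 1)) ((reduce_body G D k ;; clear 30) ;; p)) (initial input) u \<tau> \<and> u \<le> reduce_time + t + 3"
proof -
  let ?\<sigma> = "(initial input)\<lparr>reg := (reg (initial input))(1 := n, 2 := M)\<rparr>"
  have red: "wp w (reduce_body G D k ;; clear 30) (\<lambda>t \<tau>. t \<le> reduce_time \<and> \<tau> = initial output_list) ?\<sigma>"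
    by (rule wp_reduce_body[OF _ _ _ _ lim]) (simp_all add: M0_def, simp add: initial_def)
  have main: "wp w ((reduce_body G D k ;; clear 30) ;; p) (\<lambda>u \<tau>'. u \<le> reduce_time + t \<and> \<tau>' = \<tau>) ?\<sigma>"
    by (rule wp_SeqT[OF red, where b = t]) (use r in \<open>auto simp: wp_def\<close>)
  have m: "mem (initial input) 0 = n" "mem (initial input) (Suc 0) = M" by (simp_all add: initial_def input_def)
  have "M \<le> Z" by (simp add: Z_def)
  then have b: "n < 2 ^ w" "M < 2 ^ w" "Suc 0 < 2 ^ w" using lim by (auto simp: lim_def)
  have "M \<noteq> 0" using pos(4) by simp
  then have "wp w (Load 1 (Imm 0) ;; Load 2 (Imm 1) ;;
    If (Equal (Reg 2) (Imm 0)) (mov 0 (Imm 1)) ((reduce_body G D k ;; clear 30) ;; p))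
    (\<lambda>u \<tau>'. u \<le> reduce_time + t + 3 \<and> \<tau>' = \<tau>) (initial input)"
    unfolding wp_Seq[of w "Load _ _"]
    using b by (simp add: m del: wp_Seq, intro wp_mono[OF main[simplified One_nat_def]]) simp
  then show ?thesis by (auto simp: wp_def)
qed

end

text \<open>With \<open>x = y * (n + 1)\<close>, the inequality
  \<open>(x / K) ^ K <= (1 + x / K) ^ K <= exp x\<close> gives an explicit constant. The base
  \<open>n + 1\<close> accounts for the extra factor \<open>exp y\<close>.\<close>

lemma poly_le_exp:
  assumes "0 < (\<delta> :: real)"
  shows "\<exists>C\<ge>1. \<forall>n::nat. (real n + 1) ^ K \<le> C * 2 powr (\<delta> * real n)"
proof (cases "K = 0")
  case True
  have "1 \<le> 2 powr (\<delta> * real n)" for n using assms by (intro ge_one_powr_ge_zero) auto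
  then show ?thesis using True by (intro exI[of _ 1]) auto
next
  case False
  define y where "y = \<delta> * ln 2"
  have y: "0 < y" using assms by (simp add: y_def)
  define C where "C = max 1 ((real K / y) ^ K * exp y)"
  have "(real n + 1) ^ K \<le> C * 2 powr (\<delta> * real n)" for n
  proof -
    let ?x = "y * (real n + 1)"
    have "0 \<le> ?x" using y by simp
    then have "(?x / real K) ^ K \<le> (1 + ?x / real K) ^ K" by (intro power_mono) auto
    also have "\<dots> \<le> exp ?x"
      using False \<open>0 \<le> ?x\<close> by (intro exp_ge_one_plus_x_over_n_power_n) auto
    finally have "(real K / y) ^ K * (?x / real K) ^ K \<le> (real K / y) ^ K * exp ?x"
      using y by (intro mult_left_mono) auto
    moreover have "(real K / y) ^ K * (?x / real K) ^ K = (real n + 1) ^ K"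
      using y False by (simp flip: power_mult_distrib)
    moreover have "exp ?x = exp y * 2 powr (\<delta> * real n)"
      by (simp add: y_def powr_def algebra_simps exp_add)
    ultimately have "(real n + 1) ^ K \<le> ((real K / y) ^ K * exp y) * 2 powr (\<delta> * real n)" by (simp add: mult.assoc)
    also have "\<dots> \<le> C * 2 powr (\<delta> * real n)" by (intro mult_right_mono) (auto simp: C_def)
    finally show ?thesis .
  qed
  then show ?thesis by (intro exI[of _ C]) (auto simp: C_def)
qed

text \<open>Distinct clauses are images of distinct lists of at most \<open>k\<close> literals. This
  makes the number of rounds polynomial in \<open>n\<close>.\<close>

lemma num_clauses_le:
  assumes d: "distinct (map set Cs)" and c: "\<And>C. C \<in> set Cs \<Longrightarrow> set C \<subseteq> {..<n} \<times> (UNIV :: bool set) \<and> length C \<le> k"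
  shows "length Cs \<le> (2 * n + 1) ^ k"
proof -
  let ?L = "{..<n} \<times> (UNIV :: bool set)"
  have L: "finite ?L" "card ?L = 2 * n" by (simp_all add: card_cartesian_product)
  have "length Cs = card (set (map set Cs))" using distinct_card[OF d] by simp
  also have "\<dots> \<le> card (set ` {xs. set xs \<subseteq> ?L \<and> length xs \<le> k})"
    using c by (intro card_mono finite_imageI finite_lists_length_le L(1)) auto
  also have "\<dots> \<le> card {xs. set xs \<subseteq> ?L \<and> length xs \<le> k}" by (intro card_image_le finite_lists_length_le L(1))
  also have "\<dots> = (\<Sum>i\<le>k. (2 * n) ^ i)" by (simp add: card_lists_length_le[OF L(1)] L(2))
  also have "\<dots> \<le> (2 * n + 1) ^ k"
  proof (induction k)
    case (Suc k)
    have "(2 * n) ^ Suc k \<le> 2 * n * (2 * n + 1) ^ k"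
      unfolding power_Suc by (intro mult_left_mono power_mono) auto
    moreover have e: "(2 * n + 1) ^ Suc k = (2 * n + 1) ^ k + 2 * n * (2 * n + 1) ^ k" by simp
    ultimately show ?case unfolding sum.atMost_Suc e using Suc by (intro add_mono)
  qed simp
  finally show ?thesis .
qed

lemma (in ksat_reduction) U_real:
  assumes M: "M \<le> (2 * n + 1) ^ k"
  shows "real U \<le> (2 * real P * 2 ^ ((k + 1) * (D + 2)) * 2 ^ (D + 2)) * (real n + 1) ^ (k * (D + 2)) *
    2 powr ((1 + 2 / real D) / real G * real n)"
proof -
  have "M + 1 \<le> 2 * (2 * n + 2) ^ k"
  proof -
    have "(2 * n + 1) ^ k \<le> (2 * n + 2) ^ k" by (rule power_mono) auto
    moreover have "1 \<le> (2 * n + 2) ^ k" by simp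
    ultimately show ?thesis using M by linarith
  qed
  also have "\<dots> = 2 ^ (k + 1) * (n + 1) ^ k"
  proof -
    have "2 * n + 2 = 2 * (n + 1)" by simp
    then show ?thesis by (simp only: power_mult_distrib) simp
  qed
  finally have "(M + 1) ^ (D + 2) \<le> (2 ^ (k + 1) * (n + 1) ^ k) ^ (D + 2)" by (rule power_mono) simp
  also have "\<dots> = 2 ^ ((k + 1) * (D + 2)) * (n + 1) ^ (k * (D + 2))" by (simp only: power_mult_distrib power_mult)
  finally have "(M + 1) ^ (D + 2) \<le> 2 ^ ((k + 1) * (D + 2)) * (n + 1) ^ (k * (D + 2))" .
  then have "real ((M + 1) ^ (D + 2)) \<le> real (2 ^ ((k + 1) * (D + 2)) * (n + 1) ^ (k * (D + 2)))" by (simp only: of_nat_le_iff)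
  then have m: "real ((M + 1) ^ (D + 2)) \<le> 2 ^ ((k + 1) * (D + 2)) * (real n + 1) ^ (k * (D + 2))"
    by (simp only: of_nat_mult of_nat_power of_nat_numeral of_nat_add of_nat_1)
  have "real ((2 ^ blen) ^ (D + 2)) = 2 ^ (D + 2) * 2 powr (real (n div P) * real (D + 2))"
  proof -
    have "(2 ^ blen) ^ (D + 2) = (2 ^ (D + 2) * 2 ^ ((n div P) * (D + 2)) :: nat)"
      by (simp only: blen_def P_def power_mult flip: power_mult_distrib) simp
    moreover have "2 powr (real (n div P) * real (D + 2)) = (2 ^ ((n div P) * (D + 2)) :: real)"
      by (simp only: powr_realpow zero_less_numeral flip: of_nat_mult)
    ultimately show ?thesis by (simp only: of_nat_mult of_nat_power of_nat_numeral)
  qed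
  also have "\<dots> \<le> 2 ^ (D + 2) * 2 powr ((1 + 2 / real D) / real G * real n)"
  proof -
    \<comment> \<open>Up to the constant from rounding, \<open>q ^ (D + 2)\<close> has exponent
      \<open>n * (D + 2) / (G * D)\<close>.\<close>
    have "real (n div P) * real (D + 2) \<le> (real n / real P) * real (D + 2)"
      by (intro mult_right_mono of_nat_div_le_of_nat) simp
    also have "\<dots> = (1 + 2 / real D) / real G * real n"
      using GD by (simp add: P_def field_simps)
    finally show ?thesis by (intro mult_left_mono powr_mono) auto
  qed
  finally have b: "real ((2 ^ blen) ^ (D + 2)) \<le> 2 ^ (D + 2) * 2 powr ((1 + 2 / real D) / real G * real n)" .
  have "real U \<le> real (2 * P * (M + 1) ^ (D + 2) * (2 ^ blen) ^ (D + 2))" using U_bound by (simp only: of_nat_le_iff)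
  also have "\<dots> = 2 * real P * real ((M + 1) ^ (D + 2)) * real ((2 ^ blen) ^ (D + 2))" by simp
  also have "\<dots> \<le> 2 * real P * (2 ^ ((k + 1) * (D + 2)) * (real n + 1) ^ (k * (D + 2))) * (2 ^ (D + 2) * 2 powr ((1 + 2 / real D) / real G * real n))"
    using m b by (intro mult_mono mult_left_mono) auto
  finally show ?thesis by (simp add: mult_ac)
qed

text \<open>To refute SETH, one \<open>e\<close> has to work for all \<open>k\<close>. This is
  possible because \<open>D\<close> and \<open>e\<close> depend on \<open>G\<close> and
  \<open>\<epsilon>\<close> only, while \<open>k\<close> enters through polynomial factors and
  constants.\<close>

theorem ksat_from_bicriteria:
  fixes G :: nat and \<epsilon> :: real
  assumes G: "2 \<le> G" and \<epsilon>: "0 < \<epsilon>" "\<epsilon> \<le> 1"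
    and alg: "solvable_in_time bicriteria_encoding {I \<in> bicriteria_instances. num_lengths I \<le> G + 1 \<and> num_costs I \<le> G + 1}
      has_bicriteria_path (\<lambda>I. real (num_verts I) powr (real G - \<epsilon>))"
  shows "\<exists>e>0. \<forall>k. solvable_in_time ksat_encoding (ksat_instances k) satisfiable (\<lambda>(n, F). 2 powr ((1 - e) * real n))"
proof -
  define \<gamma> where "\<gamma> = real G - \<epsilon>"
  define D where "D = nat \<lceil>4 * real G / \<epsilon>\<rceil>"
  define e where "e = \<epsilon> / (4 * real G)"
  \<comment> \<open>The first summand is the exponent of \<open>U\<close>, the second absorbs the
    polynomial factor. As \<open>\<gamma> = G * (1 - 4 * e)\<close> and \<open>D\<close> makes
    \<open>2 / D <= 2 * e\<close>, the exponent \<open>\<kappa> * \<gamma>\<close> is at most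
    \<open>(1 + 2 * e) * (1 - 4 * e) + e = 1 - e - 8 * e ^ 2\<close>.\<close>
  define \<kappa> where "\<kappa> = (1 + 2 / real D) / real G + e / real G"
  have \<gamma>: "1 \<le> \<gamma>" "\<gamma> \<le> real G" using G \<epsilon> by (simp_all add: \<gamma>_def)
  have e: "0 < e" "e \<le> 1 / 2" using G \<epsilon> by (simp_all add: e_def field_simps)
  have D: "4 * real G / \<epsilon> \<le> real D" "0 < D"
  proof -
    show 1: "4 * real G / \<epsilon> \<le> real D" unfolding D_def by linarith
    have "0 < 4 * real G / \<epsilon>" using G \<epsilon> by simp
    with 1 show "0 < D" by linarith
  qed
  have \<kappa>: "0 \<le> \<kappa>" "\<kappa> * \<gamma> \<le> 1 - e"
  proof -
    show "0 \<le> \<kappa>" using e by (simp add: \<kappa>_def)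
    have "2 / real D \<le> 2 / (4 * real G / \<epsilon>)" using D G \<epsilon> by (intro divide_left_mono) auto
    also have "\<dots> = 2 * e" using G \<epsilon> by (simp add: e_def)
    finally have d: "1 + 2 / real D \<le> 1 + 2 * e" by simp
    have g: "\<gamma> / real G = 1 - 4 * e" using G by (simp add: \<gamma>_def e_def diff_divide_distrib)
    have "0 \<le> \<gamma> / real G" "\<gamma> / real G \<le> 1" using \<gamma> G by simp_all
    have "\<kappa> * \<gamma> = (1 + 2 / real D) * (\<gamma> / real G) + e * (\<gamma> / real G)" by (simp add: \<kappa>_def field_simps)
    also have "\<dots> \<le> (1 + 2 * e) * (1 - 4 * e) + e * 1"
      using d e \<open>0 \<le> \<gamma> / real G\<close> \<open>\<gamma> / real G \<le> 1\<close> unfolding g[symmetric]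
      by (intro add_mono mult_right_mono mult_left_mono) auto
    also have "\<dots> \<le> 1 - e" using e by (simp add: algebra_simps)
    finally show "\<kappa> * \<gamma> \<le> 1 - e" .
  qed
  from alg obtain p c where alg: "\<And>I xs. I \<in> bicriteria_instances \<Longrightarrow> num_lengths I \<le> G + 1 \<Longrightarrow> num_costs I \<le> G + 1 \<Longrightarrow>
      bicriteria_encoding I xs \<Longrightarrow> \<exists>w t \<sigma>. run w p (initial xs) t \<sigma> \<and> real t \<le> c * real (num_verts I) powr \<gamma> \<and>
        real w \<le> c * log 2 (2 + real (length xs) + real (Max (insert 0 (set xs))) + real (num_verts I) powr \<gamma>) \<and>
        reg \<sigma> 0 = (if has_bicriteria_path I then 1 else 0)"
    unfolding solvable_in_time_def \<gamma>_def by blast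
  show ?thesis
  proof (intro exI[of _ e] conjI allI)
    fix k
    define Ca where "Ca = 2 * real (G * D) * 2 ^ ((k + 1) * (D + 2)) * 2 ^ (D + 2)"
    from poly_le_exp[of "e / real G" "k * (D + 2)"] e G obtain Cb where
      Cb: "1 \<le> Cb" "\<And>n. (real n + 1) ^ (k * (D + 2)) \<le> Cb * 2 powr (e / real G * real n)" by auto
    define CU where "CU = max 1 (Ca * Cb)"
    define Cl where "Cl = real (k + 64) * CU ^ (G + 1)"
    \<comment> \<open>The numbers of the instance are at most \<open>U ^ (G + 1)\<close> times a
      factor linear in \<open>n\<close>; the final \<open>+ 1\<close> is for this factor, by
      \<open>n + 1 <= 2 ^ n\<close>.\<close>
    define \<kappa>' where "\<kappa>' = \<kappa> * real (G + 1) + 1"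
    define Cw where "Cw = (3 + \<bar>c\<bar> * real (G + 2)) * (log 2 Cl + \<kappa>')"
    define Kt where "Kt = real (13 * k + 12 * (G * D) + 600 + 3 * (k + 1))"
    define Ct where "Ct = (Kt + 3 + \<bar>c\<bar> * 5 powr \<gamma>) * CU powr \<gamma>"
    define Cc where "Cc = 10 + 3 * Cw + Ct"
    have CU: "1 \<le> CU" by (simp add: CU_def)
    then have Cl: "1 \<le> Cl"
      unfolding Cl_def using mult_mono[of 1 "real (k + 64)" 1 "CU ^ (G + 1)"] one_le_power[OF CU, of "G + 1"] by simp
    have \<kappa>': "0 \<le> \<kappa>'" using \<kappa> by (simp add: \<kappa>'_def)
    have Cw: "0 \<le> Cw" using Cl \<kappa>' by (simp add: Cw_def)
    have Ct: "0 \<le> Ct" by (simp add: Ct_def Kt_def)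
    define alg' where "alg' = Load 1 (Imm 0) ;; Load 2 (Imm 1) ;;
      If (Equal (Reg 2) (Imm 0)) (mov 0 (Imm 1)) ((reduce_body G D k ;; clear 30) ;; p)"
    show "solvable_in_time ksat_encoding (ksat_instances k) satisfiable (\<lambda>(n, F). 2 powr ((1 - e) * real n))"
      unfolding solvable_in_time_def
    proof (intro exI[of _ alg'] exI[of _ Cc] ballI allI impI)
      fix x xs assume x: "x \<in> ksat_instances k" "ksat_encoding x xs"
      obtain n F where nF: "x = (n, F)" by (cases x)
      from x(2) obtain Cs where enc: "distinct (map set Cs)" "\<forall>C\<in>set Cs. distinct C" "F = set (map set Cs)"
        "xs = [n, length Cs] @ clause_list Cs"
        unfolding nF ksat_encoding_def clause_list_def by auto
      have lits: "set C \<subseteq> {..<n} \<times> UNIV \<and> length C \<le> k" if "C \<in> set Cs" for C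
        using x(1) that enc(2) distinct_card[of C] unfolding nF ksat_instances_def enc(3) by auto
      define T where "T = 2 powr ((1 - e) * real n)"
      define LB where "LB = log 2 (2 + real (length xs) + real (Max (insert 0 (set xs))) + T)"
      have T: "1 \<le> T" unfolding T_def using e by (intro ge_one_powr_ge_zero) auto
      \<comment> \<open>The admissible word size grows with \<open>log 2 T = (1 - e) * n\<close>,
        which is at least \<open>n / 2\<close>. So words whose number of bits is linear in
        \<open>n\<close> are allowed.\<close>
      have LB: "1 \<le> LB" "real n + 1 \<le> 3 * LB"
      proof -
        show 1: "1 \<le> LB" unfolding LB_def using T by (subst le_log_iff) auto
        have "(1 - e) * real n = log 2 T" by (simp add: T_def)
        also have "\<dots> \<le> LB" unfolding LB_def using T by (subst log_le_cancel_iff) auto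
        finally have "(1 - e) * real n \<le> LB" .
        moreover have "1 / 2 * real n \<le> (1 - e) * real n" using e by (intro mult_right_mono) auto
        ultimately show "real n + 1 \<le> 3 * LB" using 1 by linarith
      qed
      have "\<exists>w t \<sigma>. run w alg' (initial xs) t \<sigma> \<and> real t \<le> Cc * T \<and> real w \<le> Cc * LB \<and>
          reg \<sigma> 0 = (if satisfiable (n, F) then 1 else 0)"
      proof (cases "Cs = []")
        \<comment> \<open>The empty formula is answered by the test for \<open>M = 0\<close>, and
          \<open>n + 1\<close> bits suffice to load \<open>n\<close>.\<close>
        case True
        have "n < 2 ^ n" "(1 :: nat) \<le> 2 ^ n" by simp_all
        then have "n < 2 * 2 ^ n" "Suc 0 < 2 * 2 ^ n" by linarith+
        then have "wp (n + 1) alg' (\<lambda>t \<sigma>. t = 4 \<and> reg \<sigma> 0 = 1) (initial xs)"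
          unfolding alg'_def using True enc(4) by (simp add: initial_def)
        then obtain \<sigma> where "run (n + 1) alg' (initial xs) 4 \<sigma>" "reg \<sigma> 0 = 1" by (auto simp: wp_def)
        moreover have "10 * T \<le> Cc * T" "10 * LB \<le> Cc * LB"
          using T LB Cw Ct by (intro mult_right_mono; simp add: Cc_def)+
        then have "real 4 \<le> Cc * T" "real (n + 1) \<le> Cc * LB" using T LB by linarith+
        moreover have "satisfiable (n, F)" using True enc(3) by (simp add: satisfiable_def)
        ultimately show ?thesis by (intro exI[of _ "n + 1"] exI[of _ 4] exI[of _ \<sigma>]) simp
      next
        case False
        interpret ksat_reduction G D k n Cs
          using G D(2) False lits by unfold_locales auto
        have xs: "xs = input" by (simp add: input_def enc(4) M_def)
        have "M \<le> (2 * n + 1) ^ k" unfolding M_def using num_clauses_le[OF enc(1) lits] by simp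
        note U = U_real[OF this]
        have "real U \<le> Ca * (real n + 1) ^ (k * (D + 2)) * 2 powr ((1 + 2 / real D) / real G * real n)"
          using U by (simp add: Ca_def P_def mult_ac)
        also have "\<dots> \<le> Ca * (Cb * 2 powr (e / real G * real n)) * 2 powr ((1 + 2 / real D) / real G * real n)"
          by (intro mult_right_mono mult_left_mono Cb(2)) (auto simp: Ca_def)
        also have "\<dots> = Ca * Cb * 2 powr (\<kappa> * real n)"
          by (simp add: \<kappa>_def powr_add distrib_right)
        also have "\<dots> \<le> CU * 2 powr (\<kappa> * real n)" by (intro mult_right_mono) (auto simp: CU_def)
        finally have Ub: "real U \<le> CU * 2 powr (\<kappa> * real n)" .
        have U1: "1 \<le> real U" using U_pos(1) by simp
        have UT: "real U powr \<gamma> \<le> CU powr \<gamma> * T"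
        proof -
          have "real U powr \<gamma> \<le> (CU * 2 powr (\<kappa> * real n)) powr \<gamma>" using Ub \<gamma> by (intro powr_mono2) auto
          also have "\<dots> = CU powr \<gamma> * 2 powr (\<kappa> * \<gamma> * real n)" using CU by (simp add: powr_mult powr_powr mult_ac)
          also have "\<dots> \<le> CU powr \<gamma> * T" unfolding T_def using \<kappa>(2)
            by (intro mult_left_mono powr_mono mult_right_mono) auto
          finally show ?thesis .
        qed
        define l where "l = real lim"
        have l20: "20 \<le> l" by (simp add: l_def lim_def)
        have lU: "5 * real U \<le> l" unfolding l_def lim_def U_def[symmetric] by simp
        have logl: "log 2 l \<le> (log 2 Cl + \<kappa>') * (real n + 1)"
        proof -
          have "l \<le> real ((2 * n + k + 62) * U ^ (G + 1))" unfolding l_def using lim_le by (simp only: of_nat_le_iff)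
          also have "\<dots> = (2 * real n + real k + 62) * real U ^ (G + 1)" by simp
          also have "\<dots> \<le> (real (k + 64) * 2 powr (real n)) * (CU * 2 powr (\<kappa> * real n)) ^ (G + 1)"
          proof (intro mult_mono power_mono Ub)
            have "real n + 1 \<le> 2 ^ n"
              using less_exp[of n] by (metis Suc_leI of_nat_Suc of_nat_le_iff of_nat_numeral of_nat_power add.commute)
            then have "real (k + 64) * (real n + 1) \<le> real (k + 64) * 2 powr (real n)"
              by (intro mult_left_mono) (auto simp: powr_realpow)
            moreover have "2 * real n + real k + 62 \<le> real (k + 64) * (real n + 1)" by (simp add: algebra_simps)
            ultimately show "2 * real n + real k + 62 \<le> real (k + 64) * 2 powr (real n)" by linarith
          qed auto
          also have "\<dots> = Cl * 2 powr (\<kappa>' * real n)"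
          proof -
            have "(2 powr (\<kappa> * real n)) ^ (G + 1) = 2 powr (\<kappa> * real (G + 1) * real n)"
              by (subst powr_realpow[symmetric]) (auto simp: powr_powr mult_ac)
            then show ?thesis unfolding Cl_def \<kappa>'_def power_mult_distrib distrib_right powr_add by simp
          qed
          finally have "log 2 l \<le> log 2 (Cl * 2 powr (\<kappa>' * real n))" using l20 Cl by (subst log_le_cancel_iff) auto
          also have "\<dots> = log 2 Cl + \<kappa>' * real n" using Cl by (simp add: log_mult)
          also have "\<dots> \<le> (log 2 Cl + \<kappa>') * (real n + 1)" using Cl \<kappa>' by (simp add: algebra_simps)
          finally show ?thesis .
        qed
        note rc = reduction_correct[OF refl]
        define I where "I = instance_of (vx J 0 0 + 1) 0 (vx J 0 0) Lbud Cbud (ladders J)"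
        have yes: "has_bicriteria_path I \<longleftrightarrow> satisfiable (n, F)"
          unfolding I_def rc(6) enc(3) satisfiable_iff ..
        have N: "real (num_verts I) \<le> 5 * real U" "num_verts I = vx J 0 0 + 1"
          using rc(2) U_pos(1) unfolding I_def num_verts_U by simp_all
        obtain wp t \<sigma> where r: "run wp p (initial output_list) t \<sigma>" "real t \<le> c * real (num_verts I) powr \<gamma>"
          "real wp \<le> c * log 2 (2 + real (length output_list) + real (Max (insert 0 (set output_list))) + real (num_verts I) powr \<gamma>)"
          "reg \<sigma> 0 = (if has_bicriteria_path I then 1 else 0)"
          using alg[OF rc(1) rc(3) rc(4) rc(5)] unfolding I_def output_list_def by blast
        define A where "A = 2 + real (length output_list) + real (Max (insert 0 (set output_list))) + real (num_verts I) powr \<gamma>"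
        \<comment> \<open>The word size of the assumed algorithm is logarithmic in \<open>A\<close>.
          A fixed power of \<open>l\<close> bounds \<open>A\<close>, where \<open>20 <= l\<close>
          absorbs the constants, so it is linear in \<open>log 2 l\<close>.\<close>
        have A: "2 \<le> A" "A \<le> l ^ (G + 2)"
        proof -
          show "2 \<le> A" by (simp add: A_def)
          have "1 \<le> real (num_verts I)" using N(2) by simp
          then have "real (num_verts I) powr \<gamma> \<le> real (num_verts I) powr real G" using \<gamma> by (intro powr_mono) auto
          also have "\<dots> = real (num_verts I) ^ G" using \<open>1 \<le> real (num_verts I)\<close> by (simp add: powr_realpow)
          also have "\<dots> \<le> l ^ G" using N(1) lU by (intro power_mono) auto
          finally have 1: "real (num_verts I) powr \<gamma> \<le> l ^ G" .
          have 2: "1 \<le> l ^ G" using l20 by (intro one_le_power) simp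
          have "real (length output_list) \<le> l" unfolding l_def using length_output_le by simp
          moreover have "real (Max (insert 0 (set output_list))) \<le> real (2 * lim)" using max_output by (simp only: of_nat_le_iff)
          then have "real (Max (insert 0 (set output_list))) \<le> 2 * l" by (simp only: l_def of_nat_mult of_nat_numeral)
          ultimately have "A \<le> 4 * l + l ^ G" using 1 l20 by (simp add: A_def)
          also have "\<dots> \<le> 4 * (l * l ^ G) + l * l ^ G"
          proof -
            have "l * 1 \<le> l * l ^ G" using 2 l20 by (intro mult_left_mono) auto
            moreover have "1 * l ^ G \<le> l * l ^ G" using 2 l20 by (intro mult_right_mono) auto
            ultimately show ?thesis by (intro add_mono mult_left_mono) auto
          qed
          also have "\<dots> = 5 * (l * l ^ G)" by simp
          also have "\<dots> \<le> l * (l * l ^ G)" using l20 2 by (intro mult_right_mono) auto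
          finally show "A \<le> l ^ (G + 2)" by (simp add: power_add power2_eq_square mult_ac)
        qed
        have logA: "log 2 A \<le> real (G + 2) * log 2 l"
        proof -
          have "log 2 A \<le> log 2 (l ^ (G + 2))" using A l20 by (subst log_le_cancel_iff) auto
          also have "\<dots> = real (G + 2) * log 2 l" using l20 by (subst log_nat_power) auto
          finally show ?thesis .
        qed
        obtain w0 where w0: "l ^ 2 \<le> 2 ^ w0" "real w0 \<le> real (2 + 1) * log 2 l"
          using word_exists[of l 2] l20 by auto
        have "l * 1 < l * l" using l20 by (intro mult_strict_left_mono) auto
        then have "l < 2 ^ w0" using w0(1) unfolding power2_eq_square by linarith
        then have lim0: "lim < 2 ^ w0" unfolding l_def by simp
        \<comment> \<open>Both the reduction and the assumed algorithm run at the larger of their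
          word sizes.\<close>
        define w where "w = max w0 wp"
        have limw: "lim < 2 ^ w" unfolding w_def by (rule less_le_trans[OF lim0 power_increasing]) auto
        have rw: "run w p (initial output_list) t \<sigma>" using run_mono[OF r(1)] by (simp add: w_def)
        from reduction_run[OF limw rw] obtain u where u: "run w alg' (initial xs) u \<sigma>" "u \<le> reduce_time + t + 3"
          unfolding alg'_def xs by auto
        have "real w \<le> Cc * LB"
        proof -
          have "0 \<le> log 2 l" using l20 by simp
          have "real wp \<le> c * log 2 A" using r(3) unfolding A_def .
          also have "\<dots> \<le> \<bar>c\<bar> * log 2 A" using A(1) by (intro mult_right_mono) auto
          also have "\<dots> \<le> \<bar>c\<bar> * (real (G + 2) * log 2 l)" using logA by (intro mult_left_mono) auto
          finally have "real wp \<le> \<bar>c\<bar> * real (G + 2) * log 2 l" by (simp add: mult.assoc)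
          moreover have "0 \<le> \<bar>c\<bar> * real (G + 2) * log 2 l" using \<open>0 \<le> log 2 l\<close> by simp
          ultimately have "real w \<le> (3 + \<bar>c\<bar> * real (G + 2)) * log 2 l"
            using w0(2) \<open>0 \<le> log 2 l\<close> unfolding w_def distrib_right by (simp add: max_def)
          also have "\<dots> \<le> (3 + \<bar>c\<bar> * real (G + 2)) * ((log 2 Cl + \<kappa>') * (real n + 1))"
            using logl by (intro mult_left_mono) auto
          also have "\<dots> = Cw * (real n + 1)" by (simp add: Cw_def)
          also have "\<dots> \<le> Cw * (3 * LB)" using LB(2) Cw by (intro mult_left_mono)
          also have "\<dots> = (3 * Cw) * LB" by simp
          also have "\<dots> \<le> Cc * LB" using LB(1) Ct by (intro mult_right_mono) (auto simp: Cc_def)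
          finally show ?thesis .
        qed
        moreover have "real u \<le> Cc * T"
        proof -
          \<comment> \<open>This needs \<open>1 <= \<gamma>\<close>: writing the instance takes time
            linear in \<open>U\<close>, which must stay within the bound for solving it.\<close>
          have UU: "real U \<le> real U powr \<gamma>" using powr_mono[OF \<gamma>(1) U1] U1 by simp
          have "real reduce_time \<le> real (U * (13 * k + 12 * P + 600 + 3 * (k + 1)))"
            using reduce_time_le by (simp only: of_nat_le_iff)
          also have "\<dots> = real U * Kt" by (simp only: Kt_def P_def of_nat_mult)
          also have "\<dots> \<le> real U powr \<gamma> * Kt" using UU by (intro mult_right_mono) (auto simp: Kt_def)
          finally have 1: "real reduce_time \<le> real U powr \<gamma> * Kt" .
          have "real t \<le> \<bar>c\<bar> * real (num_verts I) powr \<gamma>"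
            using r(2) by (rule order_trans) (intro mult_right_mono, auto)
          also have "\<dots> \<le> \<bar>c\<bar> * (5 * real U) powr \<gamma>" using N(1) \<gamma> by (intro mult_left_mono powr_mono2) auto
          also have "\<dots> = \<bar>c\<bar> * (5 powr \<gamma> * real U powr \<gamma>)" by (simp add: powr_mult)
          finally have 2: "real t \<le> real U powr \<gamma> * (\<bar>c\<bar> * 5 powr \<gamma>)" by (simp add: mult_ac)
          have "real u \<le> real reduce_time + real t + 3" using u(2) by linarith
          also have "\<dots> \<le> real U powr \<gamma> * Kt + real U powr \<gamma> * (\<bar>c\<bar> * 5 powr \<gamma>) + real U powr \<gamma> * 3"
            using 1 2 UU U1 by linarith
          also have "\<dots> = (Kt + 3 + \<bar>c\<bar> * 5 powr \<gamma>) * real U powr \<gamma>" by (simp add: algebra_simps)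
          also have "\<dots> \<le> (Kt + 3 + \<bar>c\<bar> * 5 powr \<gamma>) * (CU powr \<gamma> * T)" using UT by (intro mult_left_mono) (auto simp: Kt_def)
          also have "\<dots> = Ct * T" by (simp add: Ct_def)
          also have "\<dots> \<le> Cc * T" using T Cw by (intro mult_right_mono) (auto simp: Cc_def)
          finally show ?thesis .
        qed
        ultimately show ?thesis using u(1) r(4) yes by (intro exI[of _ w] exI[of _ u] exI[of _ \<sigma>]) simp
      qed
      then show "\<exists>w t \<sigma>. run w alg' (initial xs) t \<sigma> \<and>
          real t \<le> Cc * (case x of (n, F) \<Rightarrow> 2 powr ((1 - e) * real n)) \<and>
          real w \<le> Cc * log 2 (2 + real (length xs) + real (Max (insert 0 (set xs))) + (case x of (n, F) \<Rightarrow> 2 powr ((1 - e) * real n))) \<and>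
          reg \<sigma> 0 = (if satisfiable x then 1 else 0)"
        by (simp add: nF T_def LB_def)
    qed
  qed (rule e)
qed

section \<open>Both bounds together\<close>

lemma solvable_in_time_mono:
  assumes "solvable_in_time enc X yes T" "Y \<subseteq> X" "\<And>x. x \<in> Y \<Longrightarrow> 0 \<le> T x \<and> T x \<le> T' x"
  shows "solvable_in_time enc Y yes T'"
proof -
  from assms(1) obtain p c where p: "\<And>x xs. x \<in> X \<Longrightarrow> enc x xs \<Longrightarrow> \<exists>w t \<sigma>. run w p (initial xs) t \<sigma> \<and> real t \<le> c * T x \<and>
      real w \<le> c * log 2 (2 + real (length xs) + real (Max (insert 0 (set xs))) + T x) \<and> reg \<sigma> 0 = (if yes x then 1 else 0)"
    unfolding solvable_in_time_def by blast
  show ?thesis unfolding solvable_in_time_def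
  proof (intro exI[of _ p] exI[of _ "\<bar>c\<bar>"] ballI allI impI)
    fix x xs assume x: "x \<in> Y" "enc x xs"
    define a where "a = 2 + real (length xs) + real (Max (insert 0 (set xs)))"
    from p[of x xs] x assms(2) obtain w t \<sigma> where r: "run w p (initial xs) t \<sigma>" "real t \<le> c * T x"
      "real w \<le> c * log 2 (a + T x)" "reg \<sigma> 0 = (if yes x then 1 else 0)"
      unfolding a_def by blast
    have T: "0 \<le> T x" "T x \<le> T' x" using assms(3) x(1) by auto
    have a: "2 \<le> a" by (simp add: a_def)
    \<comment> \<open>The sign of \<open>c\<close> is unknown; its absolute value makes the bounds
      monotone in the time function, which also occurs in the word size.\<close>
    have "c * T x \<le> \<bar>c\<bar> * T' x" using T by (intro mult_mono) auto
    moreover have "c * log 2 (a + T x) \<le> \<bar>c\<bar> * log 2 (a + T' x)" using T a by (intro mult_mono) auto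
    ultimately show "\<exists>w t \<sigma>. run w p (initial xs) t \<sigma> \<and> real t \<le> \<bar>c\<bar> * T' x \<and>
        real w \<le> \<bar>c\<bar> * log 2 (2 + real (length xs) + real (Max (insert 0 (set xs))) + T' x) \<and> reg \<sigma> 0 = (if yes x then 1 else 0)"
      using r unfolding a_def by (intro exI[of _ w] exI[of _ t] exI[of _ \<sigma>]) auto
  qed
qed

theorem theorem3:
  shows "solvable_in_time bicriteria_encoding bicriteria_instances has_bicriteria_path
      (\<lambda>I. real (num_verts I) ^ (min (num_lengths I) (num_costs I) + 2)) \<and>
    (SETH \<longrightarrow> (\<forall>(lam::nat) (chi::nat) (\<epsilon>::real). lam \<ge> 2 \<longrightarrow> chi \<ge> 2 \<longrightarrow> \<epsilon> > 0 \<longrightarrow>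
      \<not> solvable_in_time bicriteria_encoding
          {I \<in> bicriteria_instances. num_lengths I \<le> lam \<and> num_costs I \<le> chi}
          has_bicriteria_path
          (\<lambda>I. real (num_verts I) powr (real (min lam chi) - 1 - \<epsilon>))))"
proof (intro conjI impI allI notI)
  show "solvable_in_time bicriteria_encoding bicriteria_instances has_bicriteria_path
      (\<lambda>I. real (num_verts I) ^ (min (num_lengths I) (num_costs I) + 2))"
    by (rule bicriteria_upper_bound)
next
  fix lam chi :: nat and \<epsilon> :: real
  let ?X = "{I \<in> bicriteria_instances. num_lengths I \<le> lam \<and> num_costs I \<le> chi}"
  assume SETH and d: "2 \<le> lam" "2 \<le> chi" and \<epsilon>: "0 < \<epsilon>"
    and alg: "solvable_in_time bicriteria_encoding ?X has_bicriteria_path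
      (\<lambda>I. real (num_verts I) powr (real (min lam chi) - 1 - \<epsilon>))"
  show False
  proof (cases "min lam chi = 2")
    \<comment> \<open>A sublinear bound is excluded without any hypothesis on
      satisfiability.\<close>
    case True
    then have e: "real (min lam chi) - 1 - \<epsilon> = 1 - \<epsilon>" by simp
    have "path_instance m x \<in> ?X" for m x
      by (intro CollectI conjI path_instance(1) order_trans[OF path_instance(3) d(1)] order_trans[OF path_instance(4) d(2)])
    from two_weights_lower_bound[OF \<epsilon> this] alg[unfolded e] show False by (rule notE)
  next
    case False
    define G where "G = min lam chi - 1"
    have G: "2 \<le> G" "real (min lam chi) - 1 = real G" "G + 1 \<le> lam" "G + 1 \<le> chi"
      using False d by (auto simp: G_def min_def split: if_splits)
    \<comment> \<open>The larger exponent for a smaller \<open>\<delta>\<close> weakens the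
      assumption, and \<open>\<delta> <= 1\<close> keeps the exponent at least 1, as the reduction
      requires.\<close>
    define \<delta> where "\<delta> = min \<epsilon> 1"
    have \<delta>: "0 < \<delta>" "\<delta> \<le> 1" "\<delta> \<le> \<epsilon>" using \<epsilon> by (auto simp: \<delta>_def)
    have "solvable_in_time bicriteria_encoding {I \<in> bicriteria_instances. num_lengths I \<le> G + 1 \<and> num_costs I \<le> G + 1}
        has_bicriteria_path (\<lambda>I. real (num_verts I) powr (real G - \<delta>))"
    proof (rule solvable_in_time_mono[OF alg])
      fix I assume "I \<in> {I \<in> bicriteria_instances. num_lengths I \<le> G + 1 \<and> num_costs I \<le> G + 1}"
      then have "I \<in> bicriteria_instances" by blast
      then have "pverts (graph I) = {..<num_verts I}" "source I \<in> pverts (graph I)"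
        unfolding bicriteria_instances_def mem_Collect_eq by blast+
      \<comment> \<open>The source guarantees a vertex, so the powers are monotone in the
        exponent.\<close>
      then have "source I < num_verts I" by (simp only: lessThan_iff)
      then have "1 \<le> real (num_verts I)" by linarith
      then show "0 \<le> real (num_verts I) powr (real (min lam chi) - 1 - \<epsilon>) \<and>
          real (num_verts I) powr (real (min lam chi) - 1 - \<epsilon>) \<le> real (num_verts I) powr (real G - \<delta>)"
        unfolding G(2) using \<delta> by (intro conjI powr_mono) auto
    qed (use G in auto)
    from ksat_from_bicriteria[OF G(1) \<delta>(1,2) this] obtain e where "0 < e"
      "\<And>k. solvable_in_time ksat_encoding (ksat_instances k) satisfiable (\<lambda>(n, F). 2 powr ((1 - e) * real n))" by blast
    with \<open>SETH\<close> show False unfolding SETH_def by blast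
  qed
qed

end
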